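(* Let $\Omega\subseteq\mathbb{R}^d$, let $\omega$ be a positive measure on $\Omega$, let $\mathbf{F}:\Omega\to\Omega$ be nonsingular with respect to $\omega$, and let $\mathcal{K}$ be the Koopman operator $\mathcal{K}g=g\circ\mathbf{F}$ on $L^2(\Omega,\omega)$ with domain $\mathcal{D}(\mathcal{K})$. Let $\psi_1,\psi_2,\ldots\in\mathcal{D}(\mathcal{K})$ be linearly independent in $L^2(\Omega,\omega)$, let $V_N=\mathrm{span}\{\psi_1,\ldots,\psi_N\}$, and let $\mathcal{P}_N:L^2(\Omega,\omega)\rightarrow V_N$ be the corresponding orthogonal projection. Suppose that: (i) $\mathcal{P}_N^*\mathcal{P}_N$ converges strongly to the identity as $N\to\infty$; (ii) the Koopman operator $\mathcal{K}$ is self-adjoint; (iii) the quadrature rule converges, i.e. for all $N$ and all $1\le j,k\le N$, the matrices $\mathbf{G}$ and $\mathbf{A}$ (defined in the context, and depending on $N$ and $M$) satisfy $$\lim_{M\rightarrow\infty}\mathbf{G}_{jk} = \langle \psi_k,\psi_j \rangle,\qquad \lim_{M\rightarrow\infty}\mathbf{A}_{jk} = \langle \mathcal{K}\psi_k,\psi_j \rangle;$$ (iv) $\displaystyle \mathcal{K}u= \lim_{N\rightarrow\infty}\mathcal{P}_N\mathcal{K}\mathcal{P}_N^*\mathcal{P}_N u$ for all $u\in\mathcal{D}(\mathcal{K})$. Then, for any observable $g\in L^2(\Omega,\omega)$ whose computed coefficient vectors $\mathbf{g}_{N,M}$ (defined in the context) satisfy, for each $N$, $\lim_{M\to\infty}\mathbf{g}_{N,M}=\mathbf{g}_N$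 where $\mathbf{g}_N\in\mathbb{C}^N$ is the vector with $\mathcal{P}_Ng=\mathbf{\Psi}\mathbf{g}_N$, and for any bounded continuous function $f$ on $\mathbb{R}$, $$\lim_{N\rightarrow\infty}\lim_{M\rightarrow\infty} \int_{\mathbb{R}} f(\lambda)\,\mathrm{d} \mu_{\mathbf{g}_{N,M}}^{(M)}(\lambda)= \int_{\mathbb{R}} f(\lambda)\,\mathrm{d} \mu_g(\lambda),$$ where $\mu_{\mathbf{g}_{N,M}}^{(M)}$ is the spectral measure of $\mathbf{\Psi}\mathbf{g}_{N,M}$ with respect to the Hermitian DMD matrix, and $\mu_g$ is the spectral measure of $\mathcal{K}$ with respect to $g$.
   Context: Koopman setting. $L^2(\Omega,\omega)$ carries the inner product $\langle g_1,g_2\rangle=\int_\Omega g_1\overline{g_2}\,\mathrm{d}\omega$. Nonsingularity of $\mathbf{F}$ means that $\omega(E)=0$ implies $\omega(\{\mathbf{x}:\mathbf{F}(\mathbf{x})\in E\})=0$, so that $[\mathcal{K}g](\mathbf{x})=g(\mathbf{F}(\mathbf{x}))$ is well defined on equivalence classes. The projection $\mathcal{P}_N$ is a map onto $V_N$, and $\mathcal{P}_N^*:V_N\to L^2(\Omega,\omega)$ is the inclusion; elements of $V_N$ are identified with elements of $L^2(\Omega,\omega)$ where needed. Data. For each $M$ one is given quadrature nodes $\mathbf{x}^{(1)},\ldots,\mathbf{x}^{(M)}\in\Omega$, nonnegative weights $w_1,\ldots,w_M$ (nodes and weights may depend on $M$), and $\mathbf{y}^{(m)}=\mathbf{F}(\mathbf{x}^{(m)})$.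 Fix pointwise-defined representatives of the $\psi_j$ and of $g$. Put $\mathbf{\Psi}(\mathbf{x})=[\psi_1(\mathbf{x})\ \cdots\ \psi_N(\mathbf{x})]\in\mathbb{C}^{1\times N}$, and for $\mathbf{h}\in\mathbb{C}^N$ write $\mathbf{\Psi}\mathbf{h}=\sum_{j=1}^N\psi_j\mathbf{h}_j$. Let $\mathbf{W}=\mathrm{diag}(w_1,\ldots,w_M)$, and let $\mathbf{\Psi}_X,\mathbf{\Psi}_Y\in\mathbb{C}^{M\times N}$ be the matrices with $m$-th rows $\mathbf{\Psi}(\mathbf{x}^{(m)})$ and $\mathbf{\Psi}(\mathbf{y}^{(m)})$, respectively. Define $$\mathbf{G}=\mathbf{\Psi}_X^*\mathbf{W}\mathbf{\Psi}_X,\qquad \mathbf{A}=\mathbf{\Psi}_X^*\mathbf{W}\mathbf{\Psi}_Y\qquad(\text{both in }\mathbb{C}^{N\times N}).$$ It is assumed that $\mathbf{W}^{1/2}\mathbf{\Psi}_X$ has rank $N$ (for each $N$ and all sufficiently large $M$), so that $\mathbf{G}$ is positive definite. Hermitian DMD matrix. It is $$\mathbf{K}=\mathbf{G}^{-1}\left(\frac{\mathbf{A}+\mathbf{A}^*}{2}\right)\in\mathbb{C}^{N\times N},$$ which is the minimizer of $\|\mathbf{W}^{1/2}\mathbf{\Psi}_Y\mathbf{G}^{-1/2}-\mathbf{W}^{1/2}\mathbf{\Psi}_X\mathbf{K}\mathbf{G}^{-1/2}\|_{\mathrm{F}}^2$ (Frobenius norm) over $\mathbf{K}\in\mathbb{C}^{N\times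 N}$ with $\mathbf{G}\mathbf{K}=\mathbf{K}^*\mathbf{G}$. It is self-adjoint on $\mathbb{C}^N$ with respect to the inner product $(\mathbf{h}_1,\mathbf{h}_2)\mapsto\mathbf{h}_2^*\mathbf{G}\mathbf{h}_1$, which approximates $\langle\mathbf{\Psi}\mathbf{h}_1,\mathbf{\Psi}\mathbf{h}_2\rangle$. Coefficient vectors. For $g\in L^2(\Omega,\omega)$, $$\mathbf{g}_{N,M}= (\mathbf{W}^{1/2}\mathbf{\Psi}_X)^{\dagger}\mathbf{W}^{1/2}\left(g(\mathbf{x}^{(1)}),\ldots,g(\mathbf{x}^{(M)})\right)^\top\in\mathbb{C}^N,$$ where $\dagger$ denotes the Moore--Penrose pseudoinverse. Spectral measures. $\mu_g(B)=\langle\mathcal{E}(B)g,g\rangle$ for Borel $B\subset\mathbb{R}$, where $\mathcal{E}$ is the projection-valued spectral measure of the self-adjoint operator $\mathcal{K}$. The measure $\mu^{(M)}_{\mathbf{g}_{N,M}}$ is the spectral measure of $\mathbf{K}$, viewed as a self-adjoint operator on $\mathbb{C}^N$ with the inner product induced by $\mathbf{G}$, with respect to the vector $\mathbf{g}_{N,M}$. That is, $\mu^{(M)}_{\mathbf{g}_{N,M}}=\sum_{\lambda}(\mathbf{g}_{N,M}^*\mathbf{G}\mathbf{E}_\lambda\mathbf{g}_{N,M})\,\delta_\lambda$, the sum being over the distinct eigenvalues $\lambda$ of $\mathbf{K}$, with $\mathbf{E}_\lambda$ the $\mathbf{G}$-orthogonal projection onto the eigenspace of $\lambda$. *)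

theory Defs
  imports
    "HOL-Analysis.Analysis"
    "Jordan_Normal_Form.Char_Poly"
    "Jordan_Normal_Form.Gauss_Jordan_Elimination"
    "Jordan_Normal_Form.Schur_Decomposition"
    "Jordan_Normal_Form.DL_Rank"
begin

section \<open>The Hilbert space of square-integrable functions\<close>

text \<open>
  Elements of the \<open>L\<^sup>2\<close> space are represented by square-integrable functions;
  equality of elements is equality almost everywhere, and convergence is convergence
  in the seminorm \<open>L2_norm\<close>.
\<close>

definition L2 :: "'a measure \<Rightarrow> ('a \<Rightarrow> complex) set" where
  "L2 \<omega> = {g \<in> borel_measurable \<omega>. integrable \<omega> (\<lambda>x. (cmod (g x))\<^sup>2)}"

definition L2_inner :: "'a measure \<Rightarrow> ('a \<Rightarrow> complex) \<Rightarrow> ('a \<Rightarrow> complex) \<Rightarrow> complex" where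
  "L2_inner \<omega> g h = (LINT x|\<omega>. g x * cnj (h x))"

definition L2_norm :: "'a measure \<Rightarrow> ('a \<Rightarrow> complex) \<Rightarrow> real" where
  "L2_norm \<omega> g = sqrt (LINT x|\<omega>. (cmod (g x))\<^sup>2)"

definition L2_tendsto ::
  "'a measure \<Rightarrow> (nat \<Rightarrow> 'a \<Rightarrow> complex) \<Rightarrow> ('a \<Rightarrow> complex) \<Rightarrow> bool" where
  "L2_tendsto \<omega> u v \<longleftrightarrow> (\<lambda>n. L2_norm \<omega> (\<lambda>x. u n x - v x)) \<longlonglongrightarrow> 0"

text \<open>
  A (possibly unbounded) linear operator with domain \<open>D\<close>. Both \<open>D\<close> and \<open>T\<close> are
  required to be compatible with almost-everywhere equality.
\<close>

definition L2_operator ::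
  "'a measure \<Rightarrow> ('a \<Rightarrow> complex) set \<Rightarrow> (('a \<Rightarrow> complex) \<Rightarrow> 'a \<Rightarrow> complex) \<Rightarrow> bool" where
  "L2_operator \<omega> D T \<longleftrightarrow>
     D \<subseteq> L2 \<omega> \<and> (\<lambda>_. 0) \<in> D \<and> T ` D \<subseteq> L2 \<omega> \<and>
     (\<forall>g\<in>D. \<forall>h\<in>L2 \<omega>. (AE x in \<omega>. g x = h x) \<longrightarrow> h \<in> D \<and> (AE x in \<omega>. T g x = T h x)) \<and>
     (\<forall>g\<in>D. \<forall>h\<in>D. \<forall>a b. (\<lambda>x. a * g x + b * h x) \<in> D \<and>
        (AE x in \<omega>. T (\<lambda>x. a * g x + b * h x) x = a * T g x + b * T h x))"

definition L2_dense :: "'a measure \<Rightarrow> ('a \<Rightarrow> complex) set \<Rightarrow> bool" where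
  "L2_dense \<omega> D \<longleftrightarrow> (\<forall>g\<in>L2 \<omega>. \<forall>\<epsilon>>0. \<exists>h\<in>D. L2_norm \<omega> (\<lambda>x. g x - h x) < \<epsilon>)"

definition L2_adjoint_graph ::
  "'a measure \<Rightarrow> ('a \<Rightarrow> complex) set \<Rightarrow> (('a \<Rightarrow> complex) \<Rightarrow> 'a \<Rightarrow> complex) \<Rightarrow>
   (('a \<Rightarrow> complex) \<times> ('a \<Rightarrow> complex)) set" where
  "L2_adjoint_graph \<omega> D T =
     {(h, k). h \<in> L2 \<omega> \<and> k \<in> L2 \<omega> \<and> (\<forall>g\<in>D. L2_inner \<omega> (T g) h = L2_inner \<omega> g k)}"

definition L2_selfadjoint ::
  "'a measure \<Rightarrow> ('a \<Rightarrow> complex) set \<Rightarrow> (('a \<Rightarrow> complex) \<Rightarrow> 'a \<Rightarrow> complex) \<Rightarrow> bool" where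
  "L2_selfadjoint \<omega> D T \<longleftrightarrow>
     L2_operator \<omega> D T \<and> L2_dense \<omega> D \<and>
     L2_adjoint_graph \<omega> D T = {(h, k). h \<in> D \<and> k \<in> L2 \<omega> \<and> (AE x in \<omega>. k x = T h x)}"

text \<open>
  The orthogonal projection of \<open>u\<close> onto the subspace \<open>V\<close>, followed by the inclusion;
  the choice of representative is immaterial.
\<close>

definition L2_proj ::
  "'a measure \<Rightarrow> ('a \<Rightarrow> complex) set \<Rightarrow> ('a \<Rightarrow> complex) \<Rightarrow> 'a \<Rightarrow> complex" where
  "L2_proj \<omega> V u = (SOME v. v \<in> V \<and> (\<forall>v'\<in>V. L2_inner \<omega> (\<lambda>x. u x - v x) v' = 0))"


section \<open>Projection-valued spectral measures\<close>

definition L2_orthogonal_projection ::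
  "'a measure \<Rightarrow> (('a \<Rightarrow> complex) \<Rightarrow> 'a \<Rightarrow> complex) \<Rightarrow> bool" where
  "L2_orthogonal_projection \<omega> P \<longleftrightarrow>
     L2_operator \<omega> (L2 \<omega>) P \<and>
     (\<forall>g\<in>L2 \<omega>. AE x in \<omega>. P (P g) x = P g x) \<and>
     (\<forall>g\<in>L2 \<omega>. \<forall>h\<in>L2 \<omega>. L2_inner \<omega> (P g) h = L2_inner \<omega> g (P h))"

definition projection_valued_measure ::
  "'a measure \<Rightarrow> (real set \<Rightarrow> ('a \<Rightarrow> complex) \<Rightarrow> 'a \<Rightarrow> complex) \<Rightarrow> bool" where
  "projection_valued_measure \<omega> E \<longleftrightarrow>
     (\<forall>B\<in>sets borel. L2_orthogonal_projection \<omega> (E B)) \<and>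
     (\<forall>g\<in>L2 \<omega>. AE x in \<omega>. E {} g x = 0) \<and>
     (\<forall>g\<in>L2 \<omega>. AE x in \<omega>. E UNIV g x = g x) \<and>
     (\<forall>B\<in>sets borel. \<forall>C\<in>sets borel. \<forall>g\<in>L2 \<omega>. AE x in \<omega>. E (B \<inter> C) g x = E B (E C g) x) \<and>
     (\<forall>B. range B \<subseteq> sets borel \<longrightarrow> disjoint_family B \<longrightarrow>
        (\<forall>g\<in>L2 \<omega>. L2_tendsto \<omega> (\<lambda>n x. \<Sum>i<n. E (B i) g x) (E (\<Union>i::nat. B i) g)))"

definition scalar_spectral_measure ::
  "'a measure \<Rightarrow> (real set \<Rightarrow> ('a \<Rightarrow> complex) \<Rightarrow> 'a \<Rightarrow> complex) \<Rightarrow> ('a \<Rightarrow> complex) \<Rightarrow> real measure"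
  where
  "scalar_spectral_measure \<omega> E g =
     measure_of UNIV (sets borel) (\<lambda>B. ennreal (Re (L2_inner \<omega> (E B g) g)))"

text \<open>
  \<open>T = \<integral> \<lambda> d\<E>(\<lambda>)\<close>, understood in the usual quadratic-form sense: with
  \<open>\<mu>\<^sub>g(B) = \<langle>\<E>(B) g, g\<rangle>\<close>, the domain of \<open>T\<close> consists of the \<open>g\<close> with
  \<open>\<integral> \<lambda>\<^sup>2 d\<mu>\<^sub>g < \<infinity>\<close>, and \<open>\<langle>T g, g\<rangle> = \<integral> \<lambda> d\<mu>\<^sub>g\<close> there, which determines \<open>T\<close> by
  polarization. By the spectral theorem, every self-adjoint \<open>T\<close> has exactly one such
  \<open>\<E>\<close>, up to null sets.
\<close>

definition spectral_measure_of ::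
  "'a measure \<Rightarrow> ('a \<Rightarrow> complex) set \<Rightarrow> (('a \<Rightarrow> complex) \<Rightarrow> 'a \<Rightarrow> complex) \<Rightarrow>
   (real set \<Rightarrow> ('a \<Rightarrow> complex) \<Rightarrow> 'a \<Rightarrow> complex) \<Rightarrow> bool" where
  "spectral_measure_of \<omega> D T E \<longleftrightarrow>
     projection_valued_measure \<omega> E \<and>
     D = {g \<in> L2 \<omega>. integrable (scalar_spectral_measure \<omega> E g) (\<lambda>l. l\<^sup>2)} \<and>
     (\<forall>g\<in>D. L2_inner \<omega> (T g) g =
        complex_of_real (LINT l|scalar_spectral_measure \<omega> E g. l))"


section \<open>Koopman operator and dictionary\<close>

definition nonsingular_map :: "'a measure \<Rightarrow> ('a \<Rightarrow> 'a) \<Rightarrow> bool" where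
  "nonsingular_map \<omega> F \<longleftrightarrow>
     F \<in> measurable \<omega> \<omega> \<and>
     (\<forall>S\<in>sets \<omega>. emeasure \<omega> S = 0 \<longrightarrow> emeasure \<omega> (F -` S \<inter> space \<omega>) = 0)"

definition koopman :: "('a \<Rightarrow> 'a) \<Rightarrow> ('a \<Rightarrow> complex) \<Rightarrow> 'a \<Rightarrow> complex" where
  "koopman F g = (\<lambda>x. g (F x))"

text \<open>
  Dictionaries are indexed from \<open>0\<close>: the functions \<open>\<psi> 0, \<dots>, \<psi> (N - 1)\<close> span the
  \<open>N\<close>-dimensional space \<open>V\<^sub>N\<close>. Likewise, the quadrature nodes and weights of a rule
  with \<open>M\<close> points are indexed by \<open>0, \<dots>, M - 1\<close>.
\<close>

definition dict_comb :: "(nat \<Rightarrow> 'a \<Rightarrow> complex) \<Rightarrow> complex Matrix.vec \<Rightarrow> 'a \<Rightarrow> complex" where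
  "dict_comb \<psi> h = (\<lambda>x. \<Sum>j<dim_vec h. \<psi> j x * vec_index h j)"

definition dict_span :: "(nat \<Rightarrow> 'a \<Rightarrow> complex) \<Rightarrow> nat \<Rightarrow> ('a \<Rightarrow> complex) set" where
  "dict_span \<psi> N = dict_comb \<psi> ` carrier_vec N"

definition L2_lin_indep :: "'a measure \<Rightarrow> (nat \<Rightarrow> 'a \<Rightarrow> complex) \<Rightarrow> bool" where
  "L2_lin_indep \<omega> \<psi> \<longleftrightarrow>
     (\<forall>N. \<forall>h\<in>carrier_vec N. (AE x in \<omega>. dict_comb \<psi> h x = 0) \<longrightarrow> h = 0\<^sub>v N)"


section \<open>Hermitian dynamic mode decomposition\<close>

definition pinv :: "complex Matrix.mat \<Rightarrow> complex Matrix.mat" where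
  "pinv B = (THE X. X \<in> carrier_mat (dim_col B) (dim_row B) \<and>
     B * X * B = B \<and> X * B * X = X \<and>
     mat_adjoint (B * X) = B * X \<and> mat_adjoint (X * B) = X * B)"

definition dict_mat ::
  "(nat \<Rightarrow> 'a \<Rightarrow> complex) \<Rightarrow> (nat \<Rightarrow> 'a) \<Rightarrow> nat \<Rightarrow> nat \<Rightarrow> complex Matrix.mat" where
  "dict_mat \<psi> z M N = Matrix.mat M N (\<lambda>(m, j). \<psi> j (z m))"

definition weight_mat :: "(nat \<Rightarrow> real) \<Rightarrow> nat \<Rightarrow> complex Matrix.mat" where
  "weight_mat w M = mat_diag M (\<lambda>m. complex_of_real (w m))"

definition sqrt_weight_mat :: "(nat \<Rightarrow> real) \<Rightarrow> nat \<Rightarrow> complex Matrix.mat" where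
  "sqrt_weight_mat w M = mat_diag M (\<lambda>m. complex_of_real (sqrt (w m)))"

definition dmd_G ::
  "(nat \<Rightarrow> 'a \<Rightarrow> complex) \<Rightarrow> (nat \<Rightarrow> 'a) \<Rightarrow> (nat \<Rightarrow> real) \<Rightarrow> nat \<Rightarrow> nat \<Rightarrow> complex Matrix.mat" where
  "dmd_G \<psi> x w N M =
     mat_adjoint (dict_mat \<psi> x M N) * weight_mat w M * dict_mat \<psi> x M N"

definition dmd_A ::
  "(nat \<Rightarrow> 'a \<Rightarrow> complex) \<Rightarrow> ('a \<Rightarrow> 'a) \<Rightarrow> (nat \<Rightarrow> 'a) \<Rightarrow> (nat \<Rightarrow> real) \<Rightarrow> nat \<Rightarrow> nat \<Rightarrow>
   complex Matrix.mat" where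
  "dmd_A \<psi> F x w N M =
     mat_adjoint (dict_mat \<psi> x M N) * weight_mat w M * dict_mat \<psi> (\<lambda>m. F (x m)) M N"

definition hermitian_dmd ::
  "(nat \<Rightarrow> 'a \<Rightarrow> complex) \<Rightarrow> ('a \<Rightarrow> 'a) \<Rightarrow> (nat \<Rightarrow> 'a) \<Rightarrow> (nat \<Rightarrow> real) \<Rightarrow> nat \<Rightarrow> nat \<Rightarrow>
   complex Matrix.mat" where
  "hermitian_dmd \<psi> F x w N M =
     the (mat_inverse (dmd_G \<psi> x w N M)) *
       ((1 / 2) \<cdot>\<^sub>m (dmd_A \<psi> F x w N M + mat_adjoint (dmd_A \<psi> F x w N M)))"

definition coeff_vec ::
  "(nat \<Rightarrow> 'a \<Rightarrow> complex) \<Rightarrow> (nat \<Rightarrow> 'a) \<Rightarrow> (nat \<Rightarrow> real) \<Rightarrow> ('a \<Rightarrow> complex) \<Rightarrow> nat \<Rightarrow> nat \<Rightarrow>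
   complex Matrix.vec" where
  "coeff_vec \<psi> x w g N M =
     pinv (sqrt_weight_mat w M * dict_mat \<psi> x M N) *\<^sub>v
       (sqrt_weight_mat w M *\<^sub>v Matrix.vec M (\<lambda>m. g (x m)))"

definition eigenspace :: "complex Matrix.mat \<Rightarrow> complex \<Rightarrow> complex Matrix.vec set" where
  "eigenspace K l = {v \<in> carrier_vec (dim_row K). K *\<^sub>v v = l \<cdot>\<^sub>v v}"

text \<open>\<open>(h\<^sub>1, h\<^sub>2) \<mapsto> h\<^sub>2\<^sup>* G h\<^sub>1\<close>\<close>

definition G_inner ::
  "complex Matrix.mat \<Rightarrow> complex Matrix.vec \<Rightarrow> complex Matrix.vec \<Rightarrow> complex" where
  "G_inner G h1 h2 = (G *\<^sub>v h1) \<bullet>c h2"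

definition G_eigenprojection ::
  "complex Matrix.mat \<Rightarrow> complex Matrix.mat \<Rightarrow> complex \<Rightarrow> complex Matrix.mat" where
  "G_eigenprojection G K l = (THE P. P \<in> carrier_mat (dim_row K) (dim_row K) \<and>
     (\<forall>h\<in>carrier_vec (dim_row K). P *\<^sub>v h \<in> eigenspace K l \<and>
        (\<forall>u\<in>eigenspace K l. G_inner G (h - P *\<^sub>v h) u = 0)))"

text \<open>
  The Borel measure \<open>\<Sum>\<^sub>\<lambda> (g\<^sup>* G E\<^sub>\<lambda> g) \<delta>\<^sub>\<lambda>\<close>, the sum ranging over the distinct
  eigenvalues of \<open>K\<close>. It is only used for \<open>K\<close> self-adjoint with respect to
  \<open>G_inner G\<close> and \<open>G\<close> positive definite, where all eigenvalues and weights are real.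
\<close>

definition matrix_spectral_measure ::
  "complex Matrix.mat \<Rightarrow> complex Matrix.mat \<Rightarrow> complex Matrix.vec \<Rightarrow> real measure" where
  "matrix_spectral_measure G K g =
     distr
       (point_measure {l. eigenvalue K (complex_of_real l)}
         (\<lambda>l. ennreal (Re (G_inner G (G_eigenprojection G K (complex_of_real l) *\<^sub>v g) g))))
       borel (\<lambda>l. l)"

end

theory Submission
  imports Defs "HOL-Probability.Weak_Convergence" "Jordan_Normal_Form.Jordan_Normal_Form_Existence"
begin

text \<open>
  Both limits rest on one inequality about a matrix \<open>K\<close> that is self-adjoint for the inner
  product of a positive definite \<open>G\<close> (\<open>spectral_integral_approx\<close>). Split a vector as
  \<open>v = r + \<Sum>\<^sub>j u\<^sub>j\<close> and attach a real \<open>a\<^sub>j\<close> to each \<open>u\<^sub>j\<close>. If \<open>f\<close> has values in \<open>[0, 1]\<close> and is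
  \<open>L\<close>-Lipschitz, the integral of \<open>f\<close> against the spectral measure of \<open>v\<close> differs from
  \<open>\<Sum>\<^sub>j f(a\<^sub>j) Re \<langle>u\<^sub>j, v\<rangle>\<close> by at most \<open>(\<parallel>r\<parallel> + L \<Sum>\<^sub>j \<parallel>(K - a\<^sub>j) u\<^sub>j\<parallel>) \<parallel>v\<parallel>\<close>. Nothing about the spectrum of
  \<open>K\<close> occurs in this bound, only how \<open>K\<close> acts on finitely many vectors, and that is what
  the hypotheses control.

  In the limit \<open>M \<rightarrow> \<infinity>\<close> (\<open>hermitian_dmd_spectral_measure_tendsto\<close>), the quadrature matrices
  converge entrywise to the Gram matrix of the dictionary and to the compression of the
  operator. Take for \<open>u\<^sub>j\<close> the eigencomponents of the limiting coefficient vector, and for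
  \<open>a\<^sub>j\<close> the eigenvalues: all error terms tend to zero.

  In the limit \<open>N \<rightarrow> \<infinity>\<close> (\<open>galerkin_spectral_measure_tendsto\<close>), cut \<open>[-k, k)\<close> into \<open>2k\<^sup>4\<close> bands of
  width \<open>k\<^sup>-\<^sup>3\<close> and let \<open>u\<^sub>j\<close> be the coefficients of the projection of \<open>E(band\<^sub>j) g\<close>. By
  hypothesis (iv) the defect \<open>(K - a\<^sub>j) u\<^sub>j\<close> converges to \<open>(T - a\<^sub>j) E(band\<^sub>j) g\<close>, whose norm is at most
  \<open>k\<^sup>-\<^sup>3 \<parallel>E(band\<^sub>j) g\<parallel>\<close> (\<open>spectral_band\<close>). The components are orthogonal, so by Cauchy--Schwarz their
  norms add up to at most \<open>\<surd>2 k\<^sup>2 \<parallel>g\<parallel>\<close>, and the total error is \<open>O(1/k)\<close> plus the part of \<open>g\<close>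
  outside \<open>[-k, k)\<close>.

  Passing from Lipschitz test functions to bounded continuous ones is a general fact
  about finite measures (\<open>weak_convergence_from_lipschitz\<close>).
\<close>

unbundle no vec_syntax

section \<open>Weak convergence from Lipschitz test functions\<close>

lemma cts_step_bounds: "x < y \<Longrightarrow> 0 \<le> cts_step x y t" "x < y \<Longrightarrow> cts_step x y t \<le> 1"
  by (auto simp: cts_step_def divide_simps)

lemma cts_step_lipschitz:
  assumes "x < y"
  shows "(1 / (y - x))-lipschitz_on UNIV (cts_step x y)"
proof (rule lipschitz_onI)
  fix s t :: real
  have eq: "cts_step x y u = (y - max x (min y u)) / (y - x)" for u
    using assms by (auto simp: cts_step_def max_def min_def)
  have "\<bar>max x (min y s) - max x (min y t)\<bar> \<le> \<bar>s - t\<bar>" by linarith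
  then show "dist (cts_step x y s) (cts_step x y t) \<le> 1 / (y - x) * dist s t"
    using assms unfolding eq dist_real_def
    by (simp add: diff_divide_distrib[symmetric] abs_divide divide_right_mono abs_minus_commute)
qed (use assms in auto)

lemma integral_density_const:
  fixes f :: "'a \<Rightarrow> 'b::{banach, second_countable_topology}"
  assumes "f \<in> borel_measurable M" "0 \<le> c"
  shows "(LINT t|density M (\<lambda>_. ennreal c). f t) = c *\<^sub>R (LINT t|M. f t)"
  using assms by (simp add: integral_density)

text \<open>
  The function \<open>1\<close> is admissible, so the total masses converge. If the limit measure is
  zero, that already settles the claim; otherwise normalise to probability measures, for
  which piecewise linear steps determine weak convergence.
\<close>

lemma weak_convergence_from_lipschitz:
  fixes \<mu> :: "nat \<Rightarrow> real measure" and \<nu> :: "real measure"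
    and f :: "real \<Rightarrow> 'b::{banach, second_countable_topology}"
  assumes fin: "\<forall>\<^sub>F n in sequentially. finite_measure (\<mu> n) \<and> sets (\<mu> n) = sets borel"
    and fin': "finite_measure \<nu>" "sets \<nu> = sets borel"
    and conv: "\<And>h L. L-lipschitz_on UNIV h \<Longrightarrow> (\<And>t. 0 \<le> h t \<and> h t \<le> 1) \<Longrightarrow>
          (\<lambda>n. LINT t|\<mu> n. h t) \<longlonglongrightarrow> (LINT t|\<nu>. h t :: real)"
    and f: "continuous_on UNIV f" "bounded (range f)"
  shows "(\<lambda>n. LINT t|\<mu> n. f t) \<longlonglongrightarrow> (LINT t|\<nu>. f t)"
proof -
  interpret \<nu>: finite_measure \<nu> by (rule fin')
  define m where "m n = measure (\<mu> n) UNIV" for n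
  define c where "c = measure \<nu> UNIV"
  have sp: "space \<nu> = UNIV" using fin'(2) by (metis sets_eq_imp_space_eq space_borel)
  have mass: "m \<longlonglongrightarrow> c"
  proof -
    have "(\<lambda>n. LINT t|\<mu> n. 1) \<longlonglongrightarrow> (LINT t|\<nu>. 1 :: real)"
      by (rule conv[of 0 "\<lambda>_. 1"]) (auto intro: lipschitz_onI)
    moreover have "\<forall>\<^sub>F n in sequentially. (LINT t|\<mu> n. 1 :: real) = m n"
      using fin by eventually_elim (auto simp: m_def dest: sets_eq_imp_space_eq)
    ultimately show ?thesis
      using sp by (simp add: c_def filterlim_cong)
  qed
  obtain B where B: "\<And>t. norm (f t) \<le> B" using f(2) by (auto simp: bounded_iff)
  have fcont: "isCont f t" for t using f(1) by (simp add: continuous_on_eq_continuous_at)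
  have fmeas: "f \<in> borel_measurable borel" using f(1) by (rule borel_measurable_continuous_onI)
  show ?thesis
  proof (cases "c = 0")
    case True
    have "\<forall>\<^sub>F n in sequentially. norm (LINT t|\<mu> n. f t) \<le> B * m n"
      using fin
    proof eventually_elim
      case (elim n)
      then interpret finite_measure "\<mu> n" by simp
      have "space (\<mu> n) = UNIV" using elim by (metis sets_eq_imp_space_eq space_borel)
      moreover have "norm (LINT t|\<mu> n. f t) \<le> (LINT t|\<mu> n. B)"
        using B elim fmeas order_trans[OF norm_ge_zero B]
        by (intro order_trans[OF integral_norm_bound] integral_mono integrable_norm
              integrable_const_bound[of _ B])
           (auto cong: measurable_cong_sets)
      ultimately show ?case by (simp add: m_def mult.commute)
    qed
    moreover have "(\<lambda>n. B * m n) \<longlonglongrightarrow> 0"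
      using tendsto_mult_left[OF mass, of B] True by simp
    ultimately have "(\<lambda>n. LINT t|\<mu> n. f t) \<longlonglongrightarrow> 0"
      by (rule Lim_null_comparison)
    moreover have "emeasure \<nu> (space \<nu>) = 0" using True sp by (simp add: c_def \<nu>.emeasure_eq_measure)
    then have "(LINT t|\<nu>. f t) = 0"
      by (intro integral_eq_zero_AE AE_I[of _ _ "space \<nu>"]) auto
    ultimately show ?thesis by simp
  next
    case False
    then have c: "0 < c" by (simp add: c_def zero_less_measure_iff)
    define good where "good n \<longleftrightarrow> finite_measure (\<mu> n) \<and> sets (\<mu> n) = sets borel \<and> 0 < m n" for n
    have good: "\<forall>\<^sub>F n in sequentially. good n"
      using fin order_tendstoD(1)[OF mass c] by eventually_elim (auto simp: good_def)
    define \<nu>' where "\<nu>' = density \<nu> (\<lambda>_. ennreal (1 / c))"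
    \<comment> \<open>The finitely many bad indices are filled with the normalised limit measure.\<close>
    define \<mu>' where "\<mu>' n = (if good n then density (\<mu> n) (\<lambda>_. ennreal (1 / m n)) else \<nu>')" for n
    have scale: "real_distribution (density \<kappa> (\<lambda>_. ennreal (1 / measure \<kappa> UNIV)))"
      if "finite_measure \<kappa>" "sets \<kappa> = sets borel" "0 < measure \<kappa> UNIV" for \<kappa> :: "real measure"
    proof -
      interpret finite_measure \<kappa> by fact
      have "space \<kappa> = UNIV" using that by (metis sets_eq_imp_space_eq space_borel)
      then have "prob_space (density \<kappa> (\<lambda>_. ennreal (1 / measure \<kappa> UNIV)))"
        using that by (intro prob_spaceI)
          (simp add: emeasure_density_const emeasure_eq_measure ennreal_mult[symmetric])
      then show ?thesis
        using that \<open>space \<kappa> = UNIV\<close> by (simp add: real_distribution_def real_distribution_axioms_def)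
    qed
    have \<nu>': "real_distribution \<nu>'"
      using scale[of \<nu>] fin' c by (simp add: \<nu>'_def c_def)
    have \<mu>': "real_distribution (\<mu>' n)" for n
      using scale[of "\<mu> n"] \<nu>' by (simp add: \<mu>'_def good_def m_def)
    have fm: "f \<in> borel_measurable \<kappa>" if "sets \<kappa> = sets borel" for \<kappa>
      using fmeas that by (simp cong: measurable_cong_sets)
    have cm: "cts_step x y \<in> borel_measurable \<kappa>" if "sets \<kappa> = sets borel" "x < y" for \<kappa> x y
      using cts_step_lipschitz[OF that(2), THEN lipschitz_on_continuous_on] that(1)
      by (simp add: borel_measurable_continuous_onI cong: measurable_cong_sets)
    have "weak_conv_m \<mu>' \<nu>'"
    proof (rule integral_cts_step_conv_imp_weak_conv[OF \<mu>' \<nu>'])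
      fix x y :: real assume xy: "x < y"
      have "(\<lambda>n. (1 / m n) *\<^sub>R (LINT t|\<mu> n. cts_step x y t)) \<longlonglongrightarrow> (1 / c) *\<^sub>R (LINT t|\<nu>. cts_step x y t)"
        using c xy by (intro tendsto_intros mass conv[OF cts_step_lipschitz]) (auto simp: cts_step_bounds)
      moreover have "\<forall>\<^sub>F n in sequentially. (1 / m n) *\<^sub>R (LINT t|\<mu> n. cts_step x y t) = (LINT t|\<mu>' n. cts_step x y t)"
        using good
      proof eventually_elim
        case (elim n)
        then have "cts_step x y \<in> borel_measurable (\<mu> n)" "0 < m n" using cm xy by (simp_all add: good_def)
        with elim show ?case by (simp add: \<mu>'_def integral_density_const)
      qed
      ultimately have "(\<lambda>n. LINT t|\<mu>' n. cts_step x y t) \<longlonglongrightarrow> (1 / c) *\<^sub>R (LINT t|\<nu>. cts_step x y t)"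
        by (rule Lim_transform_eventually)
      moreover have "(LINT t|\<nu>'. cts_step x y t) = (1 / c) *\<^sub>R (LINT t|\<nu>. cts_step x y t)"
        using c cm[OF fin'(2) xy] unfolding \<nu>'_def by (intro integral_density_const) auto
      ultimately show "(\<lambda>n. integral\<^sup>L (\<mu>' n) (cts_step x y)) \<longlonglongrightarrow> integral\<^sup>L \<nu>' (cts_step x y)"
        by (simp only:)
    qed
    then have "(\<lambda>n. LINT t|\<mu>' n. f t) \<longlonglongrightarrow> (LINT t|\<nu>'. f t)"
      using \<mu>' \<nu>' fcont B by (intro weak_conv_imp_integral_bdd_continuous_conv) auto
    also have "(LINT t|\<nu>'. f t) = (1 / c) *\<^sub>R (LINT t|\<nu>. f t)"
      using c fm[OF fin'(2)] unfolding \<nu>'_def by (intro integral_density_const) auto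
    finally have lim: "(\<lambda>n. LINT t|\<mu>' n. f t) \<longlonglongrightarrow> (1 / c) *\<^sub>R (LINT t|\<nu>. f t)" .
    have "\<forall>\<^sub>F n in sequentially. (LINT t|\<mu>' n. f t) = (1 / m n) *\<^sub>R (LINT t|\<mu> n. f t)"
      using good
    proof eventually_elim
      case (elim n)
      then have "f \<in> borel_measurable (\<mu> n)" "0 < m n" using fm by (simp_all add: good_def)
      with elim show ?case by (simp add: \<mu>'_def integral_density_const)
    qed
    with lim have "(\<lambda>n. (1 / m n) *\<^sub>R (LINT t|\<mu> n. f t)) \<longlonglongrightarrow> (1 / c) *\<^sub>R (LINT t|\<nu>. f t)"
      by (rule Lim_transform_eventually)
    from tendsto_scaleR[OF mass this]
    have "(\<lambda>n. m n *\<^sub>R (1 / m n) *\<^sub>R (LINT t|\<mu> n. f t)) \<longlonglongrightarrow> (LINT t|\<nu>. f t)"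
      using c by simp
    moreover have "\<forall>\<^sub>F n in sequentially. m n *\<^sub>R (1 / m n) *\<^sub>R (LINT t|\<mu> n. f t) = (LINT t|\<mu> n. f t)"
      using good by eventually_elim (auto simp: good_def)
    ultimately show ?thesis by (rule Lim_transform_eventually)
  qed
qed

text \<open>
  The usual interchange argument: each approximation level \<open>k\<close> has its own limit in \<open>n\<close>, and
  the limiting error \<open>b k + c k\<close> can be made small.
\<close>

lemma tendsto_by_approximation:
  fixes X :: "nat \<Rightarrow> real"
  assumes approx: "\<And>k n. \<bar>X n - S k n\<bar> \<le> B k n"
    and S: "\<And>k. S k \<longlonglongrightarrow> s k" and B: "\<And>k. B k \<longlonglongrightarrow> b k"
    and s: "\<And>k. \<bar>s k - x\<bar> \<le> c k" and bc: "(\<lambda>k. b k + c k) \<longlonglongrightarrow> 0"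
  shows "X \<longlonglongrightarrow> x"
proof (rule tendstoI)
  fix e :: real assume e: "0 < e"
  have "\<forall>\<^sub>F k in sequentially. b k + c k < e / 2" using e by (intro order_tendstoD(2)[OF bc]) simp
  then obtain k where k: "b k + c k < e / 2" using eventually_happens'[OF sequentially_bot] by blast
  have "(\<lambda>n. \<bar>S k n - s k\<bar> + B k n) \<longlonglongrightarrow> \<bar>s k - s k\<bar> + b k"
    by (intro tendsto_intros S B)
  then have "\<forall>\<^sub>F n in sequentially. \<bar>S k n - s k\<bar> + B k n < b k + e / 2"
    using e by (intro order_tendstoD(2)) auto
  then show "\<forall>\<^sub>F n in sequentially. dist (X n) x < e"
  proof eventually_elim
    case (elim n)
    then show ?case using approx[of n k] s[of k] k unfolding dist_real_def by linarith
  qed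
qed

section \<open>Quadratic forms and matrix entries\<close>

text \<open>
  The Cauchy--Schwarz inequality, in terms of the values \<open>\<parallel>g + c h\<parallel>\<^sup>2\<close> only. It serves both the matrix
  inner products and the inner product of \<open>L\<^sup>2\<close>.
\<close>

lemma norm_le_from_quadratic:
  fixes a d :: real and b :: complex
  assumes "0 \<le> d" and quad: "\<And>c. 0 \<le> a + 2 * Re (cnj c * b) + (cmod c)\<^sup>2 * d"
  shows "cmod b \<le> sqrt a * sqrt d"
proof -
  have "0 \<le> a" using quad[of 0] by simp
  have quad': "0 \<le> a + 2 * s * (cmod b)\<^sup>2 + s\<^sup>2 * (cmod b)\<^sup>2 * d" for s
  proof -
    have "Re (cnj (complex_of_real s * b) * b) = s * (cmod b)\<^sup>2"
      by (simp only: cmod_power2) (simp add: power2_eq_square algebra_simps)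
    moreover have "(cmod (complex_of_real s * b))\<^sup>2 = s\<^sup>2 * (cmod b)\<^sup>2"
      by (simp add: norm_mult power_mult_distrib)
    ultimately show ?thesis using quad[of "complex_of_real s * b"] by simp
  qed
  have "(cmod b)\<^sup>2 \<le> a * d"
  proof (cases "d = 0 \<or> b = 0")
    case True
    have "b = 0"
    proof (rule ccontr)
      assume b: "b \<noteq> 0"
      \<comment> \<open>For \<open>d = 0\<close> the form is affine in \<open>s\<close>; this \<open>s\<close> makes it equal to \<open>-1\<close>.\<close>
      then show False using True quad'[of "- ((a + 1) / (2 * (cmod b)\<^sup>2))"] \<open>0 \<le> a\<close> by simp
    qed
    then show ?thesis using \<open>0 \<le> a\<close> \<open>0 \<le> d\<close> by simp
  next
    case False
    have "0 \<le> a - (cmod b)\<^sup>2 / d"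
      using quad'[of "- (1 / d)"] False by (simp add: power2_eq_square)
    then show ?thesis using False assms(1) by (simp add: field_simps)
  qed
  then show ?thesis
    using real_sqrt_le_mono[of "(cmod b)\<^sup>2" "a * d"] by (simp add: real_sqrt_mult)
qed

lemma Re_quadratic:
  assumes "Im d = 0"
  shows "Re (a + cnj c * b + c * cnj b + c * cnj c * d) = Re a + 2 * Re (cnj c * b) + (cmod c)\<^sup>2 * Re d"
  using assms by (simp only: cmod_power2) (simp add: power2_eq_square algebra_simps)

lemma mat_adjoint_carrier [simp]: "A \<in> carrier_mat n m \<Longrightarrow> mat_adjoint A \<in> carrier_mat m n"
  by (auto simp: mat_adjoint_def)

lemma mat_adjoint_dim [simp]: "dim_row (mat_adjoint A) = dim_col A" "dim_col (mat_adjoint A) = dim_row A"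
  by (auto simp: mat_adjoint_def)

lemma mat_adjoint_index [simp]:
  fixes A :: "complex mat"
  shows "i < dim_col A \<Longrightarrow> j < dim_row A \<Longrightarrow> mat_adjoint A $$ (i, j) = cnj (A $$ (j, i))"
  by (simp add: mat_adjoint_def mat_of_rows_index)

lemma mult_mat_vec_index:
  assumes "A \<in> carrier_mat n m" "v \<in> carrier_vec m" "i < n"
  shows "(A *\<^sub>v v) $ i = (\<Sum>j<m. A $$ (i, j) * v $ j)"
  using assms by (auto simp: scalar_prod_def lessThan_atLeast0 intro!: sum.cong)

lemma mult_mat_index:
  assumes "A \<in> carrier_mat n m" "B \<in> carrier_mat m p" "i < n" "j < p"
  shows "(A * B) $$ (i, j) = (\<Sum>k<m. A $$ (i, k) * B $$ (k, j))"
  using assms by (auto simp: scalar_prod_def lessThan_atLeast0 intro!: sum.cong)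

section \<open>Sesquilinear forms given by matrices\<close>

lemma G_inner_eq_sum:
  assumes "G \<in> carrier_mat n n" "h \<in> carrier_vec n" "k \<in> carrier_vec n"
  shows "G_inner G h k = (\<Sum>i<n. \<Sum>j<n. G $$ (i, j) * h $ j * cnj (k $ i))"
proof -
  have "G_inner G h k = (\<Sum>i<n. (G *\<^sub>v h) $ i * cnj (k $ i))"
    using assms unfolding G_inner_def by (auto simp: scalar_prod_def lessThan_atLeast0 intro!: sum.cong)
  also have "\<dots> = (\<Sum>i<n. \<Sum>j<n. G $$ (i, j) * h $ j * cnj (k $ i))"
    using assms by (intro sum.cong refl) (simp add: mult_mat_vec_index sum_distrib_right del: index_mult_mat_vec)
  finally show ?thesis .
qed

lemma G_inner_hermitian:
  assumes G: "G \<in> carrier_mat n n" "mat_adjoint G = G" and "h \<in> carrier_vec n" "k \<in> carrier_vec n"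
  shows "G_inner G k h = cnj (G_inner G h k)"
proof -
  have G_cnj: "G $$ (j, i) = cnj (G $$ (i, j))" if "i < n" "j < n" for i j
    using mat_adjoint_index[of j G i] G that by simp
  have "G_inner G k h = (\<Sum>j<n. \<Sum>i<n. G $$ (j, i) * k $ i * cnj (h $ j))"
    using assms by (simp add: G_inner_eq_sum)
  also have "\<dots> = (\<Sum>i<n. \<Sum>j<n. G $$ (j, i) * k $ i * cnj (h $ j))"
    by (rule sum.swap)
  also have "\<dots> = (\<Sum>i<n. \<Sum>j<n. cnj (G $$ (i, j) * h $ j * cnj (k $ i)))"
    by (intro sum.cong refl) (subst G_cnj, auto)
  finally show ?thesis using assms by (simp add: G_inner_eq_sum)
qed

lemma G_inner_mult_left:
  assumes "G \<in> carrier_mat n n" "K \<in> carrier_mat n n" "h \<in> carrier_vec n"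
  shows "G_inner G (K *\<^sub>v h) k = G_inner (G * K) h k"
  using assms by (simp add: G_inner_def assoc_mult_mat_vec[of G n n K n])

lemma G_inner_sum_left:
  assumes "G \<in> carrier_mat n n" "k \<in> carrier_vec n" "h \<in> carrier_vec n"
    and "\<And>s. s \<in> S \<Longrightarrow> v s \<in> carrier_vec n"
    and "\<And>i. i < n \<Longrightarrow> h $ i = (\<Sum>s\<in>S. v s $ i)"
  shows "G_inner G h k = (\<Sum>s\<in>S. G_inner G (v s) k)"
proof -
  have "G_inner G h k = (\<Sum>i<n. \<Sum>j<n. \<Sum>s\<in>S. G $$ (i, j) * v s $ j * cnj (k $ i))"
    using assms by (simp add: G_inner_eq_sum sum_distrib_left sum_distrib_right)
  also have "\<dots> = (\<Sum>i<n. \<Sum>s\<in>S. \<Sum>j<n. G $$ (i, j) * v s $ j * cnj (k $ i))"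
    by (intro sum.cong refl sum.swap)
  also have "\<dots> = (\<Sum>s\<in>S. \<Sum>i<n. \<Sum>j<n. G $$ (i, j) * v s $ j * cnj (k $ i))"
    by (rule sum.swap)
  finally show ?thesis using assms by (simp add: G_inner_eq_sum)
qed

lemma G_inner_add_left:
  assumes "G \<in> carrier_mat n n" "k \<in> carrier_vec n" "h \<in> carrier_vec n" "h' \<in> carrier_vec n"
  shows "G_inner G (h + h') k = G_inner G h k + G_inner G h' k"
  using assms by (simp add: G_inner_def mult_add_distrib_mat_vec[of G n n] add_scalar_prod_distrib[of _ n])

lemma G_inner_minus_left:
  assumes "G \<in> carrier_mat n n" "k \<in> carrier_vec n" "h \<in> carrier_vec n" "h' \<in> carrier_vec n"
  shows "G_inner G (h - h') k = G_inner G h k - G_inner G h' k"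
  using assms by (simp add: G_inner_def mult_minus_distrib_mat_vec[of G n n] minus_scalar_prod_distrib[of _ n])

lemma G_inner_smult_left:
  assumes "G \<in> carrier_mat n n" "k \<in> carrier_vec n" "h \<in> carrier_vec n"
  shows "G_inner G (c \<cdot>\<^sub>v h) k = c * G_inner G h k"
  using assms by (simp add: G_inner_def mult_mat_vec[of G n n])

lemma tendsto_G_inner:
  assumes "\<forall>\<^sub>F M in F. G M \<in> carrier_mat n n \<and> h M \<in> carrier_vec n \<and> k M \<in> carrier_vec n"
    and "G' \<in> carrier_mat n n" "h' \<in> carrier_vec n" "k' \<in> carrier_vec n"
    and "\<And>i j. i < n \<Longrightarrow> j < n \<Longrightarrow> ((\<lambda>M. G M $$ (i, j)) \<longlongrightarrow> G' $$ (i, j)) F"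
    and "\<And>i. i < n \<Longrightarrow> ((\<lambda>M. h M $ i) \<longlongrightarrow> h' $ i) F"
    and "\<And>i. i < n \<Longrightarrow> ((\<lambda>M. k M $ i) \<longlongrightarrow> k' $ i) F"
  shows "((\<lambda>M. G_inner (G M) (h M) (k M)) \<longlongrightarrow> G_inner G' h' k') F"
proof -
  have "((\<lambda>M. \<Sum>i<n. \<Sum>j<n. G M $$ (i, j) * h M $ j * cnj (k M $ i)) \<longlongrightarrow> G_inner G' h' k') F"
    unfolding G_inner_eq_sum[OF assms(2-4)] by (intro tendsto_intros assms) auto
  moreover have "\<forall>\<^sub>F M in F. (\<Sum>i<n. \<Sum>j<n. G M $$ (i, j) * h M $ j * cnj (k M $ i)) = G_inner (G M) (h M) (k M)"
    using assms(1) by eventually_elim (simp add: G_inner_eq_sum[of _ n])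
  ultimately show ?thesis by (rule Lim_transform_eventually)
qed

section \<open>Matrices self-adjoint for a positive definite form\<close>

definition G_norm :: "complex mat \<Rightarrow> complex Matrix.vec \<Rightarrow> real" where
  "G_norm G h = sqrt (Re (G_inner G h h))"

text \<open>
  Hermitian \<open>G * K\<close> is self-adjointness of \<open>K\<close> for \<open>(h\<^sub>1, h\<^sub>2) \<mapsto> h\<^sub>2\<^sup>* G h\<^sub>1\<close>.
\<close>

locale G_selfadjoint =
  fixes n :: nat and G K :: "complex mat"
  assumes G: "G \<in> carrier_mat n n" and K: "K \<in> carrier_mat n n"
    and G_hermitian: "mat_adjoint G = G"
    and G_positive: "\<And>h. h \<in> carrier_vec n \<Longrightarrow> h \<noteq> 0\<^sub>v n \<Longrightarrow> 0 < Re (G_inner G h h)"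
    and GK_hermitian: "mat_adjoint (G * K) = G * K"
begin

lemma K_mult_carrier [simp]: "h \<in> carrier_vec n \<Longrightarrow> K *\<^sub>v h \<in> carrier_vec n"
  using K by simp

lemma inner_sym: "h \<in> carrier_vec n \<Longrightarrow> k \<in> carrier_vec n \<Longrightarrow> G_inner G k h = cnj (G_inner G h k)"
  by (rule G_inner_hermitian[OF G G_hermitian])

lemma inner_nonneg: "h \<in> carrier_vec n \<Longrightarrow> 0 \<le> Re (G_inner G h h)"
  using G_positive[of h] G by (cases "h = 0\<^sub>v n") (auto simp: G_inner_def)

lemma inner_real: "h \<in> carrier_vec n \<Longrightarrow> Im (G_inner G h h) = 0"
  using inner_sym[of h h] by (metis complex_cnj_cancel_iff complex_cnj_cnj Reals_cnj_iff complex_is_Real_iff)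

lemma inner_self: "h \<in> carrier_vec n \<Longrightarrow> G_inner G h h = complex_of_real ((G_norm G h)\<^sup>2)"
  using inner_nonneg[of h] inner_real[of h] by (simp add: G_norm_def complex_eq_iff)

lemma G_norm_nonneg [simp]: "h \<in> carrier_vec n \<Longrightarrow> 0 \<le> G_norm G h"
  using inner_nonneg by (simp add: G_norm_def)

lemma inner_definite: "h \<in> carrier_vec n \<Longrightarrow> G_inner G h h = 0 \<Longrightarrow> h = 0\<^sub>v n"
  using G_positive[of h] by auto

lemma inner_K: "h \<in> carrier_vec n \<Longrightarrow> k \<in> carrier_vec n \<Longrightarrow> G_inner G (K *\<^sub>v h) k = G_inner G h (K *\<^sub>v k)"
  using G_inner_hermitian[of "G * K" n k h] inner_sym[of "K *\<^sub>v k" h] G K GK_hermitian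
  by (simp add: G_inner_mult_left[OF G K])

lemma inner_smult_right:
  "h \<in> carrier_vec n \<Longrightarrow> k \<in> carrier_vec n \<Longrightarrow> G_inner G h (c \<cdot>\<^sub>v k) = cnj c * G_inner G h k"
  using inner_sym[of "c \<cdot>\<^sub>v k" h] inner_sym[of k h] by (simp add: G_inner_smult_left[OF G])

lemma cauchy_schwarz:
  assumes "h \<in> carrier_vec n" "k \<in> carrier_vec n"
  shows "cmod (G_inner G h k) \<le> G_norm G h * G_norm G k"
  unfolding G_norm_def
proof (rule norm_le_from_quadratic)
  fix c :: complex
  have eq: "G_inner G (h + c \<cdot>\<^sub>v k) (h + c \<cdot>\<^sub>v k)
    = G_inner G h h + cnj c * G_inner G h k + c * cnj (G_inner G h k) + c * cnj c * G_inner G k k"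
  proof -
    have 1: "G_inner G (h + c \<cdot>\<^sub>v k) w = G_inner G h w + c * G_inner G k w" if "w \<in> carrier_vec n" for w
      using assms that G by (simp add: G_inner_add_left[of G n] G_inner_smult_left[of G n])
    have 2: "G_inner G w (h + c \<cdot>\<^sub>v k) = G_inner G w h + cnj c * G_inner G w k" if "w \<in> carrier_vec n" for w
      using 1[OF that] inner_sym[of "h + c \<cdot>\<^sub>v k" w] inner_sym[of h w] inner_sym[of k w] assms that
      by simp
    have "h + c \<cdot>\<^sub>v k \<in> carrier_vec n" using assms by simp
    show ?thesis
      unfolding 1[OF \<open>h + c \<cdot>\<^sub>v k \<in> carrier_vec n\<close>] 2[OF assms(1)] 2[OF assms(2)] inner_sym[OF assms]
      by (simp add: algebra_simps)
  qed
  have "0 \<le> Re (G_inner G (h + c \<cdot>\<^sub>v k) (h + c \<cdot>\<^sub>v k))"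
    using assms by (intro inner_nonneg) simp
  also have "\<dots> = Re (G_inner G h h) + 2 * Re (cnj c * G_inner G h k) + (cmod c)\<^sup>2 * Re (G_inner G k k)"
    unfolding eq by (rule Re_quadratic[OF inner_real[OF assms(2)]])
  finally show "0 \<le> Re (G_inner G h h) + 2 * Re (cnj c * G_inner G h k) + (cmod c)\<^sup>2 * Re (G_inner G k k)" .
qed (rule inner_nonneg[OF assms(2)])

lemma eigenvalue_real:
  assumes "h \<in> carrier_vec n" "h \<noteq> 0\<^sub>v n" "K *\<^sub>v h = l \<cdot>\<^sub>v h"
  shows "cnj l = l"
proof -
  have "l * G_inner G h h = cnj l * G_inner G h h"
    using inner_K[OF assms(1) assms(1)]
    unfolding assms(3) G_inner_smult_left[OF G assms(1) assms(1)] inner_smult_right[OF assms(1) assms(1)] .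
  moreover have "G_inner G h h \<noteq> 0" using inner_definite[OF assms(1)] assms(2) by blast
  ultimately show ?thesis by simp
qed

lemma eigenvectors_orthogonal:
  assumes "h \<in> carrier_vec n" "k \<in> carrier_vec n"
    and "K *\<^sub>v h = complex_of_real l \<cdot>\<^sub>v h" "K *\<^sub>v k = complex_of_real m \<cdot>\<^sub>v k" "l \<noteq> m"
  shows "G_inner G h k = 0"
proof -
  have "complex_of_real l * G_inner G h k = complex_of_real m * G_inner G h k"
    using inner_K[OF assms(1,2)]
    unfolding assms(3,4) G_inner_smult_left[OF G assms(2,1)] inner_smult_right[OF assms(1,2)] by simp
  then show ?thesis using assms(5) by simp
qed

end

section \<open>Diagonalisation and eigenprojections\<close>

lemma jordan_matrix_bidiagonal:
  fixes n_as :: "(nat \<times> complex) list"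
  assumes "i < sum_list (map fst n_as)" "j < sum_list (map fst n_as)"
  shows "jordan_matrix n_as $$ (i, j) \<noteq> 0 \<Longrightarrow> j = i \<or> j = Suc i"
    and "j = Suc i \<Longrightarrow> jordan_matrix n_as $$ (i, j) \<noteq> 0 \<Longrightarrow>
      jordan_matrix n_as $$ (i, j) = 1 \<and> jordan_matrix n_as $$ (j, j) = jordan_matrix n_as $$ (i, i)"
  using assms
proof (induction n_as arbitrary: i j)
  case (Cons na n_as)
  obtain m a where na: "na = (m, a)" by force
  let ?d = "sum_list (map fst n_as)"
  have idx: "jordan_matrix ((m, a) # n_as) $$ (i, j) =
      (if i < m then (if j < m then jordan_block m a $$ (i, j) else 0)
       else (if j < m then 0 else jordan_matrix n_as $$ (i - m, j - m)))"
    if "i < m + ?d" "j < m + ?d" for i j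
    unfolding jordan_matrix_Cons using that by (subst index_mat_four_block) auto
  {
    case 1
    show ?case
    proof (cases "i < m \<or> j < m")
      case True
      then show ?thesis using 1 by (auto simp: idx na split: if_splits)
    next
      case False
      then have "jordan_matrix n_as $$ (i - m, j - m) \<noteq> 0" "i - m < ?d" "j - m < ?d"
        using 1 by (auto simp: idx na split: if_splits)
      from Cons.IH(1)[OF this] False show ?thesis by auto
    qed
  next
    case 2
    show ?case
    proof (cases "i < m")
      case True
      then show ?thesis using 2 by (auto simp: idx na split: if_splits)
    next
      case False
      then have "j - m = Suc (i - m)" "jordan_matrix n_as $$ (i - m, j - m) \<noteq> 0" "i - m < ?d" "j - m < ?d"
        using 2 by (auto simp: idx na split: if_splits)
      from Cons.IH(2)[OF this] False 2 show ?thesis by (simp add: idx na)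
    qed
  }
qed auto

lemma smult_mult_mat_vec:
  assumes "A \<in> carrier_mat n m" "v \<in> carrier_vec m"
  shows "(c \<cdot>\<^sub>m A) *\<^sub>v v = c \<cdot>\<^sub>v (A *\<^sub>v v)"
  using assms by (intro eq_vecI) (auto simp: scalar_prod_def sum_distrib_left mult.assoc)

context G_selfadjoint
begin

text \<open>
  Start from the Jordan normal form. A first nonzero entry above the diagonal would give
  basis vectors with \<open>K p\<^sub>i = l p\<^sub>i\<close> and \<open>K p\<^sub>i\<^sub>+\<^sub>1 = l p\<^sub>i\<^sub>+\<^sub>1 + p\<^sub>i\<close>, which self-adjointness excludes.
\<close>

lemma diagonalisation:
  obtains P Q lam where "P \<in> carrier_mat n n" "Q \<in> carrier_mat n n" "P * Q = 1\<^sub>m n" "Q * P = 1\<^sub>m n"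
    "K * P = P * mat_diag n (\<lambda>i. complex_of_real (lam i))"
proof -
  obtain as where "char_poly K = (\<Prod>a\<leftarrow>as. [:- a, 1:])" using char_poly_factorized[OF K] by blast
  from jordan_nf_exists[OF K this] obtain n_as where "jordan_nf K n_as" ..
  then obtain P Q where wit: "similar_mat_wit K (jordan_matrix n_as) P Q"
    unfolding jordan_nf_def similar_mat_def by blast
  define J where "J = jordan_matrix n_as"
  note wit = similar_mat_witD2[OF K wit, folded J_def]
  have d: "sum_list (map fst n_as) = n" using wit(5) by (auto simp: J_def)
  have KP: "K * P = P * J"
  proof -
    have "K * P = P * J * (Q * P)" unfolding wit(3) using wit by (intro assoc_mult_mat) auto
    then show ?thesis using wit by simp
  qed
  have p: "col P j \<in> carrier_vec n" for j using wit by auto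
  have Kp: "(K *\<^sub>v col P j) $ i = (\<Sum>k<n. P $$ (i, k) * J $$ (k, j))" if "i < n" "j < n" for i j
  proof -
    have "(K *\<^sub>v col P j) $ i = (K * P) $$ (i, j)"
      using that K wit(6) by simp
    then show ?thesis using KP that wit(5,6) by (simp add: mult_mat_index[of P n n J n] del: index_mult_mat(1))
  qed
  have p0: "col P j \<noteq> 0\<^sub>v n" if "j < n" for j
  proof
    assume z: "col P j = 0\<^sub>v n"
    have "(Q * P) $$ (j, j) = row Q j \<bullet> col P j" using that wit by (intro index_mult_mat) auto
    also have "\<dots> = 0" unfolding z using wit that by auto
    finally show False using wit that by simp
  qed
  have J0: "J $$ (k, j) = 0" if "k < n" "j < n" "j \<noteq> k" "j \<noteq> Suc k" for k j
    using jordan_matrix_bidiagonal(1)[of k n_as j] that by (auto simp: J_def d)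
  have eig: "K *\<^sub>v col P j = J $$ (j, j) \<cdot>\<^sub>v col P j"
    if "j < n" "\<And>k. Suc k = j \<Longrightarrow> J $$ (k, j) = 0" for j
  proof (rule eq_vecI)
    fix i assume "i < dim_vec (J $$ (j, j) \<cdot>\<^sub>v col P j)"
    then have i: "i < n" using wit by simp
    have "(\<Sum>k<n. P $$ (i, k) * J $$ (k, j)) = (\<Sum>k<n. if k = j then P $$ (i, j) * J $$ (j, j) else 0)"
      using J0 that by (intro sum.cong) auto
    then show "(K *\<^sub>v col P j) $ i = (J $$ (j, j) \<cdot>\<^sub>v col P j) $ i"
      using i that wit(6) by (simp add: Kp del: index_mult_mat_vec)
  qed (use K wit in auto)
  have super: "J $$ (j, Suc j) = 0" if "Suc j < n" for j
  proof (rule ccontr)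
    assume "J $$ (j, Suc j) \<noteq> 0"
    \<comment> \<open>Minimality makes column \<open>i\<close> an eigenvector: it has no entry above its diagonal.\<close>
    define i where "i = (LEAST i. Suc i < n \<and> J $$ (i, Suc i) \<noteq> 0)"
    have i: "Suc i < n" "J $$ (i, Suc i) \<noteq> 0"
      using LeastI[of "\<lambda>i. Suc i < n \<and> J $$ (i, Suc i) \<noteq> 0" j] that \<open>J $$ (j, Suc j) \<noteq> 0\<close>
      by (auto simp: i_def)
    have before: "J $$ (k, i) = 0" if "Suc k = i" for k
      using not_less_Least[of k "\<lambda>i. Suc i < n \<and> J $$ (i, Suc i) \<noteq> 0"] that i by (auto simp: i_def)
    define l where "l = J $$ (i, i)"
    have bi: "J $$ (i, Suc i) = 1" "J $$ (Suc i, Suc i) = l"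
      using jordan_matrix_bidiagonal(2)[of i n_as "Suc i"] i by (auto simp: J_def d l_def)
    have e1: "K *\<^sub>v col P i = l \<cdot>\<^sub>v col P i" using eig[of i] before i by (simp add: l_def)
    have l: "cnj l = l" by (rule eigenvalue_real[OF p p0 e1]) (use i in simp)
    have e2: "K *\<^sub>v col P (Suc i) = l \<cdot>\<^sub>v col P (Suc i) + col P i"
    proof (rule eq_vecI)
      fix r assume "r < dim_vec (l \<cdot>\<^sub>v col P (Suc i) + col P i)"
      then have r: "r < n" using wit by simp
      have "(\<Sum>k<n. P $$ (r, k) * J $$ (k, Suc i)) = (\<Sum>k\<in>{i, Suc i}. P $$ (r, k) * J $$ (k, Suc i))"
        using J0[of _ "Suc i"] i by (intro sum.mono_neutral_right) auto
      then show "(K *\<^sub>v col P (Suc i)) $ r = (l \<cdot>\<^sub>v col P (Suc i) + col P i) $ r"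
        using r i wit(6) bi by (simp add: Kp del: index_mult_mat_vec)
    qed (use K wit in auto)
    \<comment> \<open>A genuine Jordan chain would make \<open>col P i\<close> orthogonal to itself.\<close>
    have "G_inner G (K *\<^sub>v col P (Suc i)) (col P i) = l * G_inner G (col P (Suc i)) (col P i) + G_inner G (col P i) (col P i)"
      unfolding e2 using p by (simp add: G_inner_add_left[OF G] G_inner_smult_left[OF G])
    moreover have "G_inner G (K *\<^sub>v col P (Suc i)) (col P i) = l * G_inner G (col P (Suc i)) (col P i)"
      unfolding inner_K[OF p p] e1 using p l by (simp add: inner_smult_right)
    ultimately have "G_inner G (col P i) (col P i) = 0" by simp
    from inner_definite[OF p this] p0[of i] i show False by simp
  qed
  have eig': "K *\<^sub>v col P j = J $$ (j, j) \<cdot>\<^sub>v col P j" if "j < n" for j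
    using eig that super by blast
  define lam where "lam i = Re (J $$ (i, i))" for i
  have "J = mat_diag n (\<lambda>i. complex_of_real (lam i))"
  proof (rule eq_matI)
    fix i j assume "i < dim_row (mat_diag n (\<lambda>i. complex_of_real (lam i)))"
      "j < dim_col (mat_diag n (\<lambda>i. complex_of_real (lam i)))"
    then have ij: "i < n" "j < n" by (simp_all add: mat_diag_def)
    show "J $$ (i, j) = mat_diag n (\<lambda>i. complex_of_real (lam i)) $$ (i, j)"
    proof (cases "i = j")
      case True
      have "cnj (J $$ (j, j)) = J $$ (j, j)"
        by (rule eigenvalue_real[OF p p0 eig']) (use ij in auto)
      then show ?thesis using True ij by (simp add: mat_diag_def complex_eq_iff lam_def)
    next
      case False
      then show ?thesis using ij J0[of i j] super[of i] by (auto simp: mat_diag_def)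
    qed
  qed (use wit in \<open>auto simp: mat_diag_def\<close>)
  then show ?thesis using that[OF wit(6,7,1,2)] KP by (simp only:)
qed

abbreviation "spec \<equiv> {l. eigenvalue K (complex_of_real l)}"

text \<open>
  Group the columns of the diagonalising matrix by eigenvalue. An eigenvalue of \<open>K\<close> that is not
  on the diagonal would have an eigenvector orthogonal to all of these, hence to itself.
\<close>

lemma spectral_resolution:
  obtains E where "finite spec" "\<And>l. E l \<in> carrier_mat n n"
    "\<And>l h. h \<in> carrier_vec n \<Longrightarrow> K *\<^sub>v (E l *\<^sub>v h) = complex_of_real l \<cdot>\<^sub>v (E l *\<^sub>v h)"
    "\<And>h i. h \<in> carrier_vec n \<Longrightarrow> i < n \<Longrightarrow> h $ i = (\<Sum>l\<in>spec. (E l *\<^sub>v h) $ i)"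
proof -
  obtain P Q lam where PQ: "P \<in> carrier_mat n n" "Q \<in> carrier_mat n n" "P * Q = 1\<^sub>m n" "Q * P = 1\<^sub>m n"
    and KP: "K * P = P * mat_diag n (\<lambda>i. complex_of_real (lam i))" by (rule diagonalisation)
  define D where "D l = mat_diag n (\<lambda>i. if lam i = l then 1 else 0 :: complex)" for l
  define E where "E l = P * (D l * Q)" for l
  define S where "S = lam ` {..<n}"
  have D: "D l \<in> carrier_mat n n" for l by (simp add: D_def)
  have E: "E l \<in> carrier_mat n n" for l using PQ D[of l] by (simp add: E_def)
  have Ev: "E l *\<^sub>v h \<in> carrier_vec n" if "h \<in> carrier_vec n" for l h using E[of l] that by simp
  have Eh: "E l *\<^sub>v h = P *\<^sub>v (D l *\<^sub>v (Q *\<^sub>v h))" if "h \<in> carrier_vec n" for l h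
    using PQ D[of l] that by (simp add: E_def assoc_mult_mat_vec[of _ n n _ n])
  have eig: "K *\<^sub>v (E l *\<^sub>v h) = complex_of_real l \<cdot>\<^sub>v (E l *\<^sub>v h)" if h: "h \<in> carrier_vec n" for l h
  proof -
    have w: "Q *\<^sub>v h \<in> carrier_vec n" using PQ h by simp
    have Dw: "D l *\<^sub>v (Q *\<^sub>v h) \<in> carrier_vec n" using D[of l] w by simp
    have Ew: "E l *\<^sub>v h = P *\<^sub>v (D l *\<^sub>v (Q *\<^sub>v h))" by (rule Eh[OF h])
    have diag: "mat_diag n (\<lambda>i. complex_of_real (lam i)) * D l = complex_of_real l \<cdot>\<^sub>m D l"
      by (simp add: D_def) (auto simp: mat_diag_def intro!: eq_matI)
    have "K *\<^sub>v (E l *\<^sub>v h) = (K * P) *\<^sub>v (D l *\<^sub>v (Q *\<^sub>v h))"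
      using K PQ(1) Dw unfolding Ew by simp
    also have "\<dots> = P *\<^sub>v ((mat_diag n (\<lambda>i. complex_of_real (lam i)) * D l) *\<^sub>v (Q *\<^sub>v h))"
      unfolding KP assoc_mult_mat_vec[OF PQ(1) mat_diag_dim Dw] assoc_mult_mat_vec[OF mat_diag_dim D w] ..
    also have "\<dots> = complex_of_real l \<cdot>\<^sub>v (P *\<^sub>v (D l *\<^sub>v (Q *\<^sub>v h)))"
      unfolding diag smult_mult_mat_vec[OF D w] mult_mat_vec[OF PQ(1) Dw] ..
    finally show ?thesis unfolding Ew .
  qed
  have sum: "h $ i = (\<Sum>l\<in>S. (E l *\<^sub>v h) $ i)" if h: "h \<in> carrier_vec n" and i: "i < n" for h i
  proof -
    have Dw: "(\<Sum>l\<in>S. (D l *\<^sub>v w) $ k) = w $ k" if "w \<in> carrier_vec n" "k < n" for w k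
    proof -
      have "(D l *\<^sub>v w) $ k = (if lam k = l then w $ k else 0)" for l
      proof -
        have "(D l *\<^sub>v w) $ k = (\<Sum>j<n. if j = k then (if lam k = l then w $ k else 0) else 0)"
          unfolding mult_mat_vec_index[OF D that] using that by (intro sum.cong) (auto simp: D_def mat_diag_def)
        then show ?thesis using that by simp
      qed
      then show ?thesis using that by (simp add: S_def)
    qed
    have w: "Q *\<^sub>v h \<in> carrier_vec n" using PQ h by simp
    have "(\<Sum>l\<in>S. (E l *\<^sub>v h) $ i) = (\<Sum>l\<in>S. \<Sum>k<n. P $$ (i, k) * (D l *\<^sub>v (Q *\<^sub>v h)) $ k)"
    proof (intro sum.cong refl)
      fix l
      have Dw: "D l *\<^sub>v (Q *\<^sub>v h) \<in> carrier_vec n" using D[of l] w by simp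
      show "(E l *\<^sub>v h) $ i = (\<Sum>k<n. P $$ (i, k) * (D l *\<^sub>v (Q *\<^sub>v h)) $ k)"
        by (simp only: Eh[OF h] mult_mat_vec_index[OF PQ(1) Dw i])
    qed
    also have "\<dots> = (\<Sum>k<n. P $$ (i, k) * (\<Sum>l\<in>S. (D l *\<^sub>v (Q *\<^sub>v h)) $ k))"
      by (subst sum.swap) (simp only: sum_distrib_left)
    also have "\<dots> = (P *\<^sub>v (Q *\<^sub>v h)) $ i"
      using Dw[OF w] by (simp add: mult_mat_vec_index[OF PQ(1) w i] del: index_mult_mat_vec)
    also have "P *\<^sub>v (Q *\<^sub>v h) = h"
      using PQ h by (simp add: assoc_mult_mat_vec[of P n n Q n, symmetric])
    finally show ?thesis by simp
  qed
  have "spec = S"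
  proof (intro Set.set_eqI iffI)
    fix l assume "l \<in> spec"
    then obtain v where v: "v \<in> carrier_vec n" "v \<noteq> 0\<^sub>v n" "K *\<^sub>v v = complex_of_real l \<cdot>\<^sub>v v"
      using K by (auto simp: eigenvalue_def eigenvector_def)
    show "l \<in> S"
    proof (rule ccontr)
      assume l: "l \<notin> S"
      have "G_inner G v v = (\<Sum>m\<in>S. G_inner G (E m *\<^sub>v v) v)"
        by (rule G_inner_sum_left[OF G v(1) v(1) Ev[OF v(1)] sum[OF v(1)]])
      also have "\<dots> = 0"
        using eigenvectors_orthogonal[OF Ev[OF v(1)] v(1) eig[OF v(1)] v(3)] l by (intro sum.neutral) metis
      finally show False using inner_definite v by blast
    qed
  next
    fix l assume "l \<in> S"
    then obtain i where i: "i < n" "l = lam i" by (auto simp: S_def)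
    have "K *\<^sub>v col P i = col (P * mat_diag n (\<lambda>i. complex_of_real (lam i))) i"
      using KP col_mult2[OF K PQ(1) i(1)] by simp
    also have "\<dots> = complex_of_real l \<cdot>\<^sub>v col P i"
      using PQ i by (auto simp: mat_diag_mult_right[OF PQ(1)] mult.commute intro!: eq_vecI)
    finally have ev: "K *\<^sub>v col P i = complex_of_real l \<cdot>\<^sub>v col P i" .
    have "col P i \<noteq> 0\<^sub>v n"
    proof
      assume z: "col P i = 0\<^sub>v n"
      have "(Q * P) $$ (i, i) = row Q i \<bullet> col P i" using i PQ by (intro index_mult_mat) auto
      also have "\<dots> = 0" unfolding z using PQ i by auto
      finally show False using PQ i by simp
    qed
    then show "l \<in> spec" using ev K PQ by (auto simp: eigenvalue_def eigenvector_def intro!: exI[of _ "col P i"])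
  qed
  then show ?thesis using that[of E] E eig sum by (simp add: S_def)
qed

abbreviation "Pr l \<equiv> G_eigenprojection G K (complex_of_real l)"

lemma eigenspace_eq: "eigenspace K l = {v \<in> carrier_vec n. K *\<^sub>v v = l \<cdot>\<^sub>v v}"
  using K by (simp add: eigenspace_def)

lemma eigenspace_minus:
  assumes "u \<in> eigenspace K l" "v \<in> eigenspace K l"
  shows "u - v \<in> eigenspace K l"
proof -
  have uv: "u \<in> carrier_vec n" "v \<in> carrier_vec n" using assms by (simp_all add: eigenspace_eq)
  have "K *\<^sub>v (u - v) = l \<cdot>\<^sub>v u - l \<cdot>\<^sub>v v"
    using assms by (simp add: mult_minus_distrib_mat_vec[OF K uv] eigenspace_eq)
  also have "\<dots> = l \<cdot>\<^sub>v (u - v)"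
    using uv by (intro eq_vecI) (auto simp: algebra_simps)
  finally show ?thesis using uv by (simp add: eigenspace_eq)
qed

text \<open>
  The difference of two candidates maps into the eigenspace and is orthogonal to it.
\<close>

lemma eigenprojection_unique:
  assumes P: "P \<in> carrier_mat n n"
    and proj: "\<And>h. h \<in> carrier_vec n \<Longrightarrow> P *\<^sub>v h \<in> eigenspace K l"
      "\<And>h u. h \<in> carrier_vec n \<Longrightarrow> u \<in> eigenspace K l \<Longrightarrow> G_inner G (h - P *\<^sub>v h) u = 0"
  shows "G_eigenprojection G K l = P"
proof -
  have dim: "dim_row K = n" using K by simp
  show ?thesis
    unfolding G_eigenprojection_def dim
  proof (rule the_equality)
    fix P' assume P': "P' \<in> carrier_mat n n \<and> (\<forall>h\<in>carrier_vec n. P' *\<^sub>v h \<in> eigenspace K l \<and>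
        (\<forall>u\<in>eigenspace K l. G_inner G (h - P' *\<^sub>v h) u = 0))"
    have same: "P' *\<^sub>v h = P *\<^sub>v h" if h: "h \<in> carrier_vec n" for h
    proof -
      define d where "d = P *\<^sub>v h - P' *\<^sub>v h"
      have c: "P *\<^sub>v h \<in> carrier_vec n" "P' *\<^sub>v h \<in> carrier_vec n" using P P' h by auto
      have dims: "dim_row P = n" "dim_row P' = n" using P P' by auto
      have d: "d \<in> eigenspace K l" unfolding d_def using proj(1)[OF h] P' h by (intro eigenspace_minus) auto
      then have d': "d \<in> carrier_vec n" by (simp add: eigenspace_eq)
      have "G_inner G d d = G_inner G (P *\<^sub>v h) d - G_inner G (P' *\<^sub>v h) d"
        by (subst (1) d_def) (rule G_inner_minus_left[OF G d' c])
      also have "\<dots> = G_inner G (h - P' *\<^sub>v h) d - G_inner G (h - P *\<^sub>v h) d"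
        by (simp add: G_inner_minus_left[OF G d' h c(1)] G_inner_minus_left[OF G d' h c(2)])
      also have "\<dots> = 0" using proj(2)[OF h d] P' h d by simp
      finally have "d = 0\<^sub>v n" by (rule inner_definite[OF d'])
      show ?thesis
      proof (rule eq_vecI)
        fix i assume "i < dim_vec (P *\<^sub>v h)"
        then have i: "i < n" using dims by simp
        have "d $ i = (P *\<^sub>v h) $ i - (P' *\<^sub>v h) $ i" unfolding d_def using dims i by (intro index_minus_vec) simp
        then show "(P' *\<^sub>v h) $ i = (P *\<^sub>v h) $ i" using \<open>d = 0\<^sub>v n\<close> i by (simp del: index_mult_mat_vec)
      qed (use dims in simp)
    qed
    show "P' = P"
    proof (rule eq_matI)
      fix i j assume "i < dim_row P" "j < dim_col P"
      then have ij: "i < n" "j < n" using P by auto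
      have "A $$ (i, j) = (A *\<^sub>v unit_vec n j) $ i" if A: "A \<in> carrier_mat n n" for A :: "complex mat"
        using ij A by (simp add: scalar_prod_right_unit[of _ n])
      then show "P' $$ (i, j) = P $$ (i, j)" using same[of "unit_vec n j"] P P' by simp
    qed (use P P' in auto)
  qed (use P proj in auto)
qed

lemma finite_spec: "finite spec"
  by (rule spectral_resolution)

text \<open>
  The matrices of \<open>spectral_resolution\<close> satisfy the definition of the \<open>G\<close>-orthogonal
  eigenprojections, because eigenvectors for different eigenvalues are orthogonal.
\<close>

lemma eigenprojection:
  fixes h u :: "complex Matrix.vec"
  shows "l \<in> spec \<Longrightarrow> Pr l \<in> carrier_mat n n"
    and "l \<in> spec \<Longrightarrow> h \<in> carrier_vec n \<Longrightarrow> K *\<^sub>v (Pr l *\<^sub>v h) = complex_of_real l \<cdot>\<^sub>v (Pr l *\<^sub>v h)"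
    and "l \<in> spec \<Longrightarrow> h \<in> carrier_vec n \<Longrightarrow> u \<in> carrier_vec n \<Longrightarrow> K *\<^sub>v u = complex_of_real l \<cdot>\<^sub>v u \<Longrightarrow>
      G_inner G (Pr l *\<^sub>v h) u = G_inner G h u"
    and "h \<in> carrier_vec n \<Longrightarrow> i < n \<Longrightarrow> h $ i = (\<Sum>l\<in>spec. (Pr l *\<^sub>v h) $ i)"
proof -
  obtain E where "finite spec" and E: "\<And>l. E l \<in> carrier_mat n n"
    "\<And>l h. h \<in> carrier_vec n \<Longrightarrow> K *\<^sub>v (E l *\<^sub>v h) = complex_of_real l \<cdot>\<^sub>v (E l *\<^sub>v h)"
    "\<And>h i. h \<in> carrier_vec n \<Longrightarrow> i < n \<Longrightarrow> h $ i = (\<Sum>l\<in>spec. (E l *\<^sub>v h) $ i)"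
    using spectral_resolution by blast
  have Ev: "E l *\<^sub>v h \<in> carrier_vec n" if "h \<in> carrier_vec n" for l h using E(1)[of l] that by simp
  have red: "G_inner G (E l *\<^sub>v h) u = G_inner G h u"
    if h: "h \<in> carrier_vec n" and u: "u \<in> carrier_vec n" "K *\<^sub>v u = complex_of_real l \<cdot>\<^sub>v u" and l: "l \<in> spec" for l h u
  proof -
    have "G_inner G h u = (\<Sum>m\<in>spec. G_inner G (E m *\<^sub>v h) u)"
      by (rule G_inner_sum_left[OF G u(1) h Ev[OF h] E(3)[OF h]])
    also have "\<dots> = (\<Sum>m\<in>spec. if m = l then G_inner G (E l *\<^sub>v h) u else 0)"
      using eigenvectors_orthogonal[OF Ev[OF h] u(1) E(2)[OF h] u(2)] by (intro sum.cong) auto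
    finally show ?thesis using l finite_spec by simp
  qed
  have eq: "Pr l = E l" if l: "l \<in> spec" for l
  proof (rule eigenprojection_unique[OF E(1)])
    fix h u :: "complex Matrix.vec"
    assume h: "h \<in> carrier_vec n" and "u \<in> eigenspace K (complex_of_real l)"
    then have u: "u \<in> carrier_vec n" "K *\<^sub>v u = complex_of_real l \<cdot>\<^sub>v u" by (simp_all add: eigenspace_eq)
    show "G_inner G (h - E l *\<^sub>v h) u = 0"
      unfolding G_inner_minus_left[OF G u(1) h Ev[OF h]] red[OF h u l] by simp
  qed (use E(2) Ev in \<open>simp add: eigenspace_eq\<close>)
  show "l \<in> spec \<Longrightarrow> Pr l \<in> carrier_mat n n" using E(1) eq by simp
  show "l \<in> spec \<Longrightarrow> h \<in> carrier_vec n \<Longrightarrow> K *\<^sub>v (Pr l *\<^sub>v h) = complex_of_real l \<cdot>\<^sub>v (Pr l *\<^sub>v h)"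
    using E(2) eq by simp
  show "l \<in> spec \<Longrightarrow> h \<in> carrier_vec n \<Longrightarrow> u \<in> carrier_vec n \<Longrightarrow> K *\<^sub>v u = complex_of_real l \<cdot>\<^sub>v u \<Longrightarrow>
      G_inner G (Pr l *\<^sub>v h) u = G_inner G h u"
    using red eq by simp
  assume "h \<in> carrier_vec n" "i < n"
  then have "h $ i = (\<Sum>l\<in>spec. (E l *\<^sub>v h) $ i)" by (rule E(3))
  also have "\<dots> = (\<Sum>l\<in>spec. (Pr l *\<^sub>v h) $ i)" using eq by (intro sum.cong) auto
  finally show "h $ i = (\<Sum>l\<in>spec. (Pr l *\<^sub>v h) $ i)" .
qed

lemma Pr_carrier [simp]: "l \<in> spec \<Longrightarrow> h \<in> carrier_vec n \<Longrightarrow> Pr l *\<^sub>v h \<in> carrier_vec n"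
  using eigenprojection(1)[of l] by simp

lemma Pr_inner: "l \<in> spec \<Longrightarrow> h \<in> carrier_vec n \<Longrightarrow> k \<in> carrier_vec n \<Longrightarrow>
    G_inner G (Pr l *\<^sub>v h) (Pr l *\<^sub>v k) = G_inner G h (Pr l *\<^sub>v k)"
  by (rule eigenprojection(3)) (simp_all add: eigenprojection(2))

lemma Pr_inner': "l \<in> spec \<Longrightarrow> h \<in> carrier_vec n \<Longrightarrow> k \<in> carrier_vec n \<Longrightarrow>
    G_inner G (Pr l *\<^sub>v h) k = G_inner G (Pr l *\<^sub>v h) (Pr l *\<^sub>v k)"
  using Pr_inner[of l k h] inner_sym[of k "Pr l *\<^sub>v h"] inner_sym[of "Pr l *\<^sub>v k" "Pr l *\<^sub>v h"]
  by (metis Pr_carrier)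

lemma inner_expand:
  assumes "h \<in> carrier_vec n" "k \<in> carrier_vec n"
  shows "G_inner G h k = (\<Sum>l\<in>spec. G_inner G (Pr l *\<^sub>v h) (Pr l *\<^sub>v k))"
proof -
  have "G_inner G h k = (\<Sum>l\<in>spec. G_inner G (Pr l *\<^sub>v h) k)"
    using assms by (intro G_inner_sum_left[OF G]) (auto intro: eigenprojection(4))
  also have "\<dots> = (\<Sum>l\<in>spec. G_inner G (Pr l *\<^sub>v h) (Pr l *\<^sub>v k))"
    using assms by (intro sum.cong refl Pr_inner')
  finally show ?thesis .
qed

lemma G_norm_expand:
  assumes "h \<in> carrier_vec n"
  shows "(G_norm G h)\<^sup>2 = (\<Sum>l\<in>spec. (G_norm G (Pr l *\<^sub>v h))\<^sup>2)"
proof -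
  have "complex_of_real ((G_norm G h)\<^sup>2) = complex_of_real (\<Sum>l\<in>spec. (G_norm G (Pr l *\<^sub>v h))\<^sup>2)"
    using inner_expand[OF assms assms] assms by (simp add: inner_self)
  then show ?thesis by (simp only: of_real_eq_iff)
qed

text \<open>
  The eigenprojections commute with \<open>K\<close>. Both sides lie in the eigenspace, and their difference
  is orthogonal to it.
\<close>

lemma Pr_minus:
  assumes "l \<in> spec" "h \<in> carrier_vec n"
  shows "Pr l *\<^sub>v (K *\<^sub>v h - complex_of_real a \<cdot>\<^sub>v h) = complex_of_real (l - a) \<cdot>\<^sub>v (Pr l *\<^sub>v h)"
    (is "?w = ?c \<cdot>\<^sub>v ?p")
proof -
  have dims: "dim_row (Pr l) = n" using eigenprojection(1)[OF assms(1)] by simp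
  have c: "?p \<in> carrier_vec n" "K *\<^sub>v h - complex_of_real a \<cdot>\<^sub>v h \<in> carrier_vec n" "?w \<in> carrier_vec n"
    using assms by simp_all
  define d where "d = ?w - ?c \<cdot>\<^sub>v ?p"
  have "?c \<cdot>\<^sub>v ?p \<in> eigenspace K (complex_of_real l)"
    using c eigenprojection(2)[OF assms]
    by (simp add: eigenspace_eq mult_mat_vec[OF K c(1)] smult_smult_assoc mult.commute)
  moreover have "?w \<in> eigenspace K (complex_of_real l)"
    using c eigenprojection(2)[OF assms(1) c(2)] by (simp add: eigenspace_eq)
  ultimately have "d \<in> eigenspace K (complex_of_real l)" unfolding d_def by (intro eigenspace_minus)
  then have d: "d \<in> carrier_vec n" "K *\<^sub>v d = complex_of_real l \<cdot>\<^sub>v d" by (simp_all add: eigenspace_eq)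
  have "G_inner G ?w d = G_inner G (K *\<^sub>v h) d - complex_of_real a * G_inner G h d"
    using assms c d
    by (simp add: eigenprojection(3) G_inner_minus_left[OF G] G_inner_smult_left[OF G])
  also have "\<dots> = ?c * G_inner G ?p d"
    using inner_K[OF assms(2) d(1)] d assms
    by (simp add: inner_smult_right eigenprojection(3) algebra_simps)
  finally have "G_inner G d d = 0"
    by (subst (1) d_def) (simp add: G_inner_minus_left[OF G d(1) c(3)] G_inner_smult_left[OF G] c d)
  then have "d = 0\<^sub>v n" by (rule inner_definite[OF d(1)])
  show ?thesis
  proof (rule eq_vecI)
    fix i assume "i < dim_vec (?c \<cdot>\<^sub>v ?p)"
    then have i: "i < n" using dims by simp
    have "d $ i = ?w $ i - (?c \<cdot>\<^sub>v ?p) $ i" unfolding d_def using dims i by (intro index_minus_vec) simp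
    then show "?w $ i = (?c \<cdot>\<^sub>v ?p) $ i" using \<open>d = 0\<^sub>v n\<close> i by simp
  qed (use dims in simp)
qed

lemma G_norm_smult:
  assumes "h \<in> carrier_vec n"
  shows "G_norm G (complex_of_real a \<cdot>\<^sub>v h) = \<bar>a\<bar> * G_norm G h"
proof -
  have "G_inner G (complex_of_real a \<cdot>\<^sub>v h) (complex_of_real a \<cdot>\<^sub>v h) = complex_of_real (a\<^sup>2) * G_inner G h h"
    using assms by (simp add: G_inner_smult_left[OF G] inner_smult_right power2_eq_square)
  then have "Re (G_inner G (complex_of_real a \<cdot>\<^sub>v h) (complex_of_real a \<cdot>\<^sub>v h)) = a\<^sup>2 * Re (G_inner G h h)"
    by (simp only: Re_complex_of_real times_complex.sel Im_complex_of_real mult_zero_left diff_zero)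
  then show ?thesis by (simp add: G_norm_def real_sqrt_mult)
qed

lemma sum_norm_Pr_le:
  assumes "h \<in> carrier_vec n" "k \<in> carrier_vec n"
  shows "(\<Sum>l\<in>spec. G_norm G (Pr l *\<^sub>v h) * G_norm G (Pr l *\<^sub>v k)) \<le> G_norm G h * G_norm G k"
proof -
  have norm: "L2_set (\<lambda>l. G_norm G (Pr l *\<^sub>v u)) spec = G_norm G u" if "u \<in> carrier_vec n" for u
    using that by (simp add: L2_set_def G_norm_expand[symmetric])
  have "(\<Sum>l\<in>spec. \<bar>G_norm G (Pr l *\<^sub>v h)\<bar> * \<bar>G_norm G (Pr l *\<^sub>v k)\<bar>) \<le> G_norm G h * G_norm G k"
    using L2_set_mult_ineq[of "\<lambda>l. G_norm G (Pr l *\<^sub>v h)" "\<lambda>l. G_norm G (Pr l *\<^sub>v k)" spec] norm assms by simp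
  then show ?thesis using assms by simp
qed

lemma
  fixes f :: "real \<Rightarrow> 'b::{banach, second_countable_topology}"
  assumes v: "v \<in> carrier_vec n"
  shows finite_matrix_spectral_measure: "finite_measure (matrix_spectral_measure G K v)"
    and integral_matrix_spectral_measure: "f \<in> borel_measurable borel \<Longrightarrow>
      (LINT t|matrix_spectral_measure G K v. f t) = (\<Sum>l\<in>spec. (G_norm G (Pr l *\<^sub>v v))\<^sup>2 *\<^sub>R f l)"
proof -
  let ?w = "\<lambda>l. Re (G_inner G (Pr l *\<^sub>v v) v)"
  let ?p = "point_measure spec (\<lambda>l. ennreal (?w l))"
  have w: "?w l = (G_norm G (Pr l *\<^sub>v v))\<^sup>2" if "l \<in> spec" for l
    using Pr_inner'[OF that v v] inner_self[of "Pr l *\<^sub>v v"] that v by simp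
  have meas: "(\<lambda>l. l) \<in> measurable ?p borel" by simp
  have "finite_measure ?p"
    by (intro finite_measureI)
       (simp add: emeasure_point_measure_finite[OF finite_spec] space_point_measure sum_ennreal w)
  then show "finite_measure (matrix_spectral_measure G K v)"
    unfolding matrix_spectral_measure_def using finite_measure.finite_measure_distr[OF _ meas] by simp
  assume f: "f \<in> borel_measurable borel"
  have "(LINT t|matrix_spectral_measure G K v. f t) = (LINT t|?p. f t)"
    unfolding matrix_spectral_measure_def by (rule integral_distr[OF meas f])
  also have "\<dots> = (\<Sum>l\<in>spec. ?w l *\<^sub>R f l)"
    by (rule lebesgue_integral_point_measure_finite[OF finite_spec]) (simp add: w)
  finally show "(LINT t|matrix_spectral_measure G K v. f t) = (\<Sum>l\<in>spec. (G_norm G (Pr l *\<^sub>v v))\<^sup>2 *\<^sub>R f l)"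
    using w by simp
qed

text \<open>
  Expanding everything in eigencomponents, the difference is the real part of
  \<open>\<Sum>\<^sub>l f(l) \<langle>Pr l r, Pr l v\<rangle> + \<Sum>\<^sub>j \<Sum>\<^sub>l (f(l) - f(a\<^sub>j)) \<langle>Pr l u\<^sub>j, Pr l v\<rangle>\<close>. In the second sum
  \<open>\<bar>f(l) - f(a\<^sub>j)\<bar> \<parallel>Pr l u\<^sub>j\<parallel> \<le> L \<bar>l - a\<^sub>j\<bar> \<parallel>Pr l u\<^sub>j\<parallel> = L \<parallel>Pr l (K - a\<^sub>j) u\<^sub>j\<parallel>\<close>, and Cauchy--Schwarz over \<open>l\<close>
  recombines the components.
\<close>

lemma spectral_integral_approx:
  fixes f :: "real \<Rightarrow> real"
  assumes lip: "L-lipschitz_on UNIV f" and f01: "\<And>t. 0 \<le> f t \<and> f t \<le> 1"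
    and v: "v \<in> carrier_vec n" and r: "r \<in> carrier_vec n"
    and u: "\<And>j. j \<in> J \<Longrightarrow> u j \<in> carrier_vec n"
    and split: "\<And>i. i < n \<Longrightarrow> v $ i = r $ i + (\<Sum>j\<in>J. u j $ i)"
  shows "\<bar>(LINT t|matrix_spectral_measure G K v. f t) - (\<Sum>j\<in>J. f (a j) * Re (G_inner G (u j) v))\<bar>
    \<le> (G_norm G r + L * (\<Sum>j\<in>J. G_norm G (K *\<^sub>v u j - complex_of_real (a j) \<cdot>\<^sub>v u j))) * G_norm G v"
proof -
  have L: "0 \<le> L" using lip by (rule lipschitz_on_nonneg)
  let ?s = "\<lambda>h l. Re (G_inner G (Pr l *\<^sub>v h) (Pr l *\<^sub>v v))"
  let ?N = "\<lambda>h l. G_norm G (Pr l *\<^sub>v h)"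
  have s_le: "\<bar>?s h l\<bar> \<le> ?N h l * ?N v l" if "h \<in> carrier_vec n" "l \<in> spec" for h l
    using order_trans[OF abs_Re_le_cmod cauchy_schwarz[of "Pr l *\<^sub>v h" "Pr l *\<^sub>v v"]] that v by simp
  have "f \<in> borel_measurable borel"
    using lipschitz_on_continuous_on[OF lip] by (rule borel_measurable_continuous_onI)
  from integral_matrix_spectral_measure[OF v this]
  have "(LINT t|matrix_spectral_measure G K v. f t) = (\<Sum>l\<in>spec. f l * ?s v l)"
    using v by (auto simp: inner_self mult.commute intro!: sum.cong)
  also have "\<dots> = (\<Sum>l\<in>spec. f l * (?s r l + (\<Sum>j\<in>J. ?s (u j) l)))"
  proof (intro sum.cong refl)
    fix l assume l: "l \<in> spec"
    define J' where "J' = insert None (Some ` J)"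
    define u' where "u' = case_option r u"
    show "f l * ?s v l = f l * (?s r l + (\<Sum>j\<in>J. ?s (u j) l))"
    proof (cases "finite J")
      case True
      have "G_inner G v (Pr l *\<^sub>v v) = (\<Sum>j\<in>J'. G_inner G (u' j) (Pr l *\<^sub>v v))"
        using True v r u l split
        by (intro G_inner_sum_left[OF G]) (auto simp: J'_def u'_def sum.reindex)
      also have "\<dots> = G_inner G r (Pr l *\<^sub>v v) + (\<Sum>j\<in>J. G_inner G (u j) (Pr l *\<^sub>v v))"
        using True by (simp add: J'_def u'_def sum.reindex)
      finally show ?thesis using l v r u by (simp add: Pr_inner)
    next
      case False
      have "v = r" using split v r False by (intro eq_vecI) auto
      then show ?thesis using False by simp
    qed
  qed
  also have "\<dots> = (\<Sum>l\<in>spec. f l * ?s r l) + (\<Sum>j\<in>J. \<Sum>l\<in>spec. f l * ?s (u j) l)"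
    by (subst sum.swap) (simp add: distrib_left sum.distrib sum_distrib_left)
  finally have 1: "(LINT t|matrix_spectral_measure G K v. f t) = \<dots>" .
  have 2: "(\<Sum>j\<in>J. f (a j) * Re (G_inner G (u j) v)) = (\<Sum>j\<in>J. \<Sum>l\<in>spec. f (a j) * ?s (u j) l)"
    by (intro sum.cong refl) (simp only: inner_expand[OF u v] Re_sum sum_distrib_left)
  have "\<bar>(LINT t|matrix_spectral_measure G K v. f t) - (\<Sum>j\<in>J. f (a j) * Re (G_inner G (u j) v))\<bar>
    = \<bar>(\<Sum>l\<in>spec. f l * ?s r l) + (\<Sum>j\<in>J. \<Sum>l\<in>spec. (f l - f (a j)) * ?s (u j) l)\<bar>"
    unfolding 1 2 by (simp add: sum_subtractf left_diff_distrib)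
  also have "\<dots> \<le> (\<Sum>l\<in>spec. \<bar>f l * ?s r l\<bar>) + (\<Sum>j\<in>J. \<Sum>l\<in>spec. \<bar>(f l - f (a j)) * ?s (u j) l\<bar>)"
    by (intro order_trans[OF abs_triangle_ineq] add_mono order_trans[OF sum_abs] sum_mono order.refl sum_abs)
  also have "\<dots> \<le> G_norm G r * G_norm G v +
      (\<Sum>j\<in>J. L * (G_norm G (K *\<^sub>v u j - complex_of_real (a j) \<cdot>\<^sub>v u j) * G_norm G v))"
  proof (intro add_mono sum_mono)
    have "(\<Sum>l\<in>spec. \<bar>f l * ?s r l\<bar>) \<le> (\<Sum>l\<in>spec. ?N r l * ?N v l)"
    proof (intro sum_mono)
      fix l assume "l \<in> spec"
      then have "\<bar>f l\<bar> * \<bar>?s r l\<bar> \<le> 1 * (?N r l * ?N v l)"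
        using f01[of l] s_le[OF r] by (intro mult_mono) auto
      then show "\<bar>f l * ?s r l\<bar> \<le> ?N r l * ?N v l" by (simp add: abs_mult)
    qed
    also have "\<dots> \<le> G_norm G r * G_norm G v" by (rule sum_norm_Pr_le[OF r v])
    finally show "(\<Sum>l\<in>spec. \<bar>f l * ?s r l\<bar>) \<le> G_norm G r * G_norm G v" .
    fix j assume j: "j \<in> J"
    let ?w = "K *\<^sub>v u j - complex_of_real (a j) \<cdot>\<^sub>v u j"
    have w: "?w \<in> carrier_vec n" using u[OF j] by simp
    have "(\<Sum>l\<in>spec. \<bar>(f l - f (a j)) * ?s (u j) l\<bar>) \<le> (\<Sum>l\<in>spec. L * (?N ?w l * ?N v l))"
    proof (intro sum_mono)
      fix l assume l: "l \<in> spec"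
      have "\<bar>f l - f (a j)\<bar> \<le> L * \<bar>l - a j\<bar>"
        using lipschitz_onD[OF lip, of l "a j"] by (simp add: dist_real_def)
      then have "\<bar>f l - f (a j)\<bar> * \<bar>?s (u j) l\<bar> \<le> (L * \<bar>l - a j\<bar>) * (?N (u j) l * ?N v l)"
        using s_le[OF u[OF j] l] L by (intro mult_mono) auto
      also have "\<dots> = L * (?N ?w l * ?N v l)"
        using l u[OF j] by (simp add: Pr_minus G_norm_smult del: of_real_diff)
      finally show "\<bar>(f l - f (a j)) * ?s (u j) l\<bar> \<le> L * (?N ?w l * ?N v l)"
        by (simp add: abs_mult)
    qed
    also have "\<dots> \<le> L * (G_norm G ?w * G_norm G v)"
      unfolding sum_distrib_left[symmetric] by (intro mult_left_mono sum_norm_Pr_le w v L)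
    finally show "(\<Sum>l\<in>spec. \<bar>(f l - f (a j)) * ?s (u j) l\<bar>) \<le> L * (G_norm G ?w * G_norm G v)" .
  qed
  finally show ?thesis by (simp add: sum_distrib_left sum_distrib_right algebra_simps)
qed

end

section \<open>Continuity of matrix spectral measures\<close>

lemma tendsto_G_norm:
  assumes "\<forall>\<^sub>F M in F. G M \<in> carrier_mat n n \<and> h M \<in> carrier_vec n"
    and "G' \<in> carrier_mat n n" "h' \<in> carrier_vec n"
    and "\<And>i j. i < n \<Longrightarrow> j < n \<Longrightarrow> ((\<lambda>M. G M $$ (i, j)) \<longlongrightarrow> G' $$ (i, j)) F"
    and "\<And>i. i < n \<Longrightarrow> ((\<lambda>M. h M $ i) \<longlongrightarrow> h' $ i) F"
  shows "((\<lambda>M. G_norm (G M) (h M)) \<longlongrightarrow> G_norm G' h') F"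
  unfolding G_norm_def
  by (intro tendsto_real_sqrt tendsto_Re tendsto_G_inner[where n = n] assms(2-) eventually_mono[OF assms(1)]) auto

text \<open>
  The eigencomponents \<open>u l\<close> of \<open>v\<close> for the limit matrix are test vectors for the approximating
  matrices: there \<open>(KM M - l) u l\<close> tends to \<open>(K - l) u l = 0\<close>.
\<close>

theorem matrix_spectral_measure_tendsto:
  fixes f :: "real \<Rightarrow> 'b::{banach, second_countable_topology}"
  assumes sa: "G_selfadjoint n G K" and v: "v \<in> carrier_vec n"
    and ev: "\<forall>\<^sub>F M in sequentially. G_selfadjoint n (GM M) (KM M) \<and> vM M \<in> carrier_vec n"
    and limG: "\<And>i j. i < n \<Longrightarrow> j < n \<Longrightarrow> (\<lambda>M. GM M $$ (i, j)) \<longlonglongrightarrow> G $$ (i, j)"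
    and limK: "\<And>i j. i < n \<Longrightarrow> j < n \<Longrightarrow> (\<lambda>M. KM M $$ (i, j)) \<longlonglongrightarrow> K $$ (i, j)"
    and limv: "\<And>i. i < n \<Longrightarrow> (\<lambda>M. vM M $ i) \<longlonglongrightarrow> v $ i"
    and f: "continuous_on UNIV f" "bounded (range f)"
  shows "(\<lambda>M. LINT l|matrix_spectral_measure (GM M) (KM M) (vM M). f l)
    \<longlonglongrightarrow> (LINT l|matrix_spectral_measure G K v. f l)"
proof (rule weak_convergence_from_lipschitz[OF _ _ _ _ f])
  interpret G_selfadjoint n G K by (rule sa)
  have sets: "sets (matrix_spectral_measure A B h) = sets borel" for A B h
    by (simp add: matrix_spectral_measure_def)
  show "\<forall>\<^sub>F M in sequentially. finite_measure (matrix_spectral_measure (GM M) (KM M) (vM M)) \<and>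
      sets (matrix_spectral_measure (GM M) (KM M) (vM M)) = sets borel"
    using ev by eventually_elim (auto simp: sets intro: G_selfadjoint.finite_matrix_spectral_measure)
  show "finite_measure (matrix_spectral_measure G K v)" by (rule finite_matrix_spectral_measure[OF v])
  show "sets (matrix_spectral_measure G K v) = sets borel" by (rule sets)
  fix h :: "real \<Rightarrow> real" and L
  assume lip: "L-lipschitz_on UNIV h" and h01: "\<And>t. 0 \<le> h t \<and> h t \<le> 1"
  define u where "u l = Pr l *\<^sub>v v" for l
  have u: "u l \<in> carrier_vec n" if "l \<in> spec" for l using that v by (simp add: u_def)
  let ?I = "\<lambda>M. LINT l|matrix_spectral_measure (GM M) (KM M) (vM M). h l"
  let ?S = "\<lambda>M. \<Sum>l\<in>spec. h l * Re (G_inner (GM M) (u l) (vM M))"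
  let ?w = "\<lambda>M l. KM M *\<^sub>v u l - complex_of_real l \<cdot>\<^sub>v u l"
  let ?B = "\<lambda>M. (G_norm (GM M) (vM M - v) + L * (\<Sum>l\<in>spec. G_norm (GM M) (?w M l))) * G_norm (GM M) (vM M)"
  have evG: "\<forall>\<^sub>F M in sequentially. GM M \<in> carrier_mat n n \<and> KM M \<in> carrier_mat n n \<and> vM M \<in> carrier_vec n"
    using ev by eventually_elim (auto dest: G_selfadjoint.G G_selfadjoint.K)
  have "h \<in> borel_measurable borel"
    using lipschitz_on_continuous_on[OF lip] by (rule borel_measurable_continuous_onI)
  then have int: "(LINT l|matrix_spectral_measure G K v. h l) = (\<Sum>l\<in>spec. h l * Re (G_inner G (u l) v))"
    using integral_matrix_spectral_measure[OF v, of h] Pr_inner'[OF _ v v]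
    by (auto simp: inner_self u_def v mult.commute intro!: sum.cong)
  have S: "?S \<longlonglongrightarrow> (LINT l|matrix_spectral_measure G K v. h l)"
    unfolding int
    by (intro tendsto_intros tendsto_G_inner[where n = n] limG limv v G u eventually_mono[OF evG]) (auto simp: u)
  have norm_v: "(\<lambda>M. G_norm (GM M) (vM M)) \<longlonglongrightarrow> G_norm G v"
    by (intro tendsto_G_norm[where n = n] limG limv v G eventually_mono[OF evG]) auto
  have zero: "G_norm G (0\<^sub>v n) = 0" using G by (simp add: G_norm_def G_inner_def)
  have "(\<lambda>M. G_norm (GM M) (vM M - v)) \<longlonglongrightarrow> G_norm G (0\<^sub>v n)"
  proof (intro tendsto_G_norm[where n = n] limG G eventually_mono[OF evG])
    fix i assume i: "i < n"
    have "(\<lambda>M. vM M $ i - v $ i) \<longlonglongrightarrow> 0\<^sub>v n $ i" using tendsto_diff[OF limv[OF i] tendsto_const[of "v $ i"]] i by simp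
    then show "(\<lambda>M. (vM M - v) $ i) \<longlonglongrightarrow> 0\<^sub>v n $ i" using v i by simp
  qed (use v in auto)
  moreover have "(\<lambda>M. G_norm (GM M) (?w M l)) \<longlonglongrightarrow> G_norm G (0\<^sub>v n)" if l: "l \<in> spec" for l
  proof (intro tendsto_G_norm[where n = n] limG G eventually_mono[OF evG])
    fix i assume i: "i < n"
    have "(\<lambda>M. (\<Sum>j<n. KM M $$ (i, j) * u l $ j) - complex_of_real l * u l $ i)
      \<longlonglongrightarrow> (\<Sum>j<n. K $$ (i, j) * u l $ j) - complex_of_real l * u l $ i"
      by (intro tendsto_intros limK i) auto
    also have "(\<Sum>j<n. K $$ (i, j) * u l $ j) - complex_of_real l * u l $ i = 0\<^sub>v n $ i"
    proof -
      have "K *\<^sub>v u l = complex_of_real l \<cdot>\<^sub>v u l" unfolding u_def by (rule eigenprojection(2)[OF l v])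
      then have "(K *\<^sub>v u l) $ i = complex_of_real l * u l $ i" using u[OF l] i by (simp del: index_mult_mat_vec)
      then show ?thesis using i by (simp add: mult_mat_vec_index[OF K u[OF l] i] del: index_mult_mat_vec)
    qed
    finally have lim: "(\<lambda>M. (\<Sum>j<n. KM M $$ (i, j) * u l $ j) - complex_of_real l * u l $ i) \<longlonglongrightarrow> 0\<^sub>v n $ i" .
    have "\<forall>\<^sub>F M in sequentially. (\<Sum>j<n. KM M $$ (i, j) * u l $ j) - complex_of_real l * u l $ i = ?w M l $ i"
      using evG
    proof eventually_elim
      case (elim M)
      then have "(KM M *\<^sub>v u l) $ i = (\<Sum>j<n. KM M $$ (i, j) * u l $ j)"
        using u[OF l] i by (intro mult_mat_vec_index) auto
      then show ?case using u[OF l] i by (simp del: index_mult_mat_vec)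
    qed
    with lim show "(\<lambda>M. ?w M l $ i) \<longlonglongrightarrow> 0\<^sub>v n $ i" by (rule Lim_transform_eventually)
  qed (use u[OF l] in auto)
  ultimately have "?B \<longlonglongrightarrow> (0 + L * (\<Sum>l\<in>spec. 0)) * G_norm G v"
    unfolding zero by (intro tendsto_intros norm_v) auto
  then have B: "?B \<longlonglongrightarrow> 0" by simp
  have "\<forall>\<^sub>F M in sequentially. norm (?I M - ?S M) \<le> ?B M"
    using ev
  proof eventually_elim
    case (elim M)
    then interpret M: G_selfadjoint n "GM M" "KM M" by simp
    have "vM M $ i = (vM M - v) $ i + (\<Sum>l\<in>spec. u l $ i)" if "i < n" for i
      using eigenprojection(4)[OF v that] v that elim by (simp add: u_def)
    then show ?case
      unfolding real_norm_def using elim v u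
      by (intro M.spectral_integral_approx[OF lip h01]) auto
  qed
  then have "(\<lambda>M. ?I M - ?S M) \<longlonglongrightarrow> 0" using B by (rule Lim_null_comparison)
  from tendsto_add[OF this S] show "?I \<longlonglongrightarrow> (LINT l|matrix_spectral_measure G K v. h l)" by simp
qed

section \<open>Adjoints, inverses and pseudoinverses\<close>

lemma mat_adjoint_mult:
  fixes A B :: "complex mat"
  assumes "A \<in> carrier_mat n m" "B \<in> carrier_mat m p"
  shows "mat_adjoint (A * B) = mat_adjoint B * mat_adjoint A"
proof (rule eq_matI)
  fix i j assume "i < dim_row (mat_adjoint B * mat_adjoint A)" "j < dim_col (mat_adjoint B * mat_adjoint A)"
  then have ij: "i < p" "j < n" using assms by auto
  have "mat_adjoint (A * B) $$ (i, j) = cnj (\<Sum>k<m. A $$ (j, k) * B $$ (k, i))"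
    using assms ij by (simp add: mult_mat_index[OF assms] del: index_mult_mat(1))
  also have "\<dots> = (\<Sum>k<m. mat_adjoint B $$ (i, k) * mat_adjoint A $$ (k, j))"
    using assms ij by (simp add: mult.commute)
  finally show "mat_adjoint (A * B) $$ (i, j) = (mat_adjoint B * mat_adjoint A) $$ (i, j)"
    using assms ij by (simp add: mult_mat_index[of _ p m _ n] del: index_mult_mat(1))
qed (use assms in auto)

lemma mat_adjoint_adjoint [simp]: "mat_adjoint (mat_adjoint A) = (A :: complex mat)"
  by (rule eq_matI) auto

lemma mat_adjoint_one [simp]: "mat_adjoint (1\<^sub>m n :: complex mat) = 1\<^sub>m n"
  by (rule eq_matI) auto

lemma mat_adjoint_hermitian_part:
  fixes A :: "complex mat"
  assumes "A \<in> carrier_mat n n"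
  shows "mat_adjoint ((1 / 2) \<cdot>\<^sub>m (A + mat_adjoint A)) = (1 / 2) \<cdot>\<^sub>m (A + mat_adjoint A)"
  by (rule eq_matI) (use assms in \<open>auto simp: add.commute\<close>)

lemma positive_definite_det:
  fixes G :: "complex mat"
  assumes G: "G \<in> carrier_mat n n"
    and pos: "\<And>h. h \<in> carrier_vec n \<Longrightarrow> h \<noteq> 0\<^sub>v n \<Longrightarrow> 0 < Re (G_inner G h h)"
  shows "det G \<noteq> 0"
proof
  assume "det G = 0"
  then obtain h where h: "h \<in> carrier_vec n" "h \<noteq> 0\<^sub>v n" "G *\<^sub>v h = 0\<^sub>v n"
    using det_0_iff_vec_prod_zero[OF G] by blast
  then have "G_inner G h h = 0" by (simp add: G_inner_def)
  with pos[OF h(1,2)] show False by simp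
qed

lemma mat_inverse_exists:
  fixes A :: "complex mat"
  assumes A: "A \<in> carrier_mat n n" and det: "det A \<noteq> 0"
  shows "\<exists>B. mat_inverse A = Some B \<and> B \<in> carrier_mat n n \<and> A * B = 1\<^sub>m n \<and> B * A = 1\<^sub>m n"
proof -
  have "mat_inverse A \<noteq> None"
    using mat_inverse(1)[OF A, where b = "()"] det_non_zero_imp_unit[OF A det, where b = "()"] by blast
  then show ?thesis using mat_inverse(2)[OF A] by blast
qed

text \<open>
  Cramer's rule; it makes the entries of the inverse continuous functions of the entries.
\<close>

lemma inverse_mat_index:
  fixes A B :: "complex mat"
  assumes A: "A \<in> carrier_mat n n" and B: "B \<in> carrier_mat n n" and AB: "A * B = 1\<^sub>m n" and ij: "i < n" "j < n"
  shows "det A \<noteq> 0" and "B $$ (i, j) = adj_mat A $$ (i, j) / det A"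
proof -
  show det: "det A \<noteq> 0" using det_mult[OF A B] AB by auto
  have "adj_mat A = adj_mat A * (A * B)" using adj_mat(1)[OF A] AB by simp
  also have "\<dots> = (adj_mat A * A) * B" using adj_mat(1)[OF A] A B by simp
  also have "\<dots> = det A \<cdot>\<^sub>m B" using adj_mat(3)[OF A] mult_smult_assoc_mat[OF one_carrier_mat B] B by simp
  finally have "adj_mat A $$ (i, j) = det A * B $$ (i, j)" using B ij by simp
  then show "B $$ (i, j) = adj_mat A $$ (i, j) / det A" using det by simp
qed

lemma tendsto_det:
  fixes A :: "nat \<Rightarrow> complex mat"
  assumes "\<forall>\<^sub>F M in sequentially. A M \<in> carrier_mat n n" "A' \<in> carrier_mat n n"
    and "\<And>i j. i < n \<Longrightarrow> j < n \<Longrightarrow> (\<lambda>M. A M $$ (i, j)) \<longlonglongrightarrow> A' $$ (i, j)"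
  shows "(\<lambda>M. det (A M)) \<longlonglongrightarrow> det A'"
proof -
  have "(\<lambda>M. \<Sum>p | p permutes {0..<n}. signof p * (\<Prod>i = 0..<n. A M $$ (i, p i))) \<longlonglongrightarrow> det A'"
    unfolding det_def'[OF assms(2)]
    by (intro tendsto_intros assms(3)) (auto simp: permutes_in_image)
  moreover have "\<forall>\<^sub>F M in sequentially. (\<Sum>p | p permutes {0..<n}. signof p * (\<Prod>i = 0..<n. A M $$ (i, p i))) = det (A M)"
    using assms(1) by eventually_elim (simp add: det_def')
  ultimately show ?thesis by (rule Lim_transform_eventually)
qed

lemma tendsto_adj_mat:
  fixes A :: "nat \<Rightarrow> complex mat"
  assumes A: "\<forall>\<^sub>F M in sequentially. A M \<in> carrier_mat n n" and A': "A' \<in> carrier_mat n n"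
    and lim: "\<And>i j. i < n \<Longrightarrow> j < n \<Longrightarrow> (\<lambda>M. A M $$ (i, j)) \<longlonglongrightarrow> A' $$ (i, j)"
    and ij: "i < n" "j < n"
  shows "(\<lambda>M. adj_mat (A M) $$ (i, j)) \<longlonglongrightarrow> adj_mat A' $$ (i, j)"
proof -
  have "(\<lambda>M. det (mat_delete (A M) j i)) \<longlonglongrightarrow> det (mat_delete A' j i)"
  proof (rule tendsto_det[of _ "n - 1"])
    show "\<forall>\<^sub>F M in sequentially. mat_delete (A M) j i \<in> carrier_mat (n - 1) (n - 1)"
      using A by eventually_elim (auto simp: mat_delete_def)
    show "mat_delete A' j i \<in> carrier_mat (n - 1) (n - 1)" using A' by (auto simp: mat_delete_def)
    fix k l assume kl: "k < n - 1" "l < n - 1"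
    let ?e = "\<lambda>B. B $$ (if k < j then k else Suc k, if l < i then l else Suc l) :: complex"
    have idx: "mat_delete B j i $$ (k, l) = ?e B" if "B \<in> carrier_mat n n" for B :: "complex mat"
      using that kl by (auto simp: mat_delete_def)
    have "(\<lambda>M. ?e (A M)) \<longlonglongrightarrow> ?e A'" using kl by (intro lim) auto
    moreover have "\<forall>\<^sub>F M in sequentially. ?e (A M) = mat_delete (A M) j i $$ (k, l)"
      using A by eventually_elim (rule idx[symmetric])
    ultimately show "(\<lambda>M. mat_delete (A M) j i $$ (k, l)) \<longlonglongrightarrow> mat_delete A' j i $$ (k, l)"
      unfolding idx[OF A'] by (rule Lim_transform_eventually)
  qed
  then have lim_det: "(\<lambda>M. (-1) ^ (j + i) * det (mat_delete (A M) j i)) \<longlonglongrightarrow> (-1) ^ (j + i) * det (mat_delete A' j i)"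
    by (intro tendsto_intros)
  have idx: "adj_mat B $$ (i, j) = (-1) ^ (j + i) * det (mat_delete B j i)"
    if "B \<in> carrier_mat n n" for B :: "complex mat"
    using that ij by (simp add: adj_mat_def cofactor_def)
  have "\<forall>\<^sub>F M in sequentially. (-1) ^ (j + i) * det (mat_delete (A M) j i) = adj_mat (A M) $$ (i, j)"
    using A by eventually_elim (rule idx[symmetric])
  with lim_det show ?thesis unfolding idx[OF A'] by (rule Lim_transform_eventually)
qed

lemma gram_hermitian:
  fixes B :: "complex mat"
  shows "B \<in> carrier_mat m n \<Longrightarrow> mat_adjoint (mat_adjoint B * B) = mat_adjoint B * B"
  by (simp add: mat_adjoint_mult[of _ n m])

lemma G_inner_gram:
  fixes B :: "complex mat"
  assumes B: "B \<in> carrier_mat m n" and hk: "h \<in> carrier_vec n" "k \<in> carrier_vec n"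
  shows "G_inner (mat_adjoint B * B) h k = (B *\<^sub>v h) \<bullet>c (B *\<^sub>v k)"
proof -
  let ?y = "B *\<^sub>v h"
  have y: "?y \<in> carrier_vec m" using B hk by simp
  have "G_inner (mat_adjoint B * B) h k = (mat_adjoint B *\<^sub>v ?y) \<bullet>c k"
    unfolding G_inner_def using B hk by (simp add: assoc_mult_mat_vec[of _ n m _ n])
  also have "\<dots> = (\<Sum>i<n. (mat_adjoint B *\<^sub>v ?y) $ i * cnj (k $ i))"
    using hk by (auto simp: scalar_prod_def lessThan_atLeast0 intro!: sum.cong)
  also have "\<dots> = (\<Sum>i<n. \<Sum>l<m. cnj (B $$ (l, i)) * ?y $ l * cnj (k $ i))"
  proof (intro sum.cong refl)
    fix i assume "i \<in> {..<n}"
    then have i: "i < n" by simp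
    have "(mat_adjoint B *\<^sub>v ?y) $ i = (\<Sum>l<m. cnj (B $$ (l, i)) * ?y $ l)"
      unfolding mult_mat_vec_index[OF mat_adjoint_carrier[OF B] y i]
      using B i by (intro sum.cong) auto
    then show "(mat_adjoint B *\<^sub>v ?y) $ i * cnj (k $ i) = (\<Sum>l<m. cnj (B $$ (l, i)) * ?y $ l * cnj (k $ i))"
      by (simp only: sum_distrib_right)
  qed
  also have "\<dots> = (\<Sum>l<m. \<Sum>i<n. cnj (B $$ (l, i)) * ?y $ l * cnj (k $ i))"
    by (rule sum.swap)
  also have "\<dots> = (\<Sum>l<m. ?y $ l * cnj ((B *\<^sub>v k) $ l))"
    by (intro sum.cong refl) (simp add: mult_mat_vec_index[OF B hk(2)] sum_distrib_left mult_ac del: index_mult_mat_vec)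
  also have "\<dots> = ?y \<bullet>c (B *\<^sub>v k)"
    using B by (auto simp: scalar_prod_def[of _ "conjugate (B *\<^sub>v k)"] lessThan_atLeast0 simp del: index_mult_mat_vec intro!: sum.cong)
  finally show ?thesis .
qed

lemma gram_positive:
  fixes B :: "complex mat"
  assumes B: "B \<in> carrier_mat m n" and det: "det (mat_adjoint B * B) \<noteq> 0"
    and h: "h \<in> carrier_vec n" "h \<noteq> 0\<^sub>v n"
  shows "0 < Re (G_inner (mat_adjoint B * B) h h)"
proof -
  have "B *\<^sub>v h \<noteq> 0\<^sub>v m"
  proof
    assume z: "B *\<^sub>v h = 0\<^sub>v m"
    have "(mat_adjoint B * B) *\<^sub>v h = mat_adjoint B *\<^sub>v (B *\<^sub>v h)"
      using B h by (simp add: assoc_mult_mat_vec[of _ n m _ n])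
    also have "\<dots> = 0\<^sub>v n" unfolding z using B by (intro eq_vecI) auto
    finally show False
      using det_0_iff_vec_prod_zero[OF mult_carrier_mat[OF mat_adjoint_carrier[OF B] B]] det h by auto
  qed
  then have "(B *\<^sub>v h) \<bullet>c (B *\<^sub>v h) > 0" using B h by (intro conjugate_square_greater_0_vec[THEN iffD2]) auto
  then show ?thesis unfolding G_inner_gram[OF B h(1) h(1)] by (simp add: less_complex_def)
qed

text \<open>
  For a matrix of full column rank the four Penrose equations have exactly one solution,
  \<open>(B\<^sup>* B)\<^sup>-\<^sup>1 B\<^sup>*\<close>: they give \<open>B\<^sup>* B X = B\<^sup>* (B X)\<^sup>* = (B X B)\<^sup>* = B\<^sup>*\<close>. Since \<open>pinv\<close> is a definite
  description, its dimensions are known only once this is established.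
\<close>

lemma pinv_carrier:
  fixes B :: "complex mat"
  assumes B: "B \<in> carrier_mat m n" and det: "det (mat_adjoint B * B) \<noteq> 0"
  shows "pinv B \<in> carrier_mat n m"
proof -
  let ?G = "mat_adjoint B * B"
  have Bs: "mat_adjoint B \<in> carrier_mat n m" and G: "?G \<in> carrier_mat n n" using B by auto
  obtain I where I: "I \<in> carrier_mat n n" "?G * I = 1\<^sub>m n" "I * ?G = 1\<^sub>m n"
    using mat_inverse_exists[OF G det] by blast
  have I_adj: "mat_adjoint I = I"
  proof -
    have "mat_adjoint I * ?G = 1\<^sub>m n"
      using mat_adjoint_mult[OF G I(1)] I(2) gram_hermitian[OF B] by simp
    then have "mat_adjoint I * (?G * I) = I"
      using assoc_mult_mat[OF mat_adjoint_carrier[OF I(1)] G I(1)] I(1) by simp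
    then show ?thesis unfolding I(2) using right_mult_one_mat[OF mat_adjoint_carrier[OF I(1)]] by simp
  qed
  define X where "X = I * mat_adjoint B"
  have X: "X \<in> carrier_mat n m" using I Bs by (simp add: X_def)
  have XB: "X * B = 1\<^sub>m n" unfolding X_def using assoc_mult_mat[OF I(1) Bs B] I(3) by simp
  have BX: "mat_adjoint (B * X) = B * X"
  proof -
    have "mat_adjoint (B * X) = mat_adjoint X * mat_adjoint B" by (rule mat_adjoint_mult[OF B X])
    also have "mat_adjoint X = B * I" unfolding X_def mat_adjoint_mult[OF I(1) Bs] I_adj by simp
    also have "B * I * mat_adjoint B = B * X" unfolding X_def by (rule assoc_mult_mat[OF B I(1) Bs])
    finally show ?thesis .
  qed
  let ?P = "\<lambda>X. X \<in> carrier_mat (dim_col B) (dim_row B) \<and> B * X * B = B \<and> X * B * X = X \<and>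
     mat_adjoint (B * X) = B * X \<and> mat_adjoint (X * B) = X * B"
  have dims: "dim_col B = n" "dim_row B = m" using B by auto
  have P: "?P X"
    using X XB BX B dims assoc_mult_mat[OF B X B] by simp
  have U: "Y = X" if "?P Y" for Y
  proof -
    have Y: "Y \<in> carrier_mat n m" "B * Y * B = B" "mat_adjoint (B * Y) = B * Y" using that dims by auto
    have "?G * Y = mat_adjoint B * mat_adjoint (B * Y)"
      unfolding Y(3) using B Bs Y(1) by (intro assoc_mult_mat) auto
    also have "\<dots> = mat_adjoint (B * Y * B)"
      using mat_adjoint_mult[of "B * Y" m m B n] B Y by simp
    finally have "?G * Y = mat_adjoint B" unfolding Y(2) .
    then have "I * (?G * Y) = X" by (simp add: X_def)
    then show "Y = X" unfolding assoc_mult_mat[OF I(1) G Y(1), symmetric] I(3) using Y(1) by simp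
  qed
  have "pinv B = X" unfolding pinv_def using P U by (rule the_equality)
  with X show ?thesis by simp
qed

section \<open>The quadrature limit of Hermitian DMD\<close>

lemma dict_mat_carrier [simp]: "dict_mat \<psi> z M N \<in> carrier_mat M N"
  by (simp add: dict_mat_def)

lemma weight_mat_carrier [simp]: "weight_mat w M \<in> carrier_mat M M" "sqrt_weight_mat w M \<in> carrier_mat M M"
  by (simp_all add: weight_mat_def sqrt_weight_mat_def)

lemma dmd_carrier [simp]: "dmd_G \<psi> x w N M \<in> carrier_mat N N" "dmd_A \<psi> F x w N M \<in> carrier_mat N N"
  unfolding dmd_G_def dmd_A_def
  by (intro mult_carrier_mat[of _ N M _ N] mult_carrier_mat[of _ N M _ M] mat_adjoint_carrier dict_mat_carrier weight_mat_carrier)+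

lemma dmd_G_eq_gram:
  assumes "\<And>m. m < M \<Longrightarrow> 0 \<le> w m"
  shows "dmd_G \<psi> x w N M =
    mat_adjoint (sqrt_weight_mat w M * dict_mat \<psi> x M N) * (sqrt_weight_mat w M * dict_mat \<psi> x M N)"
proof -
  let ?S = "sqrt_weight_mat w M" and ?X = "dict_mat \<psi> x M N"
  define B where "B = ?S * ?X"
  have S: "mat_adjoint ?S = ?S" "?S * ?S = weight_mat w M"
    using assms unfolding sqrt_weight_mat_def weight_mat_def
    by (auto simp: mat_diag_def simp flip: of_real_mult intro!: eq_matI)
       (auto simp: scalar_prod_def if_distrib cong: if_cong simp flip: of_real_mult)
  have Xs: "mat_adjoint ?X \<in> carrier_mat N M" by simp
  have "mat_adjoint B * B = (mat_adjoint ?X * ?S) * (?S * ?X)"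
    unfolding B_def mat_adjoint_mult[OF weight_mat_carrier(2) dict_mat_carrier] S(1) ..
  also have "\<dots> = mat_adjoint ?X * (?S * (?S * ?X))"
    by (rule assoc_mult_mat[OF Xs weight_mat_carrier(2) mult_carrier_mat[OF weight_mat_carrier(2) dict_mat_carrier]])
  also have "?S * (?S * ?X) = weight_mat w M * ?X"
    unfolding assoc_mult_mat[OF weight_mat_carrier(2) weight_mat_carrier(2) dict_mat_carrier, symmetric] S(2) ..
  also have "mat_adjoint ?X * (weight_mat w M * ?X) = dmd_G \<psi> x w N M"
    unfolding dmd_G_def by (rule assoc_mult_mat[OF Xs weight_mat_carrier(1) dict_mat_carrier, symmetric])
  finally show ?thesis unfolding B_def ..
qed

text \<open>
  A Gram matrix \<open>B\<^sup>* B\<close> is positive definite as soon as it is invertible, and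
  \<open>G * K\<close> is the Hermitian part of \<open>A\<close>.
\<close>

lemma hermitian_dmd_selfadjoint:
  assumes w: "\<And>m. m < M \<Longrightarrow> 0 \<le> w m" and det: "det (dmd_G \<psi> x w N M) \<noteq> 0"
  shows "G_selfadjoint N (dmd_G \<psi> x w N M) (hermitian_dmd \<psi> F x w N M)"
    and "coeff_vec \<psi> x w g N M \<in> carrier_vec N"
    and "\<exists>I\<in>carrier_mat N N. dmd_G \<psi> x w N M * I = 1\<^sub>m N \<and> 
      hermitian_dmd \<psi> F x w N M = I * ((1 / 2) \<cdot>\<^sub>m (dmd_A \<psi> F x w N M + mat_adjoint (dmd_A \<psi> F x w N M)))"
proof -
  define H where "H = (1 / 2) \<cdot>\<^sub>m (dmd_A \<psi> F x w N M + mat_adjoint (dmd_A \<psi> F x w N M))"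
  let ?G = "dmd_G \<psi> x w N M" and ?K = "hermitian_dmd \<psi> F x w N M"
  define B where "B = sqrt_weight_mat w M * dict_mat \<psi> x M N"
  have B: "B \<in> carrier_mat M N"
    unfolding B_def by (rule mult_carrier_mat[OF weight_mat_carrier(2) dict_mat_carrier])
  have G: "?G = mat_adjoint B * B" unfolding B_def using w by (rule dmd_G_eq_gram)
  obtain I where I: "mat_inverse ?G = Some I" "I \<in> carrier_mat N N" "?G * I = 1\<^sub>m N"
    using mat_inverse_exists[OF dmd_carrier(1) det] by blast
  have H: "H \<in> carrier_mat N N" unfolding H_def by (intro smult_carrier_mat add_carrier_mat mat_adjoint_carrier dmd_carrier)
  have K: "?K = I * H" by (simp add: hermitian_dmd_def I(1) H_def)
  show "\<exists>I\<in>carrier_mat N N. ?G * I = 1\<^sub>m N \<and> ?K = I * ((1 / 2) \<cdot>\<^sub>m (dmd_A \<psi> F x w N M + mat_adjoint (dmd_A \<psi> F x w N M)))"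
    using I K unfolding H_def by blast
  have GK: "?G * ?K = H"
    unfolding K assoc_mult_mat[OF dmd_carrier(1) I(2) H, symmetric] I(3) using H by simp
  show "G_selfadjoint N ?G ?K"
  proof
    show "?K \<in> carrier_mat N N" unfolding K using I(2) H by (rule mult_carrier_mat)
    show "mat_adjoint ?G = ?G" unfolding G by (rule gram_hermitian[OF B])
    show "\<And>h. h \<in> carrier_vec N \<Longrightarrow> h \<noteq> 0\<^sub>v N \<Longrightarrow> 0 < Re (G_inner ?G h h)"
      using det unfolding G by (rule gram_positive[OF B])
    show "mat_adjoint (?G * ?K) = ?G * ?K"
      unfolding GK H_def by (rule mat_adjoint_hermitian_part[OF dmd_carrier(2)])
  qed simp
  have "pinv B \<in> carrier_mat N M" using B det unfolding G by (rule pinv_carrier)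
  then show "coeff_vec \<psi> x w g N M \<in> carrier_vec N"
    unfolding coeff_vec_def B_def[symmetric]
    by (rule mult_mat_vec_carrier) (rule mult_mat_vec_carrier[OF weight_mat_carrier(2)], simp)
qed

text \<open>
  The limit of the matrices \<open>A\<close> is Hermitian, so it agrees with the limit of their Hermitian parts. The
  limit of the matrices \<open>G\<close> is positive definite, so they are eventually invertible and
  their inverses converge.
\<close>

theorem hermitian_dmd_spectral_measure_tendsto:
  fixes f :: "real \<Rightarrow> 'b::{banach, second_countable_topology}"
  assumes w: "\<And>M m. m < M \<Longrightarrow> 0 \<le> w M m"
    and sa: "G_selfadjoint N G K" and v: "v \<in> carrier_vec N"
    and limG: "\<And>j k. j < N \<Longrightarrow> k < N \<Longrightarrow> (\<lambda>M. dmd_G \<psi> (x M) (w M) N M $$ (j, k)) \<longlonglongrightarrow> G $$ (j, k)"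
    and limA: "\<And>j k. j < N \<Longrightarrow> k < N \<Longrightarrow> (\<lambda>M. dmd_A \<psi> F (x M) (w M) N M $$ (j, k)) \<longlonglongrightarrow> (G * K) $$ (j, k)"
    and limv: "\<And>j. j < N \<Longrightarrow> (\<lambda>M. coeff_vec \<psi> (x M) (w M) g N M $ j) \<longlonglongrightarrow> v $ j"
    and f: "continuous_on UNIV f" "bounded (range f)"
  shows "(\<lambda>M. LINT l|matrix_spectral_measure (dmd_G \<psi> (x M) (w M) N M)
        (hermitian_dmd \<psi> F (x M) (w M) N M) (coeff_vec \<psi> (x M) (w M) g N M). f l)
    \<longlonglongrightarrow> (LINT l|matrix_spectral_measure G K v. f l)"
proof -
  interpret G_selfadjoint N G K by (rule sa)
  let ?G = "\<lambda>M. dmd_G \<psi> (x M) (w M) N M" and ?K = "\<lambda>M. hermitian_dmd \<psi> F (x M) (w M) N M"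
  let ?A = "\<lambda>M. dmd_A \<psi> F (x M) (w M) N M"
  let ?H = "\<lambda>M. (1 / 2) \<cdot>\<^sub>m (?A M + mat_adjoint (?A M))"
  have GK: "G * K \<in> carrier_mat N N" using G K by (rule mult_carrier_mat)
  have det: "det G \<noteq> 0" using G G_positive by (rule positive_definite_det)
  have "(\<lambda>M. det (?G M)) \<longlonglongrightarrow> det G"
    by (rule tendsto_det[OF _ G limG]) auto
  then have lim_det: "(\<lambda>M. det (?G M)) \<longlonglongrightarrow> det G" and ev: "\<forall>\<^sub>F M in sequentially. det (?G M) \<noteq> 0"
    using det by (auto intro: tendsto_imp_eventually_ne)
  obtain I where I: "I \<in> carrier_mat N N" "G * I = 1\<^sub>m N" "I * G = 1\<^sub>m N"
    using mat_inverse_exists[OF G det] by blast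
  have dimA: "dim_row (?A M) = N" "dim_col (?A M) = N" for M using carrier_matD[OF dmd_carrier(2)] by blast+
  have limK: "(\<lambda>M. ?K M $$ (i, j)) \<longlonglongrightarrow> K $$ (i, j)" if ij: "i < N" "j < N" for i j
  proof -
    have limH: "(\<lambda>M. ?H M $$ (k, j)) \<longlonglongrightarrow> (G * K) $$ (k, j)" if k: "k < N" for k
    proof -
      have "(\<lambda>M. 1 / 2 * (?A M $$ (k, j) + cnj (?A M $$ (j, k))))
        \<longlonglongrightarrow> 1 / 2 * ((G * K) $$ (k, j) + cnj ((G * K) $$ (j, k)))"
        by (intro tendsto_intros limA k ij)
      also have "(\<lambda>M. 1 / 2 * (?A M $$ (k, j) + cnj (?A M $$ (j, k)))) = (\<lambda>M. ?H M $$ (k, j))"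
        using k ij dimA by (auto simp: fun_eq_iff)
      also have "cnj ((G * K) $$ (j, k)) = (G * K) $$ (k, j)"
      proof -
        have "mat_adjoint (G * K) $$ (k, j) = cnj ((G * K) $$ (j, k))"
          using G K k ij by (intro mat_adjoint_index) auto
        then show ?thesis unfolding GK_hermitian ..
      qed
      finally show ?thesis by simp
    qed
    have "(\<lambda>M. \<Sum>k<N. adj_mat (?G M) $$ (i, k) / det (?G M) * ?H M $$ (k, j))
      \<longlonglongrightarrow> (\<Sum>k<N. adj_mat G $$ (i, k) / det G * (G * K) $$ (k, j))"
      by (intro tendsto_intros tendsto_adj_mat[where n = N] G limG lim_det limH det ij always_eventually allI dmd_carrier) auto
    also have "(\<Sum>k<N. adj_mat G $$ (i, k) / det G * (G * K) $$ (k, j)) = (I * (G * K)) $$ (i, j)"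
      unfolding mult_mat_index[OF I(1) GK ij] using ij
      by (intro sum.cong refl) (simp add: inverse_mat_index(2)[OF G I(1,2)] del: index_mult_mat(1))
    also have "I * (G * K) = K"
      unfolding assoc_mult_mat[OF I(1) G K, symmetric] I(3) using K by simp
    finally have lim: "(\<lambda>M. \<Sum>k<N. adj_mat (?G M) $$ (i, k) / det (?G M) * ?H M $$ (k, j)) \<longlonglongrightarrow> K $$ (i, j)" .
    have "\<forall>\<^sub>F M in sequentially.
        (\<Sum>k<N. adj_mat (?G M) $$ (i, k) / det (?G M) * ?H M $$ (k, j)) = ?K M $$ (i, j)"
      using ev
    proof eventually_elim
      case (elim M)
      obtain J where J: "J \<in> carrier_mat N N" "?G M * J = 1\<^sub>m N" "?K M = J * ?H M"
        using hermitian_dmd_selfadjoint(3)[of M "w M" \<psi> "x M" N F] w elim by blast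
      have H: "?H M \<in> carrier_mat N N" by (intro smult_carrier_mat add_carrier_mat mat_adjoint_carrier dmd_carrier)
      show ?case
        unfolding J(3) mult_mat_index[OF J(1) H ij] using ij
        by (intro sum.cong refl) (simp add: inverse_mat_index(2)[OF dmd_carrier(1) J(1,2)])
    qed
    with lim show ?thesis by (rule Lim_transform_eventually)
  qed
  show ?thesis
  proof (rule matrix_spectral_measure_tendsto[OF sa v _ limG limK limv f])
    show "\<forall>\<^sub>F M in sequentially. G_selfadjoint N (?G M) (?K M) \<and> coeff_vec \<psi> (x M) (w M) g N M \<in> carrier_vec N"
      using ev by eventually_elim (use hermitian_dmd_selfadjoint(1,2) w in blast)
  qed
qed

section \<open>Square-integrable functions\<close>

lemma L2_measurable [measurable_dest]: "g \<in> L2 \<omega> \<Longrightarrow> g \<in> borel_measurable \<omega>"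
  by (simp add: L2_def)

lemma L2_integrable_square: "g \<in> L2 \<omega> \<Longrightarrow> integrable \<omega> (\<lambda>x. (cmod (g x))\<^sup>2)"
  by (simp add: L2_def)

lemma L2_lincomb:
  assumes g: "g \<in> L2 \<omega>" and h: "h \<in> L2 \<omega>"
  shows "(\<lambda>x. a * g x + b * h x) \<in> L2 \<omega>"
proof -
  note [measurable] = L2_measurable[OF g] L2_measurable[OF h]
  have "integrable \<omega> (\<lambda>x. 2 * (cmod a)\<^sup>2 * (cmod (g x))\<^sup>2 + 2 * (cmod b)\<^sup>2 * (cmod (h x))\<^sup>2)"
    using L2_integrable_square[OF g] L2_integrable_square[OF h] by simp
  then have "integrable \<omega> (\<lambda>x. (cmod (a * g x + b * h x))\<^sup>2)"
  proof (rule Bochner_Integration.integrable_bound)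
    have "(cmod (a * g x + b * h x))\<^sup>2 \<le> 2 * (cmod a)\<^sup>2 * (cmod (g x))\<^sup>2 + 2 * (cmod b)\<^sup>2 * (cmod (h x))\<^sup>2" for x
    proof -
      have "(cmod (a * g x + b * h x))\<^sup>2 \<le> (cmod (a * g x) + cmod (b * h x))\<^sup>2"
        by (intro power_mono norm_triangle_ineq) simp
      also have "\<dots> \<le> 2 * (cmod (a * g x))\<^sup>2 + 2 * (cmod (b * h x))\<^sup>2"
        using sum_squares_bound[of "cmod (a * g x)" "cmod (b * h x)"] by (simp add: power2_sum)
      finally show ?thesis by (simp add: norm_mult power_mult_distrib)
    qed
    then show "AE x in \<omega>. norm ((cmod (a * g x + b * h x))\<^sup>2) \<le>
        norm (2 * (cmod a)\<^sup>2 * (cmod (g x))\<^sup>2 + 2 * (cmod b)\<^sup>2 * (cmod (h x))\<^sup>2)"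
      by (intro AE_I2) (simp add: abs_of_nonneg)
  qed simp
  then show ?thesis by (simp add: L2_def)
qed

lemma L2_zero: "(\<lambda>_. 0) \<in> L2 \<omega>"
  by (simp add: L2_def)

lemma L2_add: "g \<in> L2 \<omega> \<Longrightarrow> h \<in> L2 \<omega> \<Longrightarrow> (\<lambda>x. g x + h x) \<in> L2 \<omega>"
  using L2_lincomb[of g \<omega> h 1 1] by simp

lemma L2_diff: "g \<in> L2 \<omega> \<Longrightarrow> h \<in> L2 \<omega> \<Longrightarrow> (\<lambda>x. g x - h x) \<in> L2 \<omega>"
  using L2_lincomb[of g \<omega> h 1 "- 1"] by simp

lemma L2_scale: "g \<in> L2 \<omega> \<Longrightarrow> (\<lambda>x. a * g x) \<in> L2 \<omega>"
  using L2_lincomb[of g \<omega> g a 0] by simp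

lemma L2_sum: "(\<And>j. j \<in> J \<Longrightarrow> u j \<in> L2 \<omega>) \<Longrightarrow> (\<lambda>x. \<Sum>j\<in>J. u j x) \<in> L2 \<omega>"
  by (induction J rule: infinite_finite_induct) (auto intro: L2_zero L2_add)

lemma L2_measurable_cnj: "g \<in> L2 \<omega> \<Longrightarrow> (\<lambda>x. cnj (g x)) \<in> borel_measurable \<omega>"
  by (rule borel_measurable_continuous_on[OF continuous_on_cnj[OF continuous_on_id] L2_measurable])

lemma L2_integrable_product:
  assumes g: "g \<in> L2 \<omega>" and h: "h \<in> L2 \<omega>"
  shows "integrable \<omega> (\<lambda>x. g x * cnj (h x))"
proof -
  note [measurable] = L2_measurable[OF g] L2_measurable_cnj[OF h]
  have "integrable \<omega> (\<lambda>x. (cmod (g x))\<^sup>2 + (cmod (h x))\<^sup>2)"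
    using L2_integrable_square[OF g] L2_integrable_square[OF h] by simp
  then show ?thesis
  proof (rule Bochner_Integration.integrable_bound)
    have "cmod (g x * cnj (h x)) \<le> (cmod (g x))\<^sup>2 + (cmod (h x))\<^sup>2" for x
      using sum_squares_bound[of "cmod (g x)" "cmod (h x)"]
        mult_nonneg_nonneg[OF norm_ge_zero[of "g x"] norm_ge_zero[of "h x"]]
      unfolding norm_mult complex_mod_cnj by linarith
    then show "AE x in \<omega>. norm (g x * cnj (h x)) \<le> norm ((cmod (g x))\<^sup>2 + (cmod (h x))\<^sup>2)"
      by (intro AE_I2) (simp add: abs_of_nonneg)
  qed simp
qed

lemma L2_inner_lincomb_left:
  assumes "g \<in> L2 \<omega>" "h \<in> L2 \<omega>" "k \<in> L2 \<omega>"
  shows "L2_inner \<omega> (\<lambda>x. a * g x + b * h x) k = a * L2_inner \<omega> g k + b * L2_inner \<omega> h k"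
proof -
  have "L2_inner \<omega> (\<lambda>x. a * g x + b * h x) k = (LINT x|\<omega>. a * (g x * cnj (k x)) + b * (h x * cnj (k x)))"
    unfolding L2_inner_def by (intro Bochner_Integration.integral_cong refl) (simp add: algebra_simps)
  also have "\<dots> = a * L2_inner \<omega> g k + b * L2_inner \<omega> h k"
    unfolding L2_inner_def using L2_integrable_product[OF assms(1,3)] L2_integrable_product[OF assms(2,3)]
    by simp
  finally show ?thesis .
qed

lemma L2_inner_add_left:
  "g \<in> L2 \<omega> \<Longrightarrow> h \<in> L2 \<omega> \<Longrightarrow> k \<in> L2 \<omega> \<Longrightarrow>
    L2_inner \<omega> (\<lambda>x. g x + h x) k = L2_inner \<omega> g k + L2_inner \<omega> h k"
  using L2_inner_lincomb_left[of g \<omega> h k 1 1] by simp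

lemma L2_inner_diff_left:
  "g \<in> L2 \<omega> \<Longrightarrow> h \<in> L2 \<omega> \<Longrightarrow> k \<in> L2 \<omega> \<Longrightarrow>
    L2_inner \<omega> (\<lambda>x. g x - h x) k = L2_inner \<omega> g k - L2_inner \<omega> h k"
  using L2_inner_lincomb_left[of g \<omega> h k 1 "- 1"] by simp

lemma L2_inner_scale_left: "L2_inner \<omega> (\<lambda>x. a * g x) k = a * L2_inner \<omega> g k"
  by (simp add: L2_inner_def mult.assoc)

lemma L2_inner_zero_left [simp]: "L2_inner \<omega> (\<lambda>_. 0) k = 0"
  by (simp add: L2_inner_def)

lemma L2_inner_sum_left:
  assumes "\<And>j. j \<in> J \<Longrightarrow> u j \<in> L2 \<omega>" "k \<in> L2 \<omega>"
  shows "L2_inner \<omega> (\<lambda>x. \<Sum>j\<in>J. u j x) k = (\<Sum>j\<in>J. L2_inner \<omega> (u j) k)"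
  using assms(1)
proof (induction J rule: infinite_finite_induct)
  case (insert j J)
  then show ?case
    using L2_inner_add_left[of "u j" \<omega> "\<lambda>x. \<Sum>j\<in>J. u j x" k] L2_sum[of J u \<omega>] assms(2) by simp
qed auto

lemma L2_inner_cnj: "L2_inner \<omega> h g = cnj (L2_inner \<omega> g h)"
proof -
  have "(\<lambda>x. h x * cnj (g x)) = (\<lambda>x. cnj (g x * cnj (h x)))" by (simp add: fun_eq_iff mult.commute)
  then show ?thesis unfolding L2_inner_def by (simp only: Bochner_Integration.integral_cnj)
qed

lemma L2_inner_lincomb_right:
  assumes "g \<in> L2 \<omega>" "h \<in> L2 \<omega>" "k \<in> L2 \<omega>"
  shows "L2_inner \<omega> k (\<lambda>x. a * g x + b * h x) = cnj a * L2_inner \<omega> k g + cnj b * L2_inner \<omega> k h"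
  unfolding L2_inner_cnj[of \<omega> k] L2_inner_lincomb_left[OF assms] by simp

lemma L2_inner_self: "L2_inner \<omega> g g = complex_of_real ((L2_norm \<omega> g)\<^sup>2)"
proof -
  have "L2_inner \<omega> g g = (LINT x|\<omega>. complex_of_real ((cmod (g x))\<^sup>2))"
    unfolding L2_inner_def by (simp only: complex_norm_square)
  also have "\<dots> = complex_of_real (LINT x|\<omega>. (cmod (g x))\<^sup>2)"
    by (rule integral_complex_of_real)
  finally show ?thesis unfolding L2_norm_def by simp
qed

lemma L2_norm_nonneg [simp]: "0 \<le> L2_norm \<omega> g"
  by (simp add: L2_norm_def)

lemma L2_norm_eq_sqrt_inner: "L2_norm \<omega> g = sqrt (Re (L2_inner \<omega> g g))"
  by (simp add: L2_inner_self)

lemma L2_cauchy_schwarz: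
  assumes "g \<in> L2 \<omega>" "h \<in> L2 \<omega>"
  shows "cmod (L2_inner \<omega> g h) \<le> L2_norm \<omega> g * L2_norm \<omega> h"
  unfolding L2_norm_eq_sqrt_inner
proof (rule norm_le_from_quadratic)
  fix c :: complex
  let ?s = "\<lambda>x. 1 * g x + c * h x"
  have s: "?s \<in> L2 \<omega>" using assms by (rule L2_lincomb)
  have "L2_inner \<omega> ?s ?s = L2_inner \<omega> g g + cnj c * L2_inner \<omega> g h + c * cnj (L2_inner \<omega> g h)
      + c * cnj c * L2_inner \<omega> h h"
    unfolding L2_inner_lincomb_left[OF assms s] L2_inner_lincomb_right[OF assms assms(1)]
      L2_inner_lincomb_right[OF assms assms(2)] L2_inner_cnj[of \<omega> h g] by (simp add: algebra_simps)
  then have "Re (L2_inner \<omega> ?s ?s) = Re (L2_inner \<omega> g g) + 2 * Re (cnj c * L2_inner \<omega> g h)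
      + (cmod c)\<^sup>2 * Re (L2_inner \<omega> h h)"
    using Re_quadratic[of "L2_inner \<omega> h h"] by (simp add: L2_inner_self)
  moreover have "0 \<le> Re (L2_inner \<omega> ?s ?s)" by (simp only: L2_inner_self Re_complex_of_real) simp
  ultimately show "0 \<le> Re (L2_inner \<omega> g g) + 2 * Re (cnj c * L2_inner \<omega> g h) + (cmod c)\<^sup>2 * Re (L2_inner \<omega> h h)"
    by simp
qed (simp add: L2_inner_self)

lemma L2_norm_triangle:
  assumes "g \<in> L2 \<omega>" "h \<in> L2 \<omega>"
  shows "L2_norm \<omega> (\<lambda>x. g x + h x) \<le> L2_norm \<omega> g + L2_norm \<omega> h"
proof (rule power2_le_imp_le)
  have s: "(\<lambda>x. g x + h x) \<in> L2 \<omega>" using assms by (rule L2_add)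
  have "L2_inner \<omega> (\<lambda>x. g x + h x) (\<lambda>x. g x + h x)
    = L2_inner \<omega> g g + L2_inner \<omega> g h + cnj (L2_inner \<omega> g h) + L2_inner \<omega> h h"
    using L2_inner_lincomb_right[OF assms assms(1), of 1 1] L2_inner_lincomb_right[OF assms assms(2), of 1 1]
      L2_inner_cnj[of \<omega> h g] by (simp add: L2_inner_add_left[OF assms s])
  then have "(L2_norm \<omega> (\<lambda>x. g x + h x))\<^sup>2 = (L2_norm \<omega> g)\<^sup>2 + 2 * Re (L2_inner \<omega> g h) + (L2_norm \<omega> h)\<^sup>2"
    unfolding L2_inner_self by (simp add: complex_eq_iff)
  also have "Re (L2_inner \<omega> g h) \<le> L2_norm \<omega> g * L2_norm \<omega> h"
    using L2_cauchy_schwarz[OF assms] complex_Re_le_cmod order_trans by blast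
  finally show "(L2_norm \<omega> (\<lambda>x. g x + h x))\<^sup>2 \<le> (L2_norm \<omega> g + L2_norm \<omega> h)\<^sup>2"
    by (simp add: power2_sum)
qed simp

lemma L2_norm_scale: "L2_norm \<omega> (\<lambda>x. a * g x) = cmod a * L2_norm \<omega> g"
  by (simp add: L2_norm_def norm_mult power_mult_distrib real_sqrt_mult)

lemma L2_norm_diff_commute: "L2_norm \<omega> (\<lambda>x. g x - h x) = L2_norm \<omega> (\<lambda>x. h x - g x)"
  by (simp add: L2_norm_def norm_minus_commute)

lemma L2_inner_cong_AE:
  assumes "g \<in> L2 \<omega>" "g' \<in> L2 \<omega>" "h \<in> L2 \<omega>" "h' \<in> L2 \<omega>"
    and "AE x in \<omega>. g x = g' x" "AE x in \<omega>. h x = h' x"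
  shows "L2_inner \<omega> g h = L2_inner \<omega> g' h'"
proof -
  note [measurable] = assms(1-2)[THEN L2_measurable] assms(3-4)[THEN L2_measurable_cnj]
  show ?thesis unfolding L2_inner_def by (rule integral_cong_AE) (use assms(5,6) in auto)
qed

lemma L2_norm_cong_AE:
  assumes "g \<in> L2 \<omega>" "h \<in> L2 \<omega>" "AE x in \<omega>. g x = h x"
  shows "L2_norm \<omega> g = L2_norm \<omega> h"
  unfolding L2_norm_eq_sqrt_inner L2_inner_cong_AE[OF assms(1,2,1,2,3,3)] ..

lemma L2_norm_eq_0_iff:
  assumes "g \<in> L2 \<omega>"
  shows "L2_norm \<omega> g = 0 \<longleftrightarrow> (AE x in \<omega>. g x = 0)"
  using integral_nonneg_eq_0_iff_AE[OF L2_integrable_square[OF assms]] by (simp add: L2_norm_def)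

lemma L2_tendsto_inner:
  assumes u: "L2_tendsto \<omega> u v" "\<And>n. u n \<in> L2 \<omega>" "v \<in> L2 \<omega>"
    and w: "L2_tendsto \<omega> w k" "\<And>n. w n \<in> L2 \<omega>" "k \<in> L2 \<omega>"
  shows "(\<lambda>n. L2_inner \<omega> (u n) (w n)) \<longlonglongrightarrow> L2_inner \<omega> v k"
proof -
  let ?d = "\<lambda>n x. u n x - v x" and ?e = "\<lambda>n x. w n x - k x"
  have bound: "cmod (L2_inner \<omega> (u n) (w n) - L2_inner \<omega> v k)
    \<le> L2_norm \<omega> (?d n) * (L2_norm \<omega> (?e n) + L2_norm \<omega> k) + L2_norm \<omega> v * L2_norm \<omega> (?e n)" for n
  proof -
    have d: "?d n \<in> L2 \<omega>" and e: "?e n \<in> L2 \<omega>" using u w by (auto intro: L2_diff)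
    have "L2_inner \<omega> (u n) (w n) - L2_inner \<omega> v (w n) = L2_inner \<omega> (?d n) (w n)"
      using u w by (simp add: L2_inner_diff_left)
    moreover have "L2_inner \<omega> v (w n) - L2_inner \<omega> v k = L2_inner \<omega> v (?e n)"
      using L2_inner_lincomb_right[OF w(2)[of n] w(3) u(3), of 1 "- 1"] by simp
    ultimately have "L2_inner \<omega> (u n) (w n) - L2_inner \<omega> v k = L2_inner \<omega> (?d n) (w n) + L2_inner \<omega> v (?e n)"
      by (simp add: algebra_simps)
    then have "cmod (L2_inner \<omega> (u n) (w n) - L2_inner \<omega> v k)
        \<le> L2_norm \<omega> (?d n) * L2_norm \<omega> (w n) + L2_norm \<omega> v * L2_norm \<omega> (?e n)"
      using norm_triangle_ineq[of "L2_inner \<omega> (?d n) (w n)" "L2_inner \<omega> v (?e n)"]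
        L2_cauchy_schwarz[OF d w(2)[of n]] L2_cauchy_schwarz[OF u(3) e] by simp
    also have "L2_norm \<omega> (w n) \<le> L2_norm \<omega> (?e n) + L2_norm \<omega> k"
      using L2_norm_triangle[OF e w(3)] by simp
    finally show ?thesis by (simp add: mult_left_mono)
  qed
  have "(\<lambda>n. L2_norm \<omega> (?d n) * (L2_norm \<omega> (?e n) + L2_norm \<omega> k) + L2_norm \<omega> v * L2_norm \<omega> (?e n))
      \<longlonglongrightarrow> 0 * (0 + L2_norm \<omega> k) + L2_norm \<omega> v * 0"
    using u(1) w(1) unfolding L2_tendsto_def by (intro tendsto_intros)
  then have lim: "(\<lambda>n. L2_norm \<omega> (?d n) * (L2_norm \<omega> (?e n) + L2_norm \<omega> k) + L2_norm \<omega> v * L2_norm \<omega> (?e n))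
      \<longlonglongrightarrow> 0" by simp
  have "(\<lambda>n. L2_inner \<omega> (u n) (w n) - L2_inner \<omega> v k) \<longlonglongrightarrow> 0"
    by (rule Lim_null_comparison[OF always_eventually[OF allI[OF bound]] lim])
  then show ?thesis by (simp add: LIM_zero_iff)
qed

lemma L2_tendsto_norm:
  assumes "L2_tendsto \<omega> u v" "\<And>n. u n \<in> L2 \<omega>" "v \<in> L2 \<omega>"
  shows "(\<lambda>n. L2_norm \<omega> (u n)) \<longlonglongrightarrow> L2_norm \<omega> v"
  unfolding L2_norm_eq_sqrt_inner
  by (intro tendsto_real_sqrt tendsto_Re L2_tendsto_inner assms)

lemma L2_tendsto_lincomb:
  assumes u: "L2_tendsto \<omega> u v" "\<And>n. u n \<in> L2 \<omega>" "v \<in> L2 \<omega>"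
    and w: "L2_tendsto \<omega> w k" "\<And>n. w n \<in> L2 \<omega>" "k \<in> L2 \<omega>"
  shows "L2_tendsto \<omega> (\<lambda>n x. a * u n x + b * w n x) (\<lambda>x. a * v x + b * k x)"
  unfolding L2_tendsto_def
proof (rule Lim_null_comparison[OF always_eventually[OF allI]])
  fix n
  have "L2_norm \<omega> (\<lambda>x. a * u n x + b * w n x - (a * v x + b * k x))
    = L2_norm \<omega> (\<lambda>x. a * (u n x - v x) + b * (w n x - k x))" by (simp add: algebra_simps)
  also have "\<dots> \<le> cmod a * L2_norm \<omega> (\<lambda>x. u n x - v x) + cmod b * L2_norm \<omega> (\<lambda>x. w n x - k x)"
    using L2_norm_triangle[of "\<lambda>x. a * (u n x - v x)" \<omega> "\<lambda>x. b * (w n x - k x)"] u w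
    by (simp add: L2_norm_scale L2_scale L2_diff)
  finally show "norm (L2_norm \<omega> (\<lambda>x. a * u n x + b * w n x - (a * v x + b * k x)))
    \<le> cmod a * L2_norm \<omega> (\<lambda>x. u n x - v x) + cmod b * L2_norm \<omega> (\<lambda>x. w n x - k x)" by simp
next
  have "(\<lambda>n. cmod a * L2_norm \<omega> (\<lambda>x. u n x - v x) + cmod b * L2_norm \<omega> (\<lambda>x. w n x - k x))
    \<longlonglongrightarrow> cmod a * 0 + cmod b * 0"
    using u(1) w(1) unfolding L2_tendsto_def by (intro tendsto_intros)
  then show "(\<lambda>n. cmod a * L2_norm \<omega> (\<lambda>x. u n x - v x) + cmod b * L2_norm \<omega> (\<lambda>x. w n x - k x)) \<longlonglongrightarrow> 0"
    by simp
qed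

lemma L2_tendsto_sum:
  assumes "\<And>j. j \<in> J \<Longrightarrow> L2_tendsto \<omega> (u j) (v j)" "\<And>j n. j \<in> J \<Longrightarrow> u j n \<in> L2 \<omega>" "\<And>j. j \<in> J \<Longrightarrow> v j \<in> L2 \<omega>"
  shows "L2_tendsto \<omega> (\<lambda>n x. \<Sum>j\<in>J. u j n x) (\<lambda>x. \<Sum>j\<in>J. v j x)"
  using assms
proof (induction J rule: infinite_finite_induct)
  case (insert j J)
  have IH: "L2_tendsto \<omega> (\<lambda>n x. \<Sum>j\<in>J. u j n x) (\<lambda>x. \<Sum>j\<in>J. v j x)"
    by (rule insert.IH) (use insert.prems in blast)+
  have sums: "(\<lambda>x. \<Sum>j\<in>J. u j n x) \<in> L2 \<omega>" "(\<lambda>x. \<Sum>j\<in>J. v j x) \<in> L2 \<omega>" for n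
    by (rule L2_sum; use insert.prems in blast)+
  from insert.prems have j: "L2_tendsto \<omega> (u j) (v j)" "\<And>n. u j n \<in> L2 \<omega>" "v j \<in> L2 \<omega>" by blast+
  show ?case using L2_tendsto_lincomb[OF j IH sums, of 1 1] insert.hyps by simp
qed (auto simp: L2_tendsto_def L2_norm_def)

section \<open>Self-adjoint operators and their spectral measures\<close>

locale selfadjoint_operator =
  fixes \<omega> :: "'a measure" and D :: "('a \<Rightarrow> complex) set" and T :: "('a \<Rightarrow> complex) \<Rightarrow> 'a \<Rightarrow> complex"
  assumes selfadjoint: "L2_selfadjoint \<omega> D T"
begin

lemma operator: "L2_operator \<omega> D T"
  using selfadjoint by (simp add: L2_selfadjoint_def)

lemma D_L2: "g \<in> D \<Longrightarrow> g \<in> L2 \<omega>"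
  using operator by (auto simp: L2_operator_def)

lemma T_L2: "g \<in> D \<Longrightarrow> T g \<in> L2 \<omega>"
  using operator by (auto simp: L2_operator_def)

lemma D_lincomb: "g \<in> D \<Longrightarrow> h \<in> D \<Longrightarrow> (\<lambda>x. a * g x + b * h x) \<in> D"
  using operator by (auto simp: L2_operator_def)

lemma D_zero: "(\<lambda>_. 0) \<in> D"
  using operator by (simp add: L2_operator_def)

lemma D_sum: "(\<And>j. j \<in> J \<Longrightarrow> u j \<in> D) \<Longrightarrow> (\<lambda>x. \<Sum>j\<in>J. u j x) \<in> D"
proof (induction J rule: infinite_finite_induct)
  case (insert j J)
  then show ?case using D_lincomb[of "u j" "\<lambda>x. \<Sum>j\<in>J. u j x" 1 1] by simp
qed (auto intro: D_zero)

lemma T_lincomb: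
  "g \<in> D \<Longrightarrow> h \<in> D \<Longrightarrow> AE x in \<omega>. T (\<lambda>x. a * g x + b * h x) x = a * T g x + b * T h x"
  using operator by (auto simp: L2_operator_def)

lemma symmetric:
  assumes "g \<in> D" "h \<in> D"
  shows "L2_inner \<omega> (T g) h = L2_inner \<omega> g (T h)"
proof -
  have "(h, T h) \<in> L2_adjoint_graph \<omega> D T"
    using selfadjoint assms(2) T_L2 by (simp add: L2_selfadjoint_def)
  then show ?thesis using assms(1) by (simp add: L2_adjoint_graph_def)
qed

lemma dense:
  assumes "g \<in> L2 \<omega>"
  obtains w where "\<And>n. w n \<in> D" "L2_tendsto \<omega> w g"
proof -
  have "\<exists>h\<in>D. L2_norm \<omega> (\<lambda>x. g x - h x) < 1 / real (Suc n)" for n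
    using selfadjoint assms by (simp add: L2_selfadjoint_def L2_dense_def)
  then obtain w where w: "\<And>n. w n \<in> D" "\<And>n. L2_norm \<omega> (\<lambda>x. g x - w n x) < 1 / real (Suc n)"
    by metis
  have "L2_tendsto \<omega> w g"
    unfolding L2_tendsto_def
  proof (rule Lim_null_comparison[OF always_eventually[OF allI]])
    show "norm (L2_norm \<omega> (\<lambda>x. w n x - g x)) \<le> 1 / real (Suc n)" for n
      using w(2)[of n] L2_norm_diff_commute[of \<omega> g "w n"] by simp
    show "(\<lambda>n. 1 / real (Suc n)) \<longlonglongrightarrow> 0"
      using LIMSEQ_inverse_real_of_nat by (simp add: inverse_eq_divide)
  qed
  with w(1) show ?thesis by (rule that)
qed

end

locale spectral_operator = selfadjoint_operator \<omega> D T
  for \<omega> :: "'a measure" and D T +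
  fixes E :: "real set \<Rightarrow> ('a \<Rightarrow> complex) \<Rightarrow> 'a \<Rightarrow> complex"
  assumes spectral: "spectral_measure_of \<omega> D T E"
begin

abbreviation "\<mu> \<equiv> scalar_spectral_measure \<omega> E"

lemma pvm: "projection_valued_measure \<omega> E"
  using spectral by (simp add: spectral_measure_of_def)

lemma E_projection: "B \<in> sets borel \<Longrightarrow> L2_orthogonal_projection \<omega> (E B)"
  using pvm by (simp add: projection_valued_measure_def)

lemma E_L2: "B \<in> sets borel \<Longrightarrow> g \<in> L2 \<omega> \<Longrightarrow> E B g \<in> L2 \<omega>"
  using E_projection[of B] by (auto simp: L2_orthogonal_projection_def L2_operator_def)

lemma E_symmetric: "B \<in> sets borel \<Longrightarrow> g \<in> L2 \<omega> \<Longrightarrow> h \<in> L2 \<omega> \<Longrightarrow>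
    L2_inner \<omega> (E B g) h = L2_inner \<omega> g (E B h)"
  using E_projection[of B] by (simp add: L2_orthogonal_projection_def)

lemma E_lincomb: "B \<in> sets borel \<Longrightarrow> g \<in> L2 \<omega> \<Longrightarrow> h \<in> L2 \<omega> \<Longrightarrow>
    AE x in \<omega>. E B (\<lambda>x. a * g x + b * h x) x = a * E B g x + b * E B h x"
  using E_projection[of B] by (simp add: L2_orthogonal_projection_def L2_operator_def)

lemma E_Int: "B \<in> sets borel \<Longrightarrow> C \<in> sets borel \<Longrightarrow> g \<in> L2 \<omega> \<Longrightarrow>
    AE x in \<omega>. E (B \<inter> C) g x = E B (E C g) x"
  using pvm by (simp add: projection_valued_measure_def)

lemma E_empty: "g \<in> L2 \<omega> \<Longrightarrow> AE x in \<omega>. E {} g x = 0"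
  using pvm by (simp add: projection_valued_measure_def)

lemma E_UNIV: "g \<in> L2 \<omega> \<Longrightarrow> AE x in \<omega>. E UNIV g x = g x"
  using pvm by (simp add: projection_valued_measure_def)

text \<open>
  The projections are symmetric and multiplicative; in particular the ranges of
  \<open>E B\<close> and \<open>E C\<close> are orthogonal for disjoint \<open>B\<close> and \<open>C\<close>.
\<close>

lemma E_inner_E:
  assumes B: "B \<in> sets borel" and C: "C \<in> sets borel" and g: "g \<in> L2 \<omega>" and h: "h \<in> L2 \<omega>"
  shows "L2_inner \<omega> (E B g) (E C h) = L2_inner \<omega> (E (C \<inter> B) g) h"
proof -
  have "L2_inner \<omega> (E B g) (E C h) = L2_inner \<omega> (E C (E B g)) h"
    using assms by (simp add: E_symmetric E_L2)
  also have "\<dots> = L2_inner \<omega> (E (C \<inter> B) g) h"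
  proof (rule L2_inner_cong_AE)
    show "AE x in \<omega>. E C (E B g) x = E (C \<inter> B) g x"
      using E_Int[OF C B g] by eventually_elim simp
  qed (use assms in \<open>auto intro: E_L2\<close>)
  finally show ?thesis .
qed

lemma E_norm: "B \<in> sets borel \<Longrightarrow> g \<in> L2 \<omega> \<Longrightarrow> Re (L2_inner \<omega> (E B g) g) = (L2_norm \<omega> (E B g))\<^sup>2"
  using E_inner_E[of B B g g] by (metis Int_absorb L2_inner_self Re_complex_of_real)

lemma \<mu>_sets [simp]: "sets (\<mu> g) = sets borel"
  using sets.sigma_sets_eq[of "borel :: real measure"] by (simp add: scalar_spectral_measure_def)

lemma \<mu>_space [simp]: "space (\<mu> g) = UNIV"
  by (simp add: scalar_spectral_measure_def)

text \<open>
  The set function defining the scalar spectral measure is \<open>B \<mapsto> \<parallel>E B g\<parallel>\<^sup>2\<close>. It is countably additive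
  because the defining series converges in \<open>L\<^sup>2\<close> and the inner product is continuous.
\<close>

lemma emeasure_\<mu>:
  assumes g: "g \<in> L2 \<omega>" and B: "B \<in> sets borel"
  shows "emeasure (\<mu> g) B = ennreal ((L2_norm \<omega> (E B g))\<^sup>2)"
proof -
  let ?f = "\<lambda>B. ennreal (Re (L2_inner \<omega> (E B g) g))"
  have "emeasure (\<mu> g) B = ?f B"
    unfolding scalar_spectral_measure_def
  proof (rule emeasure_measure_of_sigma)
    show "sigma_algebra UNIV (sets borel :: real set set)"
      using sets.sigma_algebra_axioms[of "borel :: real measure"] by simp
    show "positive (sets borel) ?f"
      using E_norm[OF _ g, of "{}"] L2_norm_eq_0_iff[OF E_L2[OF _ g], of "{}"] E_empty[OF g]
      by (simp add: positive_def)
    show "countably_additive (sets borel) ?f"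
    proof (rule countably_additiveI)
      fix A :: "nat \<Rightarrow> real set"
      assume A: "range A \<subseteq> sets borel" "disjoint_family A" "(\<Union>i. A i) \<in> sets borel"
      have Ai: "A i \<in> sets borel" for i using A(1) by auto
      have lim: "L2_tendsto \<omega> (\<lambda>n x. \<Sum>i<n. E (A i) g x) (E (\<Union>i. A i) g)"
        using pvm A g unfolding projection_valued_measure_def by blast
      have const: "L2_tendsto \<omega> (\<lambda>_. g) g" by (simp add: L2_tendsto_def L2_norm_def)
      have "(\<lambda>n. L2_inner \<omega> (\<lambda>x. \<Sum>i<n. E (A i) g x) g) \<longlonglongrightarrow> L2_inner \<omega> (E (\<Union>i. A i) g) g"
        by (rule L2_tendsto_inner[OF lim _ _ const]) (use Ai A g in \<open>auto intro!: L2_sum E_L2\<close>)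
      then have "(\<lambda>n. Re (L2_inner \<omega> (\<lambda>x. \<Sum>i<n. E (A i) g x) g)) \<longlonglongrightarrow> Re (L2_inner \<omega> (E (\<Union>i. A i) g) g)"
        by (rule tendsto_Re)
      then have sums: "(\<lambda>i. Re (L2_inner \<omega> (E (A i) g) g)) sums Re (L2_inner \<omega> (E (\<Union>i. A i) g) g)"
        using Ai g by (simp add: sums_def L2_inner_sum_left E_L2)
      have "(\<Sum>i. ?f (A i)) = ennreal (\<Sum>i. Re (L2_inner \<omega> (E (A i) g) g))"
        using sums_summable[OF sums] Ai g by (intro suminf_ennreal2) (auto simp: E_norm)
      also have "\<dots> = ?f (\<Union>i. A i)" using sums_unique[OF sums] by simp
      finally show "(\<Sum>i. ?f (A i)) = ?f (\<Union>i. A i)" .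
    qed
  qed (rule B)
  then show ?thesis using E_norm[OF B g] by simp
qed

lemma finite_\<mu>: "g \<in> L2 \<omega> \<Longrightarrow> finite_measure (\<mu> g)"
  by (intro finite_measureI) (simp add: emeasure_\<mu>)

lemma measure_\<mu>: "g \<in> L2 \<omega> \<Longrightarrow> B \<in> sets borel \<Longrightarrow> measure (\<mu> g) B = (L2_norm \<omega> (E B g))\<^sup>2"
  by (simp add: measure_def emeasure_\<mu>)

lemma measure_\<mu>_UNIV: "g \<in> L2 \<omega> \<Longrightarrow> measure (\<mu> g) UNIV = (L2_norm \<omega> g)\<^sup>2"
  using L2_norm_cong_AE[OF E_L2[of UNIV g] _ E_UNIV] by (simp add: measure_\<mu>)

lemma measure_\<mu>_E:
  assumes "g \<in> L2 \<omega>" "B \<in> sets borel" "C \<in> sets borel"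
  shows "measure (\<mu> (E C g)) B = measure (\<mu> g) (B \<inter> C)"
  using L2_norm_cong_AE[OF _ _ E_Int[OF assms(2,3,1)]] assms by (simp add: measure_\<mu> E_L2)

lemma D_eq: "D = {g \<in> L2 \<omega>. integrable (\<mu> g) (\<lambda>l. l\<^sup>2)}"
  using spectral by (simp add: spectral_measure_of_def)

lemma quadratic_form: "g \<in> D \<Longrightarrow> L2_inner \<omega> (T g) g = complex_of_real (LINT l|\<mu> g. l)"
  using spectral by (simp add: spectral_measure_of_def)

lemma integrable_id: assumes "g \<in> D" shows "integrable (\<mu> g) (\<lambda>l. l)"
proof -
  interpret finite_measure "\<mu> g" using assms by (intro finite_\<mu> D_L2)
  have "integrable (\<mu> g) (\<lambda>l. 1 + l\<^sup>2)" using assms by (simp add: D_eq)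
  then show ?thesis
  proof (rule Bochner_Integration.integrable_bound)
    have "\<bar>l\<bar> \<le> 1 + l\<^sup>2" for l :: real
      using sum_squares_bound[of 1 "\<bar>l\<bar>"] by (simp add: power2_eq_square)
    then show "AE l in \<mu> g. norm l \<le> norm (1 + l\<^sup>2)" by (intro AE_I2) (simp add: abs_of_nonneg)
  qed (simp cong: measurable_cong_sets)
qed

lemma E_bounded_in_D:
  assumes g: "g \<in> L2 \<omega>" and I: "I \<in> sets borel" "I \<subseteq> {a - \<delta>..a + \<delta>}"
  shows "E I g \<in> D"
proof -
  have u: "E I g \<in> L2 \<omega>" using g I by (intro E_L2)
  interpret finite_measure "\<mu> (E I g)" using u by (rule finite_\<mu>)
  have "measure (\<mu> (E I g)) (- I) = 0"
    using measure_\<mu>_E[OF g, of "- I" I] I by simp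
  then have "AE l in \<mu> (E I g). l \<in> I"
    using I by (intro AE_I[of _ _ "- I"]) (auto simp: emeasure_eq_measure)
  then have "AE l in \<mu> (E I g). norm (l\<^sup>2) \<le> (\<bar>a\<bar> + \<delta>)\<^sup>2"
  proof eventually_elim
    case (elim l)
    then have "l \<in> {a - \<delta>..a + \<delta>}" using I(2) by blast
    then have "\<bar>l\<bar> \<le> \<bar>a\<bar> + \<delta>" unfolding atLeastAtMost_iff by linarith
    from power_mono[OF this, of 2] show ?case by simp
  qed
  then have "integrable (\<mu> (E I g)) (\<lambda>l. l\<^sup>2)"
    by (rule integrable_const_bound) (simp cong: measurable_cong_sets)
  with u show ?thesis by (simp add: D_eq)
qed

text \<open>
  The operator is linked to \<open>E\<close> only by \<open>\<langle>T s, s\<rangle> = \<integral> l d\<mu>\<^sub>s\<close>, so the left-hand side is obtained by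
  polarisation, as a difference of integrals of \<open>l - a\<close> against the measures of \<open>u + w\<close> and \<open>u - w\<close>.
  As \<open>u\<close> lives on \<open>I\<close>, these measures agree outside \<open>I\<close>; on \<open>I\<close> the integrand is at
  most \<open>\<delta>\<close> in modulus, and the parallelogram law gives the bound. Since \<open>w\<close> ranges over the
  whole domain, the bound controls all of \<open>(T - a) u\<close>, not only its part in the range of \<open>E I\<close>.
\<close>

lemma spectral_band_polarised:
  assumes g: "g \<in> L2 \<omega>" and I: "I \<in> sets borel" "I \<subseteq> {a - \<delta>..a + \<delta>}" and \<delta>: "0 \<le> \<delta>" and w: "w \<in> D"
  defines "u \<equiv> E I g"
  shows "2 * Re (L2_inner \<omega> (\<lambda>x. T u x - complex_of_real a * u x) w)
    \<le> \<delta> * ((L2_norm \<omega> u)\<^sup>2 + (L2_norm \<omega> w)\<^sup>2)"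
proof -
  have uD: "u \<in> D" unfolding u_def using g I by (rule E_bounded_in_D)
  note u = D_L2[OF uD] and wL = D_L2[OF w]
  define s where "s b = (\<lambda>x. 1 * u x + b * w x)" for b :: complex
  have sD: "s b \<in> D" for b unfolding s_def using uD w by (rule D_lincomb)
  note sL = D_L2[OF sD]
  have norm_s: "(L2_norm \<omega> (s b))\<^sup>2 = (L2_norm \<omega> u)\<^sup>2 + 2 * Re (cnj b * L2_inner \<omega> u w) + (cmod b)\<^sup>2 * (L2_norm \<omega> w)\<^sup>2" for b
  proof -
    have "L2_inner \<omega> (s b) (s b) = L2_inner \<omega> u u + cnj b * L2_inner \<omega> u w + b * cnj (L2_inner \<omega> u w) + b * cnj b * L2_inner \<omega> w w"
      using sL[of b] unfolding s_def
      by (simp add: L2_inner_lincomb_left[OF u wL, of _ 1 b, simplified] L2_inner_lincomb_right[OF u wL _ , of _ 1 b, simplified] u wL L2_inner_cnj[of \<omega> w u] algebra_simps)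
    then have "Re (L2_inner \<omega> (s b) (s b)) = Re (L2_inner \<omega> u u) + 2 * Re (cnj b * L2_inner \<omega> u w) + (cmod b)\<^sup>2 * Re (L2_inner \<omega> w w)"
      using Re_quadratic[of "L2_inner \<omega> w w"] by (simp add: L2_inner_self)
    then show ?thesis by (simp only: L2_inner_self Re_complex_of_real)
  qed
  have form_s: "(LINT l|\<mu> (s b). l) = Re (L2_inner \<omega> (T u) u) + 2 * Re (cnj b * L2_inner \<omega> (T u) w) + (cmod b)\<^sup>2 * Re (L2_inner \<omega> (T w) w)" for b
  proof -
    let ?t = "\<lambda>x. 1 * T u x + b * T w x"
    have t: "?t \<in> L2 \<omega>" using T_L2[OF uD] T_L2[OF w] by (rule L2_lincomb)
    have "L2_inner \<omega> (T (s b)) (s b) = L2_inner \<omega> ?t (s b)"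
      using T_lincomb[OF uD w, of 1 b] by (intro L2_inner_cong_AE T_L2 sD sL t) (auto simp: s_def)
    also have "\<dots> = L2_inner \<omega> (T u) (s b) + b * L2_inner \<omega> (T w) (s b)"
      using L2_inner_lincomb_left[OF T_L2[OF uD] T_L2[OF w] sL, of 1 b b] by simp
    also have "L2_inner \<omega> (T u) (s b) = L2_inner \<omega> (T u) u + cnj b * L2_inner \<omega> (T u) w"
      unfolding s_def using L2_inner_lincomb_right[OF u wL T_L2[OF uD], of 1 b] by simp
    also have "L2_inner \<omega> (T w) (s b) = cnj (L2_inner \<omega> (T u) w) + cnj b * L2_inner \<omega> (T w) w"
      unfolding s_def using L2_inner_lincomb_right[OF u wL T_L2[OF w], of 1 b]
        symmetric[OF w uD] L2_inner_cnj[of \<omega> w "T u"] by simp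
    finally have "L2_inner \<omega> (T (s b)) (s b) = L2_inner \<omega> (T u) u + cnj b * L2_inner \<omega> (T u) w
        + b * cnj (L2_inner \<omega> (T u) w) + b * cnj b * L2_inner \<omega> (T w) w"
      by (simp add: algebra_simps)
    then have "Re (L2_inner \<omega> (T (s b)) (s b)) = Re (L2_inner \<omega> (T u) u) + 2 * Re (cnj b * L2_inner \<omega> (T u) w)
        + (cmod b)\<^sup>2 * Re (L2_inner \<omega> (T w) w)"
      using Re_quadratic[of "L2_inner \<omega> (T w) w"] quadratic_form[OF w] by simp
    then show ?thesis using quadratic_form[OF sD[of b]] by simp
  qed
  define R where "R b = (LINT l|\<mu> (s b). indicator (- I) l *\<^sub>R (l - a))" for b
  \<comment> \<open>Outside \<open>I\<close>, the measures of \<open>u + w\<close> and \<open>u - w\<close> agree.\<close>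
  have outside: "R 1 = R (- 1)"
  proof -
    have "emeasure (\<mu> (s b)) B = ennreal ((L2_norm \<omega> (E B w))\<^sup>2)" if B: "B \<in> sets borel" "B \<subseteq> - I" and b: "cmod b = 1" for B b
    proof -
      have "B \<inter> I = {}" using B(2) by auto
      have "AE x in \<omega>. E B (s b) x = b * E B w x"
        using E_lincomb[OF B(1) u wL, of 1 b] E_Int[OF B(1) I(1) g] E_empty[OF g]
        unfolding \<open>B \<inter> I = {}\<close> s_def[symmetric] u_def[symmetric] by eventually_elim simp
      then have "L2_norm \<omega> (E B (s b)) = L2_norm \<omega> (\<lambda>x. b * E B w x)"
        by (intro L2_norm_cong_AE E_L2 L2_scale B sL wL)
      then show ?thesis using emeasure_\<mu>[OF sL B(1)] b by (simp add: L2_norm_scale)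
    qed
    note agree = this
    have "restrict_space (\<mu> (s 1)) (- I) = restrict_space (\<mu> (s (- 1))) (- I)"
    proof (rule measure_eqI)
      show "sets (restrict_space (\<mu> (s 1)) (- I)) = sets (restrict_space (\<mu> (s (- 1))) (- I))"
        by (rule sets_restrict_space_cong) simp
      fix B assume "B \<in> sets (restrict_space (\<mu> (s 1)) (- I))"
      then have B: "B \<in> sets borel" "B \<subseteq> - I" using I(1) by (auto simp: sets_restrict_space)
      show "emeasure (restrict_space (\<mu> (s 1)) (- I)) B = emeasure (restrict_space (\<mu> (s (- 1))) (- I)) B"
        using B I(1) agree[OF B, of 1] agree[OF B, of "- 1"] by (simp add: emeasure_restrict_space)
    qed
    then show ?thesis
      unfolding R_def using I(1) integral_restrict_space[of "- I" "\<mu> (s 1)" "\<lambda>l. l - a"]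
        integral_restrict_space[of "- I" "\<mu> (s (- 1))" "\<lambda>l. l - a"] by simp
  qed
  have near: "\<bar>(LINT l|\<mu> (s b). l) - a * (L2_norm \<omega> (s b))\<^sup>2 - R b\<bar> \<le> \<delta> * (L2_norm \<omega> (s b))\<^sup>2" for b
  proof -
    interpret finite_measure "\<mu> (s b)" using sL by (rule finite_\<mu>)
    have int: "integrable (\<mu> (s b)) (\<lambda>l. l - a)" using integrable_id[OF sD] by simp
    have int_ind: "integrable (\<mu> (s b)) (\<lambda>l. indicator C l *\<^sub>R (l - a))" if "C \<in> sets borel" for C
      using that int by (intro integrable_mult_indicator) auto
    have "(LINT l|\<mu> (s b). l) - a * (L2_norm \<omega> (s b))\<^sup>2 = (LINT l|\<mu> (s b). l - a)"
      using integrable_id[OF sD[of b]] by (simp add: measure_\<mu>_UNIV[OF sL] mult.commute)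
    also have "\<dots> = (LINT l|\<mu> (s b). indicator I l *\<^sub>R (l - a) + indicator (- I) l *\<^sub>R (l - a))"
      by (intro Bochner_Integration.integral_cong refl) (simp split: split_indicator)
    also have "\<dots> = (LINT l|\<mu> (s b). indicator I l *\<^sub>R (l - a)) + R b"
      unfolding R_def using I(1) by (intro Bochner_Integration.integral_add int_ind) auto
    finally have "(LINT l|\<mu> (s b). l) - a * (L2_norm \<omega> (s b))\<^sup>2 - R b = (LINT l|\<mu> (s b). indicator I l *\<^sub>R (l - a))"
      by simp
    moreover have "\<bar>LINT l|\<mu> (s b). indicator I l *\<^sub>R (l - a)\<bar> \<le> (LINT l|\<mu> (s b). \<bar>indicator I l *\<^sub>R (l - a)\<bar>)"
      by (rule integral_abs_bound)
    moreover have "(LINT l|\<mu> (s b). \<bar>indicator I l *\<^sub>R (l - a)\<bar>) \<le> \<delta> * (L2_norm \<omega> (s b))\<^sup>2"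
    proof -
      have "(LINT l|\<mu> (s b). \<bar>indicator I l *\<^sub>R (l - a)\<bar>) \<le> (LINT l|\<mu> (s b). \<delta>)"
        using I \<delta> by (intro integral_mono integrable_abs int_ind) (auto split: split_indicator simp: abs_le_iff)
      then show ?thesis by (simp add: measure_\<mu>_UNIV[OF sL] mult.commute)
    qed
    ultimately show ?thesis by linarith
  qed
  have "4 * Re (L2_inner \<omega> (T u) w) - a * (4 * Re (L2_inner \<omega> u w))
      = ((LINT l|\<mu> (s 1). l) - a * (L2_norm \<omega> (s 1))\<^sup>2 - R 1)
        - ((LINT l|\<mu> (s (- 1)). l) - a * (L2_norm \<omega> (s (- 1)))\<^sup>2 - R (- 1))"
    unfolding form_s norm_s outside by (simp add: algebra_simps)
  also have "\<dots> \<le> \<delta> * (L2_norm \<omega> (s 1))\<^sup>2 + \<delta> * (L2_norm \<omega> (s (- 1)))\<^sup>2"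
    using near[of 1] near[of "- 1"] by linarith
  also have "\<dots> = 2 * (\<delta> * ((L2_norm \<omega> u)\<^sup>2 + (L2_norm \<omega> w)\<^sup>2))"
    unfolding norm_s by (simp add: algebra_simps)
  finally have "2 * (Re (L2_inner \<omega> (T u) w) - a * Re (L2_inner \<omega> u w)) \<le> \<delta> * ((L2_norm \<omega> u)\<^sup>2 + (L2_norm \<omega> w)\<^sup>2)"
    by (simp add: algebra_simps)
  moreover have "L2_inner \<omega> (\<lambda>x. T u x - complex_of_real a * u x) w = L2_inner \<omega> (T u) w - complex_of_real a * L2_inner \<omega> u w"
    using L2_inner_lincomb_left[OF T_L2[OF uD] u wL, of 1 "- complex_of_real a"] by simp
  ultimately show ?thesis by simp
qed

text \<open>
  Put \<open>y = (T - a) u\<close>. By density of the domain, \<open>w = y / \<delta>\<close> may be used in the polarised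
  inequality, which then reads \<open>2 \<parallel>y\<parallel>\<^sup>2 / \<delta> \<le> \<delta> \<parallel>u\<parallel>\<^sup>2 + \<parallel>y\<parallel>\<^sup>2 / \<delta>\<close>.
\<close>

lemma spectral_band:
  assumes g: "g \<in> L2 \<omega>" and I: "I \<in> sets borel" "I \<subseteq> {a - \<delta>..a + \<delta>}" and \<delta>: "0 < \<delta>"
  defines "u \<equiv> E I g"
  shows "u \<in> D" and "L2_norm \<omega> (\<lambda>x. T u x - complex_of_real a * u x) \<le> \<delta> * L2_norm \<omega> u"
proof -
  show uD: "u \<in> D" unfolding u_def using g I by (rule E_bounded_in_D)
  let ?y = "\<lambda>x. T u x - complex_of_real a * u x"
  have y: "?y \<in> L2 \<omega>" using uD by (intro L2_diff L2_scale T_L2 D_L2)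
  let ?z = "\<lambda>x. complex_of_real (1 / \<delta>) * ?y x"
  have z: "?z \<in> L2 \<omega>" using y by (rule L2_scale)
  obtain w where w: "\<And>n. w n \<in> D" "L2_tendsto \<omega> w ?z" using dense[OF z] by blast
  have const: "L2_tendsto \<omega> (\<lambda>_. ?y) ?y" by (simp add: L2_tendsto_def L2_norm_def)
  have lim1: "(\<lambda>n. 2 * Re (L2_inner \<omega> ?y (w n))) \<longlonglongrightarrow> 2 * Re (L2_inner \<omega> ?y ?z)"
    by (intro tendsto_intros L2_tendsto_inner[OF const _ _ w(2)] y z D_L2 w(1))
  have lim2: "(\<lambda>n. \<delta> * ((L2_norm \<omega> u)\<^sup>2 + (L2_norm \<omega> (w n))\<^sup>2)) \<longlonglongrightarrow> \<delta> * ((L2_norm \<omega> u)\<^sup>2 + (L2_norm \<omega> ?z)\<^sup>2)"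
    by (intro tendsto_intros L2_tendsto_norm[OF w(2)] z D_L2 w(1))
  have "2 * Re (L2_inner \<omega> ?y ?z) \<le> \<delta> * ((L2_norm \<omega> u)\<^sup>2 + (L2_norm \<omega> ?z)\<^sup>2)"
    using spectral_band_polarised[OF g I less_imp_le[OF \<delta>] w(1), folded u_def]
    by (intro LIMSEQ_le[OF lim1 lim2]) blast
  moreover have "Re (L2_inner \<omega> ?y ?z) = (L2_norm \<omega> ?y)\<^sup>2 / \<delta>"
    unfolding L2_inner_cnj[of \<omega> ?y] L2_inner_scale_left L2_inner_self by simp
  moreover have "(L2_norm \<omega> ?z)\<^sup>2 = (L2_norm \<omega> ?y)\<^sup>2 / \<delta>\<^sup>2"
    unfolding L2_norm_scale norm_of_real using \<delta> by (simp add: power_mult_distrib power_divide)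
  ultimately have "2 * ((L2_norm \<omega> ?y)\<^sup>2 / \<delta>) \<le> \<delta> * ((L2_norm \<omega> u)\<^sup>2 + (L2_norm \<omega> ?y)\<^sup>2 / \<delta>\<^sup>2)"
    by (simp only:)
  then have "(L2_norm \<omega> ?y)\<^sup>2 \<le> (\<delta> * L2_norm \<omega> u)\<^sup>2"
    using \<delta> by (simp add: field_simps power2_eq_square)
  then show "L2_norm \<omega> ?y \<le> \<delta> * L2_norm \<omega> u"
    by (rule power2_le_imp_le) (use \<delta> in simp)
qed

end

section \<open>Galerkin matrices\<close>

lemma dict_comb_minus:
  assumes "h \<in> carrier_vec n" "k \<in> carrier_vec n"
  shows "dict_comb \<psi> (h - k) = (\<lambda>x. dict_comb \<psi> h x - dict_comb \<psi> k x)"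
  using assms by (simp add: dict_comb_def fun_eq_iff sum_subtractf[symmetric] right_diff_distrib)

lemma dict_comb_smult: "dict_comb \<psi> (c \<cdot>\<^sub>v h) = (\<lambda>x. c * dict_comb \<psi> h x)"
  by (simp add: dict_comb_def fun_eq_iff sum_distrib_left mult.left_commute)

locale galerkin = selfadjoint_operator \<omega> D T
  for \<omega> :: "'a measure" and D T +
  fixes \<psi> :: "nat \<Rightarrow> 'a \<Rightarrow> complex"
  assumes dict_D: "\<And>j. \<psi> j \<in> D" and indep: "L2_lin_indep \<omega> \<psi>"
begin

definition gram :: "nat \<Rightarrow> complex mat" where
  "gram N = Matrix.mat N N (\<lambda>(j, k). L2_inner \<omega> (\<psi> k) (\<psi> j))"

definition stiffness :: "nat \<Rightarrow> complex mat" where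
  "stiffness N = Matrix.mat N N (\<lambda>(j, k). L2_inner \<omega> (T (\<psi> k)) (\<psi> j))"

text \<open>
  In the basis \<open>\<psi>\<close> this is the matrix of \<open>P N \<circ> T\<close> on the span of the first \<open>N\<close> dictionary
  functions.
\<close>

definition compression :: "nat \<Rightarrow> complex mat" where
  "compression N = the (mat_inverse (gram N)) * stiffness N"

abbreviation "P N \<equiv> L2_proj \<omega> (dict_span \<psi> N)"

lemma gram_carrier [simp]: "gram N \<in> carrier_mat N N" "stiffness N \<in> carrier_mat N N"
  by (simp_all add: gram_def stiffness_def)

lemma dict_L2: "\<psi> j \<in> L2 \<omega>"
  by (rule D_L2[OF dict_D])

lemma comb_D: "dict_comb \<psi> h \<in> D"
proof -
  have "(\<lambda>x. \<psi> j x * h $ j) \<in> D" for j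
    using D_lincomb[OF dict_D[of j] dict_D[of j], of "h $ j" 0] by (simp add: mult.commute)
  then show ?thesis unfolding dict_comb_def by (intro D_sum)
qed

lemma comb_L2: "dict_comb \<psi> h \<in> L2 \<omega>"
  by (rule D_L2[OF comb_D])

lemma inner_comb_left:
  assumes "h \<in> carrier_vec N" "k \<in> L2 \<omega>"
  shows "L2_inner \<omega> (dict_comb \<psi> h) k = (\<Sum>j<N. h $ j * L2_inner \<omega> (\<psi> j) k)"
proof -
  have "dict_comb \<psi> h = (\<lambda>x. \<Sum>j<N. h $ j * \<psi> j x)"
    using assms(1) by (simp add: dict_comb_def mult.commute)
  then show ?thesis
    using assms(2) by (simp add: L2_inner_sum_left L2_scale dict_L2 L2_inner_scale_left)
qed

lemma inner_comb_right:
  assumes "h \<in> carrier_vec N" "k \<in> L2 \<omega>"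
  shows "L2_inner \<omega> k (dict_comb \<psi> h) = (\<Sum>j<N. cnj (h $ j) * L2_inner \<omega> k (\<psi> j))"
  unfolding L2_inner_cnj[of \<omega> k] inner_comb_left[OF assms] by simp

lemma G_inner_gram_eq:
  assumes "h \<in> carrier_vec N" "k \<in> carrier_vec N"
  shows "G_inner (gram N) h k = L2_inner \<omega> (dict_comb \<psi> h) (dict_comb \<psi> k)"
proof -
  have "L2_inner \<omega> (dict_comb \<psi> h) (dict_comb \<psi> k) = (\<Sum>i<N. \<Sum>j<N. h $ j * cnj (k $ i) * L2_inner \<omega> (\<psi> j) (\<psi> i))"
    by (simp add: inner_comb_right[OF assms(2) comb_L2] inner_comb_left[OF assms(1) dict_L2] sum_distrib_left mult_ac)
  then show ?thesis
    unfolding G_inner_eq_sum[OF gram_carrier(1) assms] by (simp add: gram_def mult_ac)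
qed

text \<open>
  Moving \<open>T\<close> to the dictionary functions by symmetry reduces the claim to linearity of the inner
  product.
\<close>

lemma G_inner_stiffness_eq:
  assumes "h \<in> carrier_vec N" "k \<in> carrier_vec N"
  shows "G_inner (stiffness N) h k = L2_inner \<omega> (T (dict_comb \<psi> h)) (dict_comb \<psi> k)"
proof -
  have "L2_inner \<omega> (T (dict_comb \<psi> h)) (\<psi> i) = (\<Sum>j<N. h $ j * L2_inner \<omega> (T (\<psi> j)) (\<psi> i))" for i
    unfolding symmetric[OF comb_D dict_D] inner_comb_left[OF assms(1) T_L2[OF dict_D]]
    by (simp add: symmetric[OF dict_D dict_D])
  then have "L2_inner \<omega> (T (dict_comb \<psi> h)) (dict_comb \<psi> k)
    = (\<Sum>i<N. \<Sum>j<N. h $ j * cnj (k $ i) * L2_inner \<omega> (T (\<psi> j)) (\<psi> i))"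
    by (simp add: inner_comb_right[OF assms(2) T_L2[OF comb_D]] sum_distrib_left mult_ac)
  then show ?thesis
    unfolding G_inner_eq_sum[OF gram_carrier(2) assms] by (simp add: stiffness_def mult_ac)
qed

lemma G_norm_gram: "h \<in> carrier_vec N \<Longrightarrow> G_norm (gram N) h = L2_norm \<omega> (dict_comb \<psi> h)"
  by (simp add: G_norm_def G_inner_gram_eq L2_norm_eq_sqrt_inner)

lemma gram_positive_definite:
  assumes "h \<in> carrier_vec N" "h \<noteq> 0\<^sub>v N"
  shows "0 < Re (G_inner (gram N) h h)"
proof -
  have "L2_norm \<omega> (dict_comb \<psi> h) \<noteq> 0"
    using indep assms unfolding L2_norm_eq_0_iff[OF comb_L2] L2_lin_indep_def by blast
  then show ?thesis
    by (simp add: G_inner_gram_eq[OF assms(1) assms(1)] L2_inner_self)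
qed

lemma gram_inverse:
  obtains I where "mat_inverse (gram N) = Some I" "I \<in> carrier_mat N N" "gram N * I = 1\<^sub>m N"
  using mat_inverse_exists[OF gram_carrier(1) positive_definite_det[OF gram_carrier(1) gram_positive_definite]]
  by blast

lemma compression_carrier: "compression N \<in> carrier_mat N N"
  by (rule gram_inverse[of N]) (simp add: compression_def mult_carrier_mat[of _ N N])

lemma gram_compression: "gram N * compression N = stiffness N"
proof (rule gram_inverse[of N])
  fix I assume I: "mat_inverse (gram N) = Some I" "I \<in> carrier_mat N N" "gram N * I = 1\<^sub>m N"
  have "gram N * compression N = gram N * I * stiffness N"
    using assoc_mult_mat[OF gram_carrier(1) I(2) gram_carrier(2)] by (simp add: compression_def I(1))
  then show ?thesis unfolding I(3) left_mult_one_mat[OF gram_carrier(2)] .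
qed

lemma compression_selfadjoint: "G_selfadjoint N (gram N) (compression N)"
proof
  show "mat_adjoint (gram N) = gram N"
    by (rule eq_matI) (auto simp: gram_def L2_inner_cnj[symmetric])
  show "mat_adjoint (gram N * compression N) = gram N * compression N"
    unfolding gram_compression
    by (rule eq_matI) (auto simp: stiffness_def symmetric[OF dict_D dict_D] L2_inner_cnj[symmetric])
qed (simp_all add: compression_carrier gram_positive_definite)

lemma inner_comb_compression:
  assumes h: "h \<in> carrier_vec N" and v: "v \<in> dict_span \<psi> N"
  shows "L2_inner \<omega> (dict_comb \<psi> (compression N *\<^sub>v h)) v = L2_inner \<omega> (T (dict_comb \<psi> h)) v"
proof -
  obtain k where k: "k \<in> carrier_vec N" "v = dict_comb \<psi> k" using v by (auto simp: dict_span_def)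
  have "compression N *\<^sub>v h \<in> carrier_vec N" using compression_carrier h by (rule mult_mat_vec_carrier)
  then have "L2_inner \<omega> (dict_comb \<psi> (compression N *\<^sub>v h)) v = G_inner (gram N * compression N) h k"
    unfolding k(2) G_inner_mult_left[OF gram_carrier(1) compression_carrier h, symmetric]
    using k(1) by (rule G_inner_gram_eq[symmetric])
  then show ?thesis unfolding gram_compression G_inner_stiffness_eq[OF h k(1)] k(2) .
qed

text \<open>
  Existence of the orthogonal projection comes from solving the normal equations, whose
  matrix is the Gram matrix.
\<close>

lemma P_orthogonal:
  assumes u: "u \<in> L2 \<omega>"
  shows "P N u \<in> dict_span \<psi> N" and "v \<in> dict_span \<psi> N \<Longrightarrow> L2_inner \<omega> (P N u) v = L2_inner \<omega> u v"
proof -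
  let ?Q = "\<lambda>v. v \<in> dict_span \<psi> N \<and> (\<forall>v'\<in>dict_span \<psi> N. L2_inner \<omega> (\<lambda>x. u x - v x) v' = 0)"
  have "\<exists>v. ?Q v"
  proof (rule gram_inverse[of N])
    fix I assume I: "I \<in> carrier_mat N N" "gram N * I = 1\<^sub>m N"
    define b where "b = Matrix.vec N (\<lambda>j. L2_inner \<omega> u (\<psi> j))"
    have b: "b \<in> carrier_vec N" by (simp add: b_def)
    let ?h = "I *\<^sub>v b"
    have h: "?h \<in> carrier_vec N" using I(1) b by (rule mult_mat_vec_carrier)
    have Gh: "gram N *\<^sub>v ?h = b"
      using assoc_mult_mat_vec[OF gram_carrier(1) I(1) b] b by (simp add: I(2))
    have "L2_inner \<omega> (\<lambda>x. u x - dict_comb \<psi> ?h x) v' = 0" if v': "v' \<in> dict_span \<psi> N" for v'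
    proof -
      obtain k where k: "k \<in> carrier_vec N" "v' = dict_comb \<psi> k" using v' by (auto simp: dict_span_def)
      have "L2_inner \<omega> (dict_comb \<psi> ?h) v' = b \<bullet>c k"
        unfolding k(2) G_inner_gram_eq[OF h k(1), symmetric] G_inner_def Gh ..
      also have "\<dots> = (\<Sum>j<N. cnj (k $ j) * L2_inner \<omega> u (\<psi> j))"
        using k(1) by (auto simp: scalar_prod_def b_def lessThan_atLeast0 intro!: sum.cong)
      also have "\<dots> = L2_inner \<omega> u v'" unfolding k(2) by (rule inner_comb_right[OF k(1) u, symmetric])
      finally show ?thesis using u comb_L2 k(2) by (simp add: L2_inner_diff_left)
    qed
    then show ?thesis using h by (intro exI[of _ "dict_comb \<psi> ?h"]) (auto simp: dict_span_def)
  qed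
  then have Q: "?Q (P N u)" unfolding L2_proj_def by (rule someI_ex)
  then show mem: "P N u \<in> dict_span \<psi> N" by blast
  assume v: "v \<in> dict_span \<psi> N"
  have "P N u \<in> L2 \<omega>" "v \<in> L2 \<omega>" using mem v comb_L2 by (auto simp: dict_span_def)
  then show "L2_inner \<omega> (P N u) v = L2_inner \<omega> u v"
    using Q v u L2_inner_diff_left[of u \<omega> "P N u" v] by simp
qed

lemma span_D: "v \<in> dict_span \<psi> N \<Longrightarrow> v \<in> D"
  using comb_D by (auto simp: dict_span_def)

lemma P_D: "u \<in> L2 \<omega> \<Longrightarrow> P N u \<in> D"
  by (rule span_D[OF P_orthogonal(1)])

lemma P_L2: "u \<in> L2 \<omega> \<Longrightarrow> P N u \<in> L2 \<omega>"
  by (rule D_L2[OF P_D])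

lemma P_unique:
  assumes u: "u \<in> L2 \<omega>" and h: "h \<in> carrier_vec N"
    and eq: "\<And>v. v \<in> dict_span \<psi> N \<Longrightarrow> L2_inner \<omega> (dict_comb \<psi> h) v = L2_inner \<omega> u v"
  shows "AE x in \<omega>. dict_comb \<psi> h x = P N u x"
proof -
  obtain k where k: "k \<in> carrier_vec N" "P N u = dict_comb \<psi> k"
    using P_orthogonal(1)[OF u, of N] by (auto simp: dict_span_def)
  let ?d = "\<lambda>x. dict_comb \<psi> h x - P N u x"
  have "?d = dict_comb \<psi> (h - k)" unfolding k(2) dict_comb_minus[OF h k(1)] ..
  moreover have "dict_comb \<psi> (h - k) \<in> dict_span \<psi> N" using h k(1) by (auto simp: dict_span_def)
  ultimately have d: "?d \<in> dict_span \<psi> N" by (simp only:)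
  have dL: "?d \<in> L2 \<omega>" using D_L2[OF span_D[OF d]] .
  have "L2_inner \<omega> ?d ?d = 0"
    using eq[OF d] P_orthogonal(2)[OF u d] dL by (simp add: L2_inner_diff_left[OF comb_L2 P_L2[OF u]])
  then have "L2_norm \<omega> ?d = 0" by (simp add: L2_inner_self)
  then show ?thesis using L2_norm_eq_0_iff[OF dL] by simp
qed

definition coeff :: "nat \<Rightarrow> ('a \<Rightarrow> complex) \<Rightarrow> complex Matrix.vec" where
  "coeff N u = (SOME h. h \<in> carrier_vec N \<and> P N u = dict_comb \<psi> h)"

lemma coeff:
  assumes "u \<in> L2 \<omega>"
  shows coeff_carrier: "coeff N u \<in> carrier_vec N" and P_eq_coeff: "P N u = dict_comb \<psi> (coeff N u)"
proof -
  have "\<exists>h. h \<in> carrier_vec N \<and> P N u = dict_comb \<psi> h"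
    using P_orthogonal(1)[OF assms, of N] by (auto simp: dict_span_def)
  from someI_ex[OF this] show "coeff N u \<in> carrier_vec N" "P N u = dict_comb \<psi> (coeff N u)"
    unfolding coeff_def by blast+
qed

text \<open>
  This turns the defect of a coefficient vector into a norm in \<open>L\<^sup>2\<close>, where
  the strong convergence of \<open>P N (T (P N u))\<close> can be used.
\<close>

lemma G_norm_compression_coeff:
  assumes u: "u \<in> L2 \<omega>"
  shows "G_norm (gram N) (compression N *\<^sub>v coeff N u - c \<cdot>\<^sub>v coeff N u)
    = L2_norm \<omega> (\<lambda>x. P N (T (P N u)) x - c * P N u x)"
proof -
  let ?h = "coeff N u"
  have h: "?h \<in> carrier_vec N" "compression N *\<^sub>v ?h \<in> carrier_vec N"
    using coeff_carrier[OF u] mult_mat_vec_carrier[OF compression_carrier] by auto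
  have TL: "T (P N u) \<in> L2 \<omega>" by (rule T_L2[OF P_D[OF u]])
  have "AE x in \<omega>. dict_comb \<psi> (compression N *\<^sub>v ?h) x = P N (T (P N u)) x"
    using inner_comb_compression[OF h(1)] by (intro P_unique[OF TL h(2)]) (simp add: P_eq_coeff[OF u])
  then have "L2_norm \<omega> (\<lambda>x. dict_comb \<psi> (compression N *\<^sub>v ?h) x - c * P N u x)
      = L2_norm \<omega> (\<lambda>x. P N (T (P N u)) x - c * P N u x)"
    by (intro L2_norm_cong_AE L2_diff L2_scale comb_L2 P_L2 TL u) auto
  moreover have "G_norm (gram N) (compression N *\<^sub>v ?h - c \<cdot>\<^sub>v ?h)
      = L2_norm \<omega> (\<lambda>x. dict_comb \<psi> (compression N *\<^sub>v ?h) x - c * P N u x)"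
    using h by (simp add: G_norm_gram dict_comb_minus[OF h(2), of "c \<cdot>\<^sub>v ?h"] dict_comb_smult P_eq_coeff[OF u])
  ultimately show ?thesis by simp
qed

end

section \<open>Riemann sums over a uniform partition\<close>

definition band :: "real \<Rightarrow> int \<Rightarrow> real set" where
  "band \<delta> j = {of_int j * \<delta>..<(of_int j + 1) * \<delta>}"

lemma band_sets [simp]: "band \<delta> j \<in> sets borel"
  by (simp add: band_def)

lemma band_subset: "band \<delta> j \<subseteq> {of_int j * \<delta> - \<delta>..of_int j * \<delta> + \<delta>}"
  by (auto simp: band_def algebra_simps)

text \<open>
  The band that contains \<open>l\<close> has index \<open>\<lfloor>l / \<delta>\<rfloor>\<close>.
\<close>

lemma sum_indicator_band:
  fixes y :: "int \<Rightarrow> real"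
  assumes \<delta>: "0 < \<delta>"
  shows "(\<Sum>j\<in>{-m..<m}. y j * indicator (band \<delta> j) l)
    = (if - of_int m * \<delta> \<le> l \<and> l < of_int m * \<delta> then y \<lfloor>l / \<delta>\<rfloor> else 0)"
proof -
  have mem: "l \<in> band \<delta> j \<longleftrightarrow> j = \<lfloor>l / \<delta>\<rfloor>" for j
    using \<delta> floor_eq_iff[of "l / \<delta>" j] by (auto simp: band_def field_simps)
  have "(\<Sum>j\<in>{-m..<m}. y j * indicator (band \<delta> j) l) = (\<Sum>j\<in>{-m..<m}. if j = \<lfloor>l / \<delta>\<rfloor> then y j else 0)"
    by (intro sum.cong refl) (simp add: mem indicator_def)
  also have "\<dots> = (if \<lfloor>l / \<delta>\<rfloor> \<in> {-m..<m} then y \<lfloor>l / \<delta>\<rfloor> else 0)" by simp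
  also have "\<lfloor>l / \<delta>\<rfloor> \<in> {-m..<m} \<longleftrightarrow> - of_int m * \<delta> \<le> l \<and> l < of_int m * \<delta>"
    using \<delta> by (simp add: le_floor_iff floor_less_iff field_simps)
  finally show ?thesis .
qed

lemma
  fixes h :: "real \<Rightarrow> real" and \<nu> :: "real measure" and m :: int
  assumes fin: "finite_measure \<nu>" and sets: "sets \<nu> = sets borel" and \<delta>: "0 < \<delta>"
  defines "out \<equiv> - {- of_int m * \<delta>..<of_int m * \<delta>}"
  shows sum_measure_band: "(\<Sum>j\<in>{-m..<m}. measure \<nu> (band \<delta> j)) = measure \<nu> UNIV - measure \<nu> out"
    and riemann_sum_approx: "L-lipschitz_on UNIV h \<Longrightarrow> (\<And>t. 0 \<le> h t \<and> h t \<le> 1) \<Longrightarrow>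
      \<bar>(\<Sum>j\<in>{-m..<m}. h (of_int j * \<delta>) * measure \<nu> (band \<delta> j)) - (LINT t|\<nu>. h t)\<bar>
        \<le> L * \<delta> * measure \<nu> UNIV + measure \<nu> out"
proof -
  interpret finite_measure \<nu> by (rule fin)
  have space: "space \<nu> = UNIV" using sets_eq_imp_space_eq[OF sets] by simp
  have bs: "band \<delta> j \<in> sets \<nu>" and os: "out \<in> sets \<nu>" for j by (simp_all add: sets out_def)
  have int_ind: "integrable \<nu> (\<lambda>t. indicator A t :: real)" if "A \<in> sets \<nu>" for A
    using that by (simp add: integrable_real_indicator less_top[symmetric])
  have step: "integrable \<nu> (\<lambda>t. \<Sum>j\<in>{-m..<m}. y j * indicator (band \<delta> j) t)"
    "(LINT t|\<nu>. (\<Sum>j\<in>{-m..<m}. y j * indicator (band \<delta> j) t)) = (\<Sum>j\<in>{-m..<m}. y j * measure \<nu> (band \<delta> j))"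
    for y :: "int \<Rightarrow> real"
  proof -
    have int: "integrable \<nu> (\<lambda>t. y j * indicator (band \<delta> j) t)" for j
      by (intro integrable_mult_right int_ind bs)
    show "integrable \<nu> (\<lambda>t. \<Sum>j\<in>{-m..<m}. y j * indicator (band \<delta> j) t)"
      by (intro Bochner_Integration.integrable_sum int)
    have "(LINT t|\<nu>. (\<Sum>j\<in>{-m..<m}. y j * indicator (band \<delta> j) t))
        = (\<Sum>j\<in>{-m..<m}. LINT t|\<nu>. y j * indicator (band \<delta> j) t)"
      by (intro Bochner_Integration.integral_sum int)
    also have "\<dots> = (\<Sum>j\<in>{-m..<m}. y j * measure \<nu> (band \<delta> j))"
      by (intro sum.cong refl) (simp add: space)
    finally show "(LINT t|\<nu>. (\<Sum>j\<in>{-m..<m}. y j * indicator (band \<delta> j) t)) = (\<Sum>j\<in>{-m..<m}. y j * measure \<nu> (band \<delta> j))" .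
  qed
  have "(\<Sum>j\<in>{-m..<m}. measure \<nu> (band \<delta> j)) = (LINT t|\<nu>. (\<Sum>j\<in>{-m..<m}. 1 * indicator (band \<delta> j) t))"
    unfolding step(2) by simp
  also have "\<dots> = (LINT t|\<nu>. 1 - indicator out t)"
    unfolding sum_indicator_band[OF \<delta>]
    by (intro Bochner_Integration.integral_cong refl) (auto simp: out_def indicator_def)
  also have "\<dots> = measure \<nu> UNIV - measure \<nu> out"
    using int_ind[OF os] os by (simp add: space)
  finally show "(\<Sum>j\<in>{-m..<m}. measure \<nu> (band \<delta> j)) = measure \<nu> UNIV - measure \<nu> out" .
  assume lip: "L-lipschitz_on UNIV h" and h01: "\<And>t. 0 \<le> h t \<and> h t \<le> 1"
  let ?s = "\<lambda>t. \<Sum>j\<in>{-m..<m}. h (of_int j * \<delta>) * indicator (band \<delta> j) t"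
  have L: "0 \<le> L" using lip by (rule lipschitz_on_nonneg)
  have hm: "h \<in> borel_measurable \<nu>"
    using borel_measurable_continuous_onI[OF lipschitz_on_continuous_on[OF lip]] sets
    by (simp cong: measurable_cong_sets)
  have hi: "integrable \<nu> h"
    using h01 hm by (intro integrable_const_bound[of _ 1]) auto
  have close: "\<bar>?s t - h t\<bar> \<le> L * \<delta> + indicator out t" for t
  proof (cases "t \<in> out")
    case True
    then have "?s t = 0" unfolding sum_indicator_band[OF \<delta>] by (auto simp: out_def)
    moreover have "0 \<le> L * \<delta>" using L \<delta> by simp
    ultimately show ?thesis using True h01[of t] by simp
  next
    case False
    then have s: "?s t = h (of_int \<lfloor>t / \<delta>\<rfloor> * \<delta>)" unfolding sum_indicator_band[OF \<delta>] by (auto simp: out_def)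
    have "\<bar>of_int \<lfloor>t / \<delta>\<rfloor> * \<delta> - t\<bar> \<le> \<delta>"
    proof -
      have "of_int \<lfloor>t / \<delta>\<rfloor> * \<delta> \<le> t / \<delta> * \<delta>" "t / \<delta> * \<delta> \<le> (of_int \<lfloor>t / \<delta>\<rfloor> + 1) * \<delta>"
        using \<delta> by (intro mult_right_mono; linarith)+
      then show ?thesis using \<delta> by (simp add: distrib_right abs_le_iff)
    qed
    then have "\<bar>?s t - h t\<bar> \<le> L * \<delta>"
      unfolding s using lipschitz_onD[OF lip, of "of_int \<lfloor>t / \<delta>\<rfloor> * \<delta>" t] L
      by (simp add: dist_real_def) (meson mult_left_mono order_trans)
    then show ?thesis using False by simp
  qed
  have "\<bar>(\<Sum>j\<in>{-m..<m}. h (of_int j * \<delta>) * measure \<nu> (band \<delta> j)) - (LINT t|\<nu>. h t)\<bar> = \<bar>LINT t|\<nu>. ?s t - h t\<bar>"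
    using step hi by simp
  also have "\<dots> \<le> (LINT t|\<nu>. \<bar>?s t - h t\<bar>)" by (rule integral_abs_bound)
  also have "\<dots> \<le> (LINT t|\<nu>. L * \<delta> + indicator out t)"
    using step(1) hi int_ind[OF os] close by (intro integral_mono integrable_abs) auto
  also have "\<dots> = L * \<delta> * measure \<nu> UNIV + measure \<nu> out"
    using int_ind[OF os] os by (simp add: space mult.commute)
  finally show "\<bar>(\<Sum>j\<in>{-m..<m}. h (of_int j * \<delta>) * measure \<nu> (band \<delta> j)) - (LINT t|\<nu>. h t)\<bar>
        \<le> L * \<delta> * measure \<nu> UNIV + measure \<nu> out" .
qed

section \<open>Spectral convergence of Galerkin compressions\<close>

locale spectral_galerkin = spectral_operator \<omega> D T E + galerkin \<omega> D T \<psi>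
  for \<omega> :: "'a measure" and D T E \<psi> +
  assumes P_strong: "\<And>u. u \<in> L2 \<omega> \<Longrightarrow> L2_tendsto \<omega> (\<lambda>N. P N u) u"
    and P_T_strong: "\<And>u. u \<in> D \<Longrightarrow> L2_tendsto \<omega> (\<lambda>N. P N (T (P N u))) (T u)"
begin

text \<open>
  The components \<open>E (band j) g\<close> are orthogonal and \<open>\<langle>g, E (band j) g\<rangle> = \<parallel>E (band j) g\<parallel>\<^sup>2\<close>. Hence the
  squares of their norms add up to at most \<open>\<parallel>g\<parallel>\<^sup>2\<close>, and Cauchy--Schwarz costs only the square root of the number
  of bands, \<open>2m\<close>. This square root is what lets the accumulated error of thin bands vanish.
\<close>

lemma band_decomposition:
  assumes g: "g \<in> L2 \<omega>" and \<delta>: "0 < \<delta>" and m: "0 \<le> m"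
  defines "t \<equiv> measure (\<mu> g) (- {- of_int m * \<delta>..<of_int m * \<delta>})"
  shows "(L2_norm \<omega> (\<lambda>x. g x - (\<Sum>j\<in>{-m..<m}. E (band \<delta> j) g x)))\<^sup>2 = t"
    and "(\<Sum>j\<in>{-m..<m}. L2_norm \<omega> (E (band \<delta> j) g)) \<le> sqrt (2 * of_int m) * L2_norm \<omega> g"
proof -
  let ?J = "{-m..<m}"
  let ?u = "\<lambda>j. E (band \<delta> j) g"
  have u: "?u j \<in> L2 \<omega>" for j using g by (simp add: E_L2)
  have sum_sq: "(\<Sum>j\<in>?J. (L2_norm \<omega> (?u j))\<^sup>2) = (L2_norm \<omega> g)\<^sup>2 - t"
    using sum_measure_band[OF finite_\<mu>[OF g] \<mu>_sets \<delta>, of m] unfolding t_def measure_\<mu>_UNIV[OF g]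
    by (simp add: measure_\<mu> g)
  have inner_gu: "L2_inner \<omega> g (?u j) = complex_of_real ((L2_norm \<omega> (?u j))\<^sup>2)" for j
    using E_inner_E[of "band \<delta> j" "band \<delta> j" g g] g
    by (simp add: L2_inner_self E_symmetric[symmetric])
  have inner_ug: "L2_inner \<omega> (?u j) g = complex_of_real ((L2_norm \<omega> (?u j))\<^sup>2)" for j
    unfolding L2_inner_cnj[of \<omega> "?u j" g] inner_gu by simp
  have inner_uu: "L2_inner \<omega> (?u i) (?u j) = (if i = j then complex_of_real ((L2_norm \<omega> (?u j))\<^sup>2) else 0)" for i j
  proof (cases "i = j")
    case True
    then show ?thesis by (simp add: L2_inner_self)
  next
    case False
    then have "band \<delta> j \<inter> band \<delta> i = {}"
    proof (rule contrapos_np)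
      assume "band \<delta> j \<inter> band \<delta> i \<noteq> {}"
      then obtain l where "l \<in> band \<delta> j" "l \<in> band \<delta> i" by blast
      then have "j = \<lfloor>l / \<delta>\<rfloor>" "i = \<lfloor>l / \<delta>\<rfloor>"
        using \<delta> floor_eq_iff[of "l / \<delta>" j] floor_eq_iff[of "l / \<delta>" i] by (auto simp: band_def field_simps)
      then show "i = j" by simp
    qed
    then have "L2_inner \<omega> (?u i) (?u j) = L2_inner \<omega> (E {} g) g" using E_inner_E[of "band \<delta> i" "band \<delta> j" g g] g by simp
    also have "\<dots> = L2_inner \<omega> (\<lambda>_. 0) g"
      using E_empty[OF g] g by (intro L2_inner_cong_AE L2_zero E_L2) auto
    finally show ?thesis using False by simp
  qed
  let ?s = "\<lambda>x. \<Sum>j\<in>?J. ?u j x"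
  let ?r = "\<lambda>x. g x - ?s x"
  have s: "?s \<in> L2 \<omega>" using u by (intro L2_sum)
  have r: "?r \<in> L2 \<omega>" using g s by (rule L2_diff)
  have inner_ru: "L2_inner \<omega> ?r (?u j) = 0" if "j \<in> ?J" for j
    using that by (simp add: L2_inner_diff_left[OF g s u] L2_inner_sum_left u inner_gu inner_uu)
  have "L2_inner \<omega> ?r ?s = cnj (\<Sum>j\<in>?J. L2_inner \<omega> (?u j) ?r)"
    unfolding L2_inner_cnj[of \<omega> ?r] using u r by (simp only: L2_inner_sum_left)
  also have "\<dots> = 0" using inner_ru L2_inner_cnj[of \<omega> _ ?r] by simp
  finally have "L2_inner \<omega> ?r ?r = L2_inner \<omega> ?r g"
    using L2_inner_lincomb_right[OF g s r, of 1 "- 1"] by simp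
  also have "\<dots> = L2_inner \<omega> g g - (\<Sum>j\<in>?J. L2_inner \<omega> (?u j) g)"
    unfolding L2_inner_diff_left[OF g s g] L2_inner_sum_left[OF u g] ..
  finally have "complex_of_real ((L2_norm \<omega> ?r)\<^sup>2) = complex_of_real t"
    unfolding inner_ug L2_inner_self of_real_sum[symmetric] sum_sq by simp
  then show "(L2_norm \<omega> ?r)\<^sup>2 = t" by (simp only: of_real_eq_iff)
  have "(\<Sum>j\<in>?J. L2_norm \<omega> (?u j))\<^sup>2 \<le> (\<Sum>j\<in>?J. 1\<^sup>2) * (\<Sum>j\<in>?J. (L2_norm \<omega> (?u j))\<^sup>2)"
    using Cauchy_Schwarz_ineq_sum[of "\<lambda>_. 1" "\<lambda>j. L2_norm \<omega> (?u j)" ?J] by simp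
  also have "\<dots> \<le> (2 * of_int m) * (L2_norm \<omega> g)\<^sup>2"
  proof (intro mult_mono)
    show "(\<Sum>j\<in>?J. (L2_norm \<omega> (?u j))\<^sup>2) \<le> (L2_norm \<omega> g)\<^sup>2" unfolding sum_sq t_def by simp
  qed (use m in \<open>auto intro: sum_nonneg\<close>)
  finally have "(\<Sum>j\<in>?J. L2_norm \<omega> (?u j))\<^sup>2 \<le> (sqrt (2 * of_int m) * L2_norm \<omega> g)\<^sup>2"
    using m by (simp add: power_mult_distrib)
  then show "(\<Sum>j\<in>?J. L2_norm \<omega> (?u j)) \<le> sqrt (2 * of_int m) * L2_norm \<omega> g"
    by (rule power2_le_imp_le) (use m in simp)
qed

lemma dict_comb_residual:
  assumes "c \<in> carrier_vec n" "\<And>j. j \<in> J \<Longrightarrow> v j \<in> carrier_vec n"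
  shows "dict_comb \<psi> (Matrix.vec n (\<lambda>i. c $ i - (\<Sum>j\<in>J. v j $ i)))
    = (\<lambda>x. dict_comb \<psi> c x - (\<Sum>j\<in>J. dict_comb \<psi> (v j) x))"
proof
  fix x
  have "(\<Sum>j\<in>J. dict_comb \<psi> (v j) x) = (\<Sum>j\<in>J. \<Sum>i<n. \<psi> i x * v j $ i)"
    by (intro sum.cong refl) (simp add: dict_comb_def carrier_vecD[OF assms(2)])
  also have "\<dots> = (\<Sum>i<n. \<psi> i x * (\<Sum>j\<in>J. v j $ i))"
    by (subst sum.swap) (simp only: sum_distrib_left)
  finally show "dict_comb \<psi> (Matrix.vec n (\<lambda>i. c $ i - (\<Sum>j\<in>J. v j $ i))) x
      = dict_comb \<psi> c x - (\<Sum>j\<in>J. dict_comb \<psi> (v j) x)"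
    using assms(1) by (simp add: dict_comb_def right_diff_distrib sum_subtractf)
qed

text \<open>
  For each partition level \<open>k\<close> the inequality \<open>spectral_integral_approx\<close> is applied with the
  projected band components; its right-hand side converges as \<open>N \<rightarrow> \<infinity>\<close>, and the limit tends to
  zero with \<open>k\<close>.
\<close>

theorem galerkin_spectral_measure_tendsto:
  fixes f :: "real \<Rightarrow> 'b::{banach, second_countable_topology}"
  assumes g: "g \<in> L2 \<omega>"
    and c: "\<And>N. c N \<in> carrier_vec N" "\<And>N. AE x in \<omega>. P N g x = dict_comb \<psi> (c N) x"
    and f: "continuous_on UNIV f" "bounded (range f)"
  shows "(\<lambda>N. LINT l|matrix_spectral_measure (gram N) (compression N) (c N). f l) \<longlonglongrightarrow> (LINT l|\<mu> g. f l)"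
proof (rule weak_convergence_from_lipschitz[OF _ _ _ _ f])
  show "\<forall>\<^sub>F N in sequentially. finite_measure (matrix_spectral_measure (gram N) (compression N) (c N)) \<and>
      sets (matrix_spectral_measure (gram N) (compression N) (c N)) = sets borel"
    using G_selfadjoint.finite_matrix_spectral_measure[OF compression_selfadjoint c(1)]
    by (intro always_eventually) (auto simp: matrix_spectral_measure_def)
  show "finite_measure (\<mu> g)" by (rule finite_\<mu>[OF g])
  show "sets (\<mu> g) = sets borel" by (rule \<mu>_sets)
  fix h :: "real \<Rightarrow> real" and L
  assume lip: "L-lipschitz_on UNIV h" and h01: "\<And>t. 0 \<le> h t \<and> h t \<le> 1"
  have L: "0 \<le> L" using lip by (rule lipschitz_on_nonneg)
  \<comment> \<open>Width \<open>\<delta>\<close> and index range \<open>m\<close> satisfy \<open>m \<delta> \<rightarrow> \<infinity>\<close> (the bands exhaust the line) and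
    \<open>\<delta> \<surd>m \<rightarrow> 0\<close> (the accumulated defect vanishes).\<close>
  define \<delta> where "\<delta> k = 1 / real (Suc k) ^ 3" for k
  define m where "m k = int (Suc k) ^ 4" for k
  have \<delta>: "0 < \<delta> k" for k by (simp add: \<delta>_def)
  have m: "0 \<le> m k" for k by (simp add: m_def)
  have m\<delta>: "of_int (m k) * \<delta> k = real (Suc k)" for k
    by (simp add: m_def \<delta>_def power_numeral_reduce field_simps del: of_nat_Suc)
  define J where "J k = {- m k..<m k}" for k
  define a where "a k j = of_int j * \<delta> k" for k j
  define u where "u k j = E (band (\<delta> k) j) g" for k j
  define t where "t k = measure (\<mu> g) (- {- of_int (m k) * \<delta> k..<of_int (m k) * \<delta> k})" for k
  have uD: "u k j \<in> D" and band: "L2_norm \<omega> (\<lambda>x. T (u k j) x - complex_of_real (a k j) * u k j x) \<le> \<delta> k * L2_norm \<omega> (u k j)" for k j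
    using spectral_band[OF g band_sets band_subset \<delta>] unfolding u_def a_def by auto
  have u: "u k j \<in> L2 \<omega>" for k j using uD by (rule D_L2)
  let ?v = "\<lambda>N k j. coeff N (u k j)"
  have v: "?v N k j \<in> carrier_vec N" for N k j using u by (rule coeff_carrier)
  let ?r = "\<lambda>N k. Matrix.vec N (\<lambda>i. c N $ i - (\<Sum>j\<in>J k. ?v N k j $ i))"
  let ?X = "\<lambda>N. LINT l|matrix_spectral_measure (gram N) (compression N) (c N). h l"
  let ?S = "\<lambda>k N. \<Sum>j\<in>J k. h (a k j) * Re (G_inner (gram N) (?v N k j) (c N))"
  let ?w = "\<lambda>N k j. compression N *\<^sub>v ?v N k j - complex_of_real (a k j) \<cdot>\<^sub>v ?v N k j"
  let ?B = "\<lambda>k N. (G_norm (gram N) (?r N k) + L * (\<Sum>j\<in>J k. G_norm (gram N) (?w N k j))) * G_norm (gram N) (c N)"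
  let ?s = "\<lambda>k. \<Sum>j\<in>J k. h (a k j) * measure (\<mu> g) (band (\<delta> k) j)"
  let ?b = "\<lambda>k. (L2_norm \<omega> (\<lambda>x. g x - (\<Sum>j\<in>J k. u k j x))
      + L * (\<Sum>j\<in>J k. L2_norm \<omega> (\<lambda>x. T (u k j) x - complex_of_real (a k j) * u k j x))) * L2_norm \<omega> g"
  let ?e = "\<lambda>k. L * \<delta> k * (L2_norm \<omega> g)\<^sup>2 + t k"
  show "?X \<longlonglongrightarrow> (LINT l|\<mu> g. h l)"
  proof (rule tendsto_by_approximation)
    show "\<bar>?X N - ?S k N\<bar> \<le> ?B k N" for k N
      by (rule G_selfadjoint.spectral_integral_approx[OF compression_selfadjoint lip h01 c(1)])
         (simp_all add: v)
    show "?S k \<longlonglongrightarrow> ?s k" for k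
    proof (intro tendsto_sum tendsto_mult tendsto_const)
      fix j
      have "(\<lambda>N. Re (L2_inner \<omega> (P N (u k j)) (P N g))) \<longlonglongrightarrow> Re (L2_inner \<omega> (u k j) g)"
        by (intro tendsto_Re L2_tendsto_inner P_strong P_L2 u g)
      moreover have "G_inner (gram N) (?v N k j) (c N) = L2_inner \<omega> (P N (u k j)) (P N g)" for N
        unfolding G_inner_gram_eq[OF v c(1)] P_eq_coeff[OF u]
      proof (rule L2_inner_cong_AE)
        show "AE x in \<omega>. dict_comb \<psi> (c N) x = P N g x" using c(2)[of N] by eventually_elim simp
      qed (simp_all add: comb_L2 P_L2 g)
      moreover have "Re (L2_inner \<omega> (u k j) g) = measure (\<mu> g) (band (\<delta> k) j)"
        unfolding u_def using g by (simp add: E_norm measure_\<mu>)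
      ultimately show "(\<lambda>N. Re (G_inner (gram N) (?v N k j) (c N))) \<longlonglongrightarrow> measure (\<mu> g) (band (\<delta> k) j)"
        by simp
    qed
    show "?B k \<longlonglongrightarrow> ?b k" for k
    proof (intro tendsto_mult tendsto_add tendsto_sum tendsto_const)
      have "G_norm (gram N) (c N) = L2_norm \<omega> (P N g)" for N
        unfolding G_norm_gram[OF c(1)] using c(2)[of N]
        by (intro L2_norm_cong_AE comb_L2 P_L2 g) (auto elim: eventually_mono)
      then show "(\<lambda>N. G_norm (gram N) (c N)) \<longlonglongrightarrow> L2_norm \<omega> g"
        using L2_tendsto_norm[OF P_strong[OF g] P_L2[OF g] g] by simp
      have sumP: "(\<lambda>x. \<Sum>j\<in>J k. P N (u k j) x) \<in> L2 \<omega>" for N by (intro L2_sum P_L2 u)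
      have sumu: "(\<lambda>x. \<Sum>j\<in>J k. u k j x) \<in> L2 \<omega>" by (intro L2_sum u)
      have "L2_tendsto \<omega> (\<lambda>N x. \<Sum>j\<in>J k. P N (u k j) x) (\<lambda>x. \<Sum>j\<in>J k. u k j x)"
        by (intro L2_tendsto_sum P_strong P_L2 u)
      from L2_tendsto_lincomb[OF P_strong[OF g] P_L2[OF g] g this sumP sumu, of 1 "- 1"]
      have "L2_tendsto \<omega> (\<lambda>N x. P N g x - (\<Sum>j\<in>J k. P N (u k j) x)) (\<lambda>x. g x - (\<Sum>j\<in>J k. u k j x))"
        by simp
      from L2_tendsto_norm[OF this L2_diff[OF P_L2[OF g] sumP] L2_diff[OF g sumu]]
      have lim: "(\<lambda>N. L2_norm \<omega> (\<lambda>x. P N g x - (\<Sum>j\<in>J k. P N (u k j) x)))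
        \<longlonglongrightarrow> L2_norm \<omega> (\<lambda>x. g x - (\<Sum>j\<in>J k. u k j x))" .
      have "G_norm (gram N) (?r N k) = L2_norm \<omega> (\<lambda>x. P N g x - (\<Sum>j\<in>J k. P N (u k j) x))" for N
      proof -
        have "G_norm (gram N) (?r N k) = L2_norm \<omega> (\<lambda>x. dict_comb \<psi> (c N) x - (\<Sum>j\<in>J k. P N (u k j) x))"
          using dict_comb_residual[OF c(1)[of N], of "J k" "?v N k"] v
          by (simp add: G_norm_gram P_eq_coeff[OF u])
        also have "\<dots> = L2_norm \<omega> (\<lambda>x. P N g x - (\<Sum>j\<in>J k. P N (u k j) x))"
        proof (rule L2_norm_cong_AE)
          show "AE x in \<omega>. dict_comb \<psi> (c N) x - (\<Sum>j\<in>J k. P N (u k j) x) = P N g x - (\<Sum>j\<in>J k. P N (u k j) x)"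
            using c(2)[of N] by eventually_elim simp
        qed (intro L2_diff comb_L2 P_L2 g sumP)+
        finally show ?thesis .
      qed
      with lim show "(\<lambda>N. G_norm (gram N) (?r N k)) \<longlonglongrightarrow> L2_norm \<omega> (\<lambda>x. g x - (\<Sum>j\<in>J k. u k j x))"
        by simp
      fix j
      from L2_tendsto_lincomb[OF P_T_strong[OF uD] P_L2[OF T_L2[OF P_D[OF u]]] T_L2[OF uD]
          P_strong[OF u] P_L2[OF u] u, where a = 1 and b = "- complex_of_real (a k j)"]
      have "L2_tendsto \<omega> (\<lambda>N x. P N (T (P N (u k j))) x - complex_of_real (a k j) * P N (u k j) x)
          (\<lambda>x. T (u k j) x - complex_of_real (a k j) * u k j x)" by simp
      then show "(\<lambda>N. G_norm (gram N) (?w N k j)) \<longlonglongrightarrow> L2_norm \<omega> (\<lambda>x. T (u k j) x - complex_of_real (a k j) * u k j x)"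
        unfolding G_norm_compression_coeff[OF u]
        by (rule L2_tendsto_norm) (intro L2_diff L2_scale P_L2 T_L2 P_D u uD)+
    qed
    show "\<bar>?s k - (LINT l|\<mu> g. h l)\<bar> \<le> ?e k" for k
      using riemann_sum_approx[OF finite_\<mu>[OF g] \<mu>_sets \<delta>[of k] lip h01, of "m k"]
      unfolding J_def a_def t_def measure_\<mu>_UNIV[OF g] .
    have t: "t \<longlonglongrightarrow> 0"
    proof -
      interpret finite_measure "\<mu> g" by (rule finite_\<mu>[OF g])
      let ?A = "\<lambda>k. - {- real (Suc k)..<real (Suc k)}"
      have "(\<lambda>k. measure (\<mu> g) (?A k)) \<longlonglongrightarrow> measure (\<mu> g) (\<Inter>k. ?A k)"
        by (rule finite_Lim_measure_decseq) (auto simp: decseq_def)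
      also have "(\<Inter>k. ?A k) = {}"
      proof -
        have "\<exists>k. l \<notin> ?A k" for l :: real
        proof -
          obtain k where "\<bar>l\<bar> < real k" using reals_Archimedean2 by blast
          then show ?thesis by (intro exI[of _ k]) auto
        qed
        then show ?thesis by blast
      qed
      finally show ?thesis unfolding t_def by (simp add: m\<delta> del: of_nat_Suc)
    qed
    let ?bound = "\<lambda>k. (sqrt (t k) + L * (sqrt 2 * (1 / real (Suc k)) * L2_norm \<omega> g)) * L2_norm \<omega> g
        + (L * \<delta> k * (L2_norm \<omega> g)\<^sup>2 + t k)"
    have inv: "(\<lambda>k. 1 / real (Suc k)) \<longlonglongrightarrow> 0"
      using LIMSEQ_inverse_real_of_nat by (simp add: inverse_eq_divide)
    have "\<delta> \<longlonglongrightarrow> 0 ^ 3"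
      unfolding \<delta>_def power_one_over[symmetric] by (intro tendsto_power inv)
    then have "?bound \<longlonglongrightarrow> (sqrt 0 + L * (sqrt 2 * 0 * L2_norm \<omega> g)) * L2_norm \<omega> g + (L * 0 ^ 3 * (L2_norm \<omega> g)\<^sup>2 + 0)"
      by (intro tendsto_intros t inv)
    then have lim: "?bound \<longlonglongrightarrow> 0" by simp
    show "(\<lambda>k. ?b k + ?e k) \<longlonglongrightarrow> 0"
    proof (rule Lim_null_comparison[OF always_eventually[OF allI] lim])
      fix k
      note dec = band_decomposition[OF g \<delta>[of k] m[of k], folded t_def J_def u_def]
      have tail: "L2_norm \<omega> (\<lambda>x. g x - (\<Sum>j\<in>J k. u k j x)) = sqrt (t k)"
        using dec(1) real_sqrt_unique[OF _ L2_norm_nonneg] by metis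
      have "(\<Sum>j\<in>J k. L2_norm \<omega> (\<lambda>x. T (u k j) x - complex_of_real (a k j) * u k j x)) \<le> \<delta> k * (\<Sum>j\<in>J k. L2_norm \<omega> (u k j))"
        unfolding sum_distrib_left by (intro sum_mono band)
      also have "\<dots> \<le> \<delta> k * (sqrt (2 * of_int (m k)) * L2_norm \<omega> g)"
        using dec(2) \<delta>[of k] by (intro mult_left_mono) auto
      also have "\<delta> k * (sqrt (2 * of_int (m k)) * L2_norm \<omega> g) = sqrt 2 * (1 / real (Suc k)) * L2_norm \<omega> g"
      proof -
        have "sqrt (real (Suc k) ^ 4) = real (Suc k) ^ 2"
          by (rule real_sqrt_unique) (simp_all add: power_mult[symmetric])
        then have "\<delta> k * sqrt (2 * of_int (m k)) = sqrt 2 * (real (Suc k) ^ 2 / real (Suc k) ^ 3)"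
          by (simp add: m_def \<delta>_def real_sqrt_mult del: of_nat_Suc)
        also have "real (Suc k) ^ 2 / real (Suc k) ^ 3 = 1 / real (Suc k)"
          by (simp add: power_numeral_reduce field_simps del: of_nat_Suc)
        finally have e: "\<delta> k * sqrt (2 * of_int (m k)) = sqrt 2 * (1 / real (Suc k))" .
        show ?thesis unfolding mult.assoc[of "\<delta> k", symmetric] e ..
      qed
      finally have "?b k \<le> (sqrt (t k) + L * (sqrt 2 * (1 / real (Suc k)) * L2_norm \<omega> g)) * L2_norm \<omega> g"
        unfolding tail using L by (intro mult_right_mono add_left_mono mult_left_mono) auto
      moreover have "0 \<le> ?b k" using L by (intro mult_nonneg_nonneg add_nonneg_nonneg sum_nonneg) auto
      moreover have "0 \<le> ?e k" using L \<delta>[of k] unfolding t_def by (intro mult_nonneg_nonneg add_nonneg_nonneg) auto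
      ultimately show "norm (?b k + ?e k) \<le> ?bound k" by simp
    qed
  qed
qed

end

text \<open>
  Self-adjointness makes the Koopman operator an instance of the setting above: the
  quadrature limits in (iii) are the entries of its Gram and stiffness matrices, and (i) and (iv) are
  the two strong limits assumed there.
\<close>

theorem theorem4p6:
  fixes \<Omega> :: "(real ^ 'd) set"
    and \<omega> :: "(real ^ 'd) measure"
    and F :: "real ^ 'd \<Rightarrow> real ^ 'd"
    and D :: "(real ^ 'd \<Rightarrow> complex) set"
    and \<psi> :: "nat \<Rightarrow> real ^ 'd \<Rightarrow> complex"
    and x :: "nat \<Rightarrow> nat \<Rightarrow> real ^ 'd"
    and w :: "nat \<Rightarrow> nat \<Rightarrow> real"
    and E :: "real set \<Rightarrow> (real ^ 'd \<Rightarrow> complex) \<Rightarrow> real ^ 'd \<Rightarrow> complex"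
    and g :: "real ^ 'd \<Rightarrow> complex"
    and g_coeff :: "nat \<Rightarrow> complex Matrix.vec"
    and f :: "real \<Rightarrow> complex"
  assumes space: "space \<omega> = \<Omega>"
    and nonsingular: "nonsingular_map \<omega> F"
    and domain: "L2_operator \<omega> D (koopman F)"
    and dict_domain: "\<And>j. \<psi> j \<in> D"
    and dict_indep: "L2_lin_indep \<omega> \<psi>"
    and nodes: "\<And>M m. m < M \<Longrightarrow> x M m \<in> \<Omega>"
    and weights: "\<And>M m. m < M \<Longrightarrow> 0 \<le> w M m"
    and full_rank: "\<And>N. 1 \<le> N \<Longrightarrow> \<forall>\<^sub>F M in sequentially.
          vec_space.rank M (sqrt_weight_mat (w M) M * dict_mat \<psi> (x M) M N) = N"
    and proj_strong: "\<And>u. u \<in> L2 \<omega> \<Longrightarrow> L2_tendsto \<omega> (\<lambda>N. L2_proj \<omega> (dict_span \<psi> N) u) u"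
    and selfadjoint: "L2_selfadjoint \<omega> D (koopman F)"
    and quad_G: "\<And>N j k. j < N \<Longrightarrow> k < N \<Longrightarrow>
          (\<lambda>M. dmd_G \<psi> (x M) (w M) N M $$ (j, k)) \<longlonglongrightarrow> L2_inner \<omega> (\<psi> k) (\<psi> j)"
    and quad_A: "\<And>N j k. j < N \<Longrightarrow> k < N \<Longrightarrow>
          (\<lambda>M. dmd_A \<psi> F (x M) (w M) N M $$ (j, k))
            \<longlonglongrightarrow> L2_inner \<omega> (koopman F (\<psi> k)) (\<psi> j)"
    and koopman_conv: "\<And>u. u \<in> D \<Longrightarrow>
          L2_tendsto \<omega>
            (\<lambda>N. L2_proj \<omega> (dict_span \<psi> N) (koopman F (L2_proj \<omega> (dict_span \<psi> N) u)))
            (koopman F u)"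
    and spectral: "spectral_measure_of \<omega> D (koopman F) E"
    and g: "g \<in> L2 \<omega>"
    and g_coeff_dim: "\<And>N. g_coeff N \<in> carrier_vec N"
    and g_coeff: "\<And>N. AE y in \<omega>. L2_proj \<omega> (dict_span \<psi> N) g y = dict_comb \<psi> (g_coeff N) y"
    and g_coeff_conv: "\<And>N j. j < N \<Longrightarrow>
          (\<lambda>M. vec_index (coeff_vec \<psi> (x M) (w M) g N M) j) \<longlonglongrightarrow> vec_index (g_coeff N) j"
    and f_cont: "continuous_on UNIV f"
    and f_bdd: "bounded (range f)"
  shows "\<exists>L :: nat \<Rightarrow> complex.
     (\<forall>N\<ge>1. (\<lambda>M. LINT l|matrix_spectral_measure (dmd_G \<psi> (x M) (w M) N M)
                     (hermitian_dmd \<psi> F (x M) (w M) N M)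
                     (coeff_vec \<psi> (x M) (w M) g N M). f l) \<longlonglongrightarrow> L N) \<and>
     L \<longlonglongrightarrow> (LINT l|scalar_spectral_measure \<omega> E g. f l)"
proof -
  interpret spectral_galerkin \<omega> D "koopman F" E \<psi>
    by unfold_locales (fact selfadjoint spectral dict_domain dict_indep proj_strong koopman_conv)+
  let ?L = "\<lambda>N. LINT l|matrix_spectral_measure (gram N) (compression N) (g_coeff N). f l"
  show ?thesis
  proof (intro exI[of _ ?L] conjI allI impI)
    fix N :: nat
    show "(\<lambda>M. LINT l|matrix_spectral_measure (dmd_G \<psi> (x M) (w M) N M)
        (hermitian_dmd \<psi> F (x M) (w M) N M) (coeff_vec \<psi> (x M) (w M) g N M). f l) \<longlonglongrightarrow> ?L N"
    proof (rule hermitian_dmd_spectral_measure_tendsto[OF weights compression_selfadjoint g_coeff_dim _ _ _ f_cont f_bdd])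
      fix j k assume jk: "j < N" "k < N"
      show "(\<lambda>M. dmd_G \<psi> (x M) (w M) N M $$ (j, k)) \<longlonglongrightarrow> gram N $$ (j, k)"
        using quad_G[OF jk] jk by (simp add: gram_def)
      show "(\<lambda>M. dmd_A \<psi> F (x M) (w M) N M $$ (j, k)) \<longlonglongrightarrow> (gram N * compression N) $$ (j, k)"
        unfolding gram_compression using quad_A[OF jk] jk by (simp add: stiffness_def)
    qed (use weights g_coeff_conv in auto)
  next
    show "?L \<longlonglongrightarrow> (LINT l|scalar_spectral_measure \<omega> E g. f l)"
      using g g_coeff_dim g_coeff f_cont f_bdd by (rule galerkin_spectral_measure_tendsto)
  qed
qed

end
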